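(* Let $\mathbb{D}\in\mathbb{R}^{M\times M}$ be a symmetric or skew-symmetric matrix with $\mathbb{D}+\mathbb{D}^T\le 0$, let $r\ge 1$ be an integer and $s\ge 1$. Let $\mathbf{Y}$ be the solution of $\mathbf{Y}'=\mathbb{D}\mathbf{Y}+\mathbf{R}$ in $(0,T)$, $\mathbf{Y}(0)=\mathbf{Y}_0$, and assume that $\mathbf{R}\in[H^s(0,T)]^M$ and $\mathbf{Y}\in[W^{1+s,\infty}(0,T)]^M$. Let $\mathbf{Y}_r\in\mathbf{V}_\tau^r$ be the solution of the continuous time Galerkin method: $\mathbf{Y}_r(0)=\mathbf{Y}_0$ and $\mathbf{Y}_r'=\mathbb{D}\mathcal{P}_{r-1}\mathbf{Y}_r+\mathcal{P}_{r-1}\mathbf{R}$ in $I_n$, $0\le n\le N-1$. Then $$\|\mathbf{Y}-\mathbf{Y}_r\|_{L^2(0,T)}\le C(1+T)\frac{\tau^{\min(r+1,s)}}{r^s}\left(\|\mathbf{Y}\|_{H^s(0,T)}+\|\mathbb{D}\mathbf{Y}\|_{H^s(0,T)}\right),$$ $$\max_{0\le t\le T}\|(\mathbf{Y}-\mathbf{Y}_r)(t)\|_{\mathbb{R}^M}\le C(1+T^{1/2})\frac{\tau^{\min(r+1,s)}}{r^{s-1}}\left(T^{1/2}\|\mathbf{Y}\|_{W^{s+1,\infty}(0,T)}+\|\mathbf{R}\|_{H^s(0,T)}\right),$$ where the constant $C$ is independent of $\tau,r,\mathbb{D}$, and $\mathbf{R}$ but may depend on $s$.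
   Context: $T>0$; $M\ge 1$; $\mathbb{D}+\mathbb{D}^T\le 0$ means negative semidefinite. $0=t_0<t_1<\cdots<t_N=T$ is a partition, $I_n=(t_n,t_{n+1})$, $\tau_n=t_{n+1}-t_n$, $\tau=\max_{0\le n\le N-1}\tau_n$. $P^m$ is the set of polynomials of degree at most $m$. $\mathbf{V}_\tau^m$ ($m\ge 1$) is the space of continuous functions $\mathbf{v}:[0,T]\to\mathbb{R}^M$ with $\mathbf{v}|_{I_n}\in[P^m]^M$ for all $0\le n\le N-1$. For $m\ge 0$, $\mathcal{P}_m$ is the local $L^2$ projection: on each $I_n$, $\mathcal{P}_m\mathbf{v}\in[P^m]^M$ and $\int_{I_n}(\mathcal{P}_m\mathbf{v},\mathbf{w})\,dt=\int_{I_n}(\mathbf{v},\mathbf{w})\,dt$ for all $\mathbf{w}\in[P^m]^M$. The discrete problem has a unique solution. $H^s$, $W^{s,\infty}$ are the usual Sobolev spaces; the norm of a vector-valued function in $[X]^M$ is written $\|\cdot\|_X$. As usual, the generic constant $C$ does not depend on the data $\mathbf{Y}_0,\mathbf{R}$ or on the solution. *)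

theory Defs
  imports
    "HOL-Analysis.Analysis"
    "HOL-Probability.Essential_Supremum"
    "Jordan_Normal_Form.Matrix"
begin

unbundle no vec_syntax
no_notation inner (infix "\<bullet>" 70)

text \<open>
  The dimension \<open>M\<close> is a variable, so that a constant may be chosen before \<open>M\<close> and the matrix:
  vectors of dimension \<open>M\<close> are elements of \<^term>\<open>carrier_vec M\<close>.
\<close>

definition vnorm :: "real Matrix.vec \<Rightarrow> real" where
  "vnorm v = sqrt (v \<bullet> v)"

definition neg_semidef :: "nat \<Rightarrow> real mat \<Rightarrow> bool" where
  "neg_semidef M A \<longleftrightarrow> (\<forall>x\<in>carrier_vec M. x \<bullet> (A *\<^sub>v x) \<le> 0)"


section \<open>Weak derivatives and Sobolev spaces on a bounded interval\<close>

definition test_fun :: "real \<Rightarrow> real \<Rightarrow> (real \<Rightarrow> real) \<Rightarrow> bool" where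
  "test_fun a b \<phi> \<longleftrightarrow>
     (\<forall>n x. (deriv ^^ n) \<phi> field_differentiable at x) \<and>
     compact (closure {x. \<phi> x \<noteq> 0}) \<and> closure {x. \<phi> x \<noteq> 0} \<subseteq> {a<..<b}"

definition locally_integrable :: "real \<Rightarrow> real \<Rightarrow> (real \<Rightarrow> real) \<Rightarrow> bool" where
  "locally_integrable a b u \<longleftrightarrow>
     (\<forall>c d. a < c \<longrightarrow> d < b \<longrightarrow> set_integrable lebesgue {c..d} u)"

definition weak_deriv :: "real \<Rightarrow> real \<Rightarrow> nat \<Rightarrow> (real \<Rightarrow> real) \<Rightarrow> (real \<Rightarrow> real) \<Rightarrow> bool" where
  "weak_deriv a b k u v \<longleftrightarrow>
     locally_integrable a b u \<and> locally_integrable a b v \<and>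
     (\<forall>\<phi>. test_fun a b \<phi> \<longrightarrow>
        (LINT x:{a<..<b}|lebesgue. u x * (deriv ^^ k) \<phi> x) =
        (- 1) ^ k * (LINT x:{a<..<b}|lebesgue. v x * \<phi> x))"

text \<open>
  The weak derivative is unique up to a null set; \<open>wderiv\<close> selects a representative. It is only
  meaningful where a weak derivative exists, which the membership predicates below require.
\<close>

definition wderiv :: "real \<Rightarrow> real \<Rightarrow> nat \<Rightarrow> (real \<Rightarrow> real) \<Rightarrow> real \<Rightarrow> real" where
  "wderiv a b k u = (SOME v. weak_deriv a b k u v)"

definition vderiv ::
    "nat \<Rightarrow> real \<Rightarrow> real \<Rightarrow> nat \<Rightarrow> (real \<Rightarrow> real Matrix.vec) \<Rightarrow> real \<Rightarrow> real Matrix.vec" where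
  "vderiv M a b k v x = Matrix.vec M (\<lambda>i. wderiv a b k (\<lambda>y. v y $ i) x)"

definition weakly_differentiable ::
    "nat \<Rightarrow> real \<Rightarrow> real \<Rightarrow> nat \<Rightarrow> (real \<Rightarrow> real Matrix.vec) \<Rightarrow> bool" where
  "weakly_differentiable M a b k v \<longleftrightarrow>
     v \<in> {a<..<b} \<rightarrow> carrier_vec M \<and>
     (\<forall>i<M. \<forall>j\<le>k. \<exists>w. weak_deriv a b j (\<lambda>x. v x $ i) w)"

definition L2_norm_on :: "real \<Rightarrow> real \<Rightarrow> (real \<Rightarrow> real Matrix.vec) \<Rightarrow> real" where
  "L2_norm_on a b v = sqrt (LINT x:{a<..<b}|lebesgue. (vnorm (v x))\<^sup>2)"

text \<open>
  The order \<open>s \<ge> 0\<close> is real. With \<open>k = \<lfloor>s\<rfloor>\<close> and \<open>\<sigma> = s - k\<close>, the spaces for \<open>\<sigma> > 0\<close> are the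
  Sobolev-Slobodeckij space \<open>H\<^sup>s = W\<^sup>s\<^sup>,\<^sup>2\<close> and the Hoelder-Slobodeckij space \<open>W\<^sup>s\<^sup>,\<^sup>\<infinity>\<close>: the seminorm of
  order \<open>\<sigma>\<close> of the \<open>k\<close>-th derivative is added to the norm of order \<open>k\<close>.
\<close>

definition H_norm_sq :: "nat \<Rightarrow> real \<Rightarrow> real \<Rightarrow> real \<Rightarrow> (real \<Rightarrow> real Matrix.vec) \<Rightarrow> ennreal" where
  "H_norm_sq M a b s v =
     (\<Sum>j\<le>nat \<lfloor>s\<rfloor>. \<integral>\<^sup>+x. ennreal ((vnorm (vderiv M a b j v x))\<^sup>2) \<partial>lebesgue_on {a<..<b}) +
     (if frac s = 0 then 0
      else \<integral>\<^sup>+x. \<integral>\<^sup>+y. ennreal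
             ((vnorm (vderiv M a b (nat \<lfloor>s\<rfloor>) v x - vderiv M a b (nat \<lfloor>s\<rfloor>) v y))\<^sup>2
                / \<bar>x - y\<bar> powr (1 + 2 * frac s))
             \<partial>lebesgue_on {a<..<b} \<partial>lebesgue_on {a<..<b})"

definition H_space :: "nat \<Rightarrow> real \<Rightarrow> real \<Rightarrow> real \<Rightarrow> (real \<Rightarrow> real Matrix.vec) set" where
  "H_space M a b s =
     {v. weakly_differentiable M a b (nat \<lfloor>s\<rfloor>) v \<and> H_norm_sq M a b s v < \<infinity>}"

definition H_norm :: "nat \<Rightarrow> real \<Rightarrow> real \<Rightarrow> real \<Rightarrow> (real \<Rightarrow> real Matrix.vec) \<Rightarrow> real" where
  "H_norm M a b s v = sqrt (enn2real (H_norm_sq M a b s v))"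

definition Winf_enorm :: "nat \<Rightarrow> real \<Rightarrow> real \<Rightarrow> real \<Rightarrow> (real \<Rightarrow> real Matrix.vec) \<Rightarrow> ereal" where
  "Winf_enorm M a b s v =
     max (MAX j\<in>{..nat \<lfloor>s\<rfloor>}.
            esssup (lebesgue_on {a<..<b}) (\<lambda>x. ereal (vnorm (vderiv M a b j v x))))
         (if frac s = 0 then 0
          else esssup (lebesgue_on {a<..<b} \<Otimes>\<^sub>M lebesgue_on {a<..<b})
                 (\<lambda>(x, y). ereal
                    (vnorm (vderiv M a b (nat \<lfloor>s\<rfloor>) v x - vderiv M a b (nat \<lfloor>s\<rfloor>) v y)
                       / \<bar>x - y\<bar> powr frac s)))"

definition Winf_space :: "nat \<Rightarrow> real \<Rightarrow> real \<Rightarrow> real \<Rightarrow> (real \<Rightarrow> real Matrix.vec) set" where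
  "Winf_space M a b s =
     {v. weakly_differentiable M a b (nat \<lfloor>s\<rfloor>) v \<and> Winf_enorm M a b s v < \<infinity>}"

definition Winf_norm :: "nat \<Rightarrow> real \<Rightarrow> real \<Rightarrow> real \<Rightarrow> (real \<Rightarrow> real Matrix.vec) \<Rightarrow> real" where
  "Winf_norm M a b s v = real_of_ereal (Winf_enorm M a b s v)"


section \<open>The initial value problem and the continuous time Galerkin method\<close>

text \<open>
  The right-hand side is only a Sobolev function, so the equation holds in the sense of weak
  derivatives; \<open>Y\<close> is the representative that is continuous up to the boundary.
\<close>

definition ivp_solution ::
    "nat \<Rightarrow> real \<Rightarrow> real mat \<Rightarrow> (real \<Rightarrow> real Matrix.vec) \<Rightarrow> real Matrix.vec \<Rightarrow>
     (real \<Rightarrow> real Matrix.vec) \<Rightarrow> bool" where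
  "ivp_solution M T D R Y0 Y \<longleftrightarrow>
     Y \<in> {0..T} \<rightarrow> carrier_vec M \<and>
     (\<forall>i<M. continuous_on {0..T} (\<lambda>x. Y x $ i)) \<and>
     Y 0 = Y0 \<and>
     (\<forall>i<M. weak_deriv 0 T 1 (\<lambda>x. Y x $ i) (\<lambda>x. (D *\<^sub>v Y x + R x) $ i))"

definition is_partition :: "real \<Rightarrow> nat \<Rightarrow> (nat \<Rightarrow> real) \<Rightarrow> bool" where
  "is_partition T N t \<longleftrightarrow> t 0 = 0 \<and> t N = T \<and> (\<forall>n<N. t n < t (Suc n))"

definition mesh_size :: "nat \<Rightarrow> (nat \<Rightarrow> real) \<Rightarrow> real" where
  "mesh_size N t = (MAX n\<in>{..<N}. t (Suc n) - t n)"

definition vpolys :: "nat \<Rightarrow> nat \<Rightarrow> real poly Matrix.vec set" where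
  "vpolys M m = {p \<in> carrier_vec M. \<forall>i<M. degree (p $ i) \<le> m}"

definition veval :: "real poly Matrix.vec \<Rightarrow> real \<Rightarrow> real Matrix.vec" where
  "veval p x = map_vec (\<lambda>c. poly c x) p"

definition V_space :: "nat \<Rightarrow> nat \<Rightarrow> real \<Rightarrow> nat \<Rightarrow> (nat \<Rightarrow> real) \<Rightarrow> (real \<Rightarrow> real Matrix.vec) set" where
  "V_space M m T N t =
     {v. v \<in> {0..T} \<rightarrow> carrier_vec M \<and>
         (\<forall>i<M. continuous_on {0..T} (\<lambda>x. v x $ i)) \<and>
         (\<forall>n<N. \<exists>p\<in>vpolys M m. \<forall>x\<in>{t n<..<t (Suc n)}. v x = veval p x)}"

text \<open>The \<open>L\<^sup>2\<close> projection onto polynomials of degree at most \<open>m\<close> on one interval \<open>(a, b)\<close>.\<close>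

definition L2_proj ::
    "nat \<Rightarrow> nat \<Rightarrow> real \<Rightarrow> real \<Rightarrow> (real \<Rightarrow> real Matrix.vec) \<Rightarrow> real poly Matrix.vec" where
  "L2_proj M m a b v =
     (THE p. p \<in> vpolys M m \<and>
        (\<forall>w\<in>vpolys M m. (LINT x:{a<..<b}|lebesgue. veval p x \<bullet> veval w x) =
                        (LINT x:{a<..<b}|lebesgue. v x \<bullet> veval w x)))"

definition galerkin_solution ::
    "nat \<Rightarrow> nat \<Rightarrow> real \<Rightarrow> nat \<Rightarrow> (nat \<Rightarrow> real) \<Rightarrow> real mat \<Rightarrow> (real \<Rightarrow> real Matrix.vec) \<Rightarrow>
     real Matrix.vec \<Rightarrow> (real \<Rightarrow> real Matrix.vec) \<Rightarrow> bool" where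
  "galerkin_solution M r T N t D R Y0 Yr \<longleftrightarrow>
     Yr \<in> V_space M r T N t \<and>
     Yr 0 = Y0 \<and>
     (\<forall>n<N. \<forall>x\<in>{t n<..<t (Suc n)}. \<forall>i<M.
        ((\<lambda>y. Yr y $ i) has_real_derivative
           (D *\<^sub>v veval (L2_proj M (r - 1) (t n) (t (Suc n)) Yr) x +
            veval (L2_proj M (r - 1) (t n) (t (Suc n)) R) x) $ i) (at x))"

end

(*
Let Pi Y be the continuous piecewise polynomial with (Pi Y)' = P_(r-1) Y' that agrees with Y at the
nodes, and write Y - Yr = eta + theta with eta = Y - Pi Y.  On each interval
theta' = D P theta + P (D eta).  Testing with P theta bounds the nodal values of theta.  Testing
with the projection of (t_(n+1) - t) P theta bounds theta inside the interval, uniformly in D and r,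
because (t_(n+1) - t) theta' = - r theta up to lower degree makes the error of replacing P theta by
theta have the right sign.  Only D + D^T <= 0 enters.  The maximum norm then costs one power of r
through the inverse inequality.

The projection errors come from one inequality, E_n(v) <= (h/n) E_(n-1)(v') for the L2 distance
E_n to the polynomials of degree less than n, which is the spectral gap of the Legendre operator.
Iterating it consumes the integer derivatives; the fractional remainder follows by comparison with
the piecewise linear interpolant of averages over n cells.  The bound on eta itself is the dual of
the same inequality.
*)
theory Submission
  imports Defs
begin

section \<open>Square integrable functions on an interval\<close>

text \<open>The energy argument at the nodes sees only P theta, while the load has to be absorbed by
  theta itself. Therefore Young's parameter stays free until the end: \<open>1 / (4 * T)\<close> for
  the sum over all intervals, \<open>1 / (2 * h n)\<close> on a single one. \<open>D\<close>
  multiplies only eta. It commutes with projections and primitives, so D eta is the integrated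
  projection error of D Y'. This function is read in two ways: as the derivative of D Y for the L2
  estimate, and as Y'' - R' for the maximum norm, whose bound thereby contains no \<open>D\<close>.
  Each squared Sobolev norm is the integral of one density. On a cell this density bounds the local
  seminorm, so local bounds add up to the global norm without a further constant, although the
  Slobodeckij double integral is not additive over cells. Summation over components happens inside
  every estimate, hence \<open>M\<close> never enters a constant. On the analytic side everything is
  reduced to primitives of L2 functions; weak derivatives are translated into these once.\<close>

abbreviation mu :: "real \<Rightarrow> real \<Rightarrow> real measure" where
  "mu a b \<equiv> lebesgue_on {a<..<b}"

definition L2 :: "real \<Rightarrow> real \<Rightarrow> (real \<Rightarrow> real) \<Rightarrow> bool" where
  "L2 a b f \<longleftrightarrow> f \<in> borel_measurable (mu a b) \<and> integrable (mu a b) (\<lambda>x. (f x)\<^sup>2)"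

lemma finite_measure_mu: "finite_measure (mu a b)"
  by (cases "a \<le> b") (auto intro!: finite_measureI simp: emeasure_restrict_space)

lemma measure_mu: "a \<le> b \<Longrightarrow> measure (mu a b) {a<..<b} = b - a"
  by (simp add: measure_restrict_space)

lemma integral_mu_const: "a \<le> b \<Longrightarrow> integral\<^sup>L (mu a b) (\<lambda>x. c :: real) = c * (b - a)"
  by (simp add: measure_mu)

lemma integrable_mu_const: "integrable (mu a b) (\<lambda>x. c :: real)"
  using finite_measure.integrable_const[OF finite_measure_mu] .

lemma integrable_mu_bounded:
  assumes "f \<in> borel_measurable (mu a b)" "\<And>x. x \<in> {a<..<b} \<Longrightarrow> \<bar>f x :: real\<bar> \<le> B"
  shows "integrable (mu a b) f"
  by (rule finite_measure.integrable_const_bound[OF finite_measure_mu, of _ B])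
    (use assms in \<open>auto intro!: AE_I2\<close>)

lemma continuous_measurable_mu:
  assumes "continuous_on {a<..<b} (f :: real \<Rightarrow> real)"
  shows "f \<in> borel_measurable (mu a b)"
  using assms by (rule continuous_imp_measurable_on_sets_lebesgue) simp

lemma integrable_mu_continuous:
  assumes "continuous_on {a..b} (f :: real \<Rightarrow> real)"
  shows "integrable (mu a b) f"
proof -
  have "bounded (f ` {a..b})"
    by (intro compact_imp_bounded compact_continuous_image assms compact_Icc)
  then obtain B where B: "\<And>x. x \<in> {a..b} \<Longrightarrow> \<bar>f x\<bar> \<le> B"
    unfolding bounded_iff by (metis imageI real_norm_def)
  show ?thesis
    by (rule integrable_mu_bounded[where B = B])
      (auto intro!: continuous_measurable_mu B continuous_on_subset[OF assms])
qed

lemma L2_measurable: "L2 a b f \<Longrightarrow> f \<in> borel_measurable (mu a b)"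
  by (simp add: L2_def)

lemma L2_square: "L2 a b f \<Longrightarrow> integrable (mu a b) (\<lambda>x. (f x)\<^sup>2)"
  by (simp add: L2_def)

lemma L2_continuous: "continuous_on {a..b} f \<Longrightarrow> L2 a b f"
  unfolding L2_def
  by (auto intro!: integrable_mu_continuous continuous_intros continuous_measurable_mu
      intro: continuous_on_subset)

lemma L2_poly: "L2 a b (poly p)"
  by (intro L2_continuous continuous_intros)

lemma L2_const: "L2 a b (\<lambda>x. c)"
  by (intro L2_continuous continuous_intros)

lemma L2_mult_integrable:
  assumes "L2 a b f" "L2 a b g"
  shows "integrable (mu a b) (\<lambda>x. f x * g x)"
proof (rule Bochner_Integration.integrable_bound)
  show "integrable (mu a b) (\<lambda>x. (f x)\<^sup>2 + (g x)\<^sup>2)"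
    using assms by (auto simp: L2_def)
  show "(\<lambda>x. f x * g x) \<in> borel_measurable (mu a b)"
    using assms by (auto simp: L2_def intro: borel_measurable_times)
  have "\<bar>f x * g x\<bar> \<le> \<bar>(f x)\<^sup>2 + (g x)\<^sup>2\<bar>" for x
  proof -
    have "2 * (\<bar>f x\<bar> * \<bar>g x\<bar>) \<le> (f x)\<^sup>2 + (g x)\<^sup>2"
      using sum_squares_bound[of "\<bar>f x\<bar>" "\<bar>g x\<bar>"] by simp
    moreover have "0 \<le> \<bar>f x\<bar> * \<bar>g x\<bar>" by simp
    ultimately show ?thesis unfolding abs_mult by linarith
  qed
  then show "AE x in mu a b. norm (f x * g x) \<le> norm ((f x)\<^sup>2 + (g x)\<^sup>2)"
    by auto
qed

lemma L2_integrable: "L2 a b f \<Longrightarrow> integrable (mu a b) f"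
  using L2_mult_integrable[OF _ L2_const[of a b 1]] by simp

lemma L2_bounded:
  assumes "f \<in> borel_measurable (mu a b)" "\<And>x. x \<in> {a<..<b} \<Longrightarrow> \<bar>f x\<bar> \<le> B"
  shows "L2 a b f"
  unfolding L2_def
proof
  show "integrable (mu a b) (\<lambda>x. (f x)\<^sup>2)"
  proof (rule integrable_mu_bounded[where B = "B\<^sup>2"])
    show "(\<lambda>x. (f x)\<^sup>2) \<in> borel_measurable (mu a b)" using assms(1) by measurable
    show "\<bar>(f x)\<^sup>2\<bar> \<le> B\<^sup>2" if "x \<in> {a<..<b}" for x
      using power_mono[OF assms(2)[OF that], of 2] by simp
  qed
qed (rule assms)

lemma L2_add: "L2 a b f \<Longrightarrow> L2 a b g \<Longrightarrow> L2 a b (\<lambda>x. f x + g x)"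
  using L2_mult_integrable[of a b f g] unfolding L2_def power2_sum
  by (auto simp: mult.assoc)

lemma L2_cmult: "L2 a b f \<Longrightarrow> L2 a b (\<lambda>x. c * f x)"
  unfolding L2_def power_mult_distrib by auto

lemma L2_minus: "L2 a b f \<Longrightarrow> L2 a b (\<lambda>x. - f x)"
  using L2_cmult[of a b f "-1"] by simp

lemma L2_diff: "L2 a b f \<Longrightarrow> L2 a b g \<Longrightarrow> L2 a b (\<lambda>x. f x - g x)"
  using L2_add[OF _ L2_minus, of a b f g] by simp

lemma L2_sum: "(\<And>i. i \<in> I \<Longrightarrow> L2 a b (f i)) \<Longrightarrow> L2 a b (\<lambda>x. \<Sum>i\<in>I. f i x)"
  by (induction I rule: infinite_finite_induct) (auto intro!: L2_add L2_const)

text \<open>Completeness of Lebesgue measure keeps an a.e. modification measurable; extension by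
  zero reduces this to the whole line.\<close>

lemma L2_cong_AE:
  assumes "L2 a b f" "AE x in mu a b. f x = g x"
  shows "L2 a b g"
proof -
  have "(\<lambda>x. if x \<in> {a<..<b} then f x else 0) \<in> borel_measurable lebesgue"
    using assms(1) by (intro borel_measurable_if_I) (auto simp: L2_def)
  then have "(\<lambda>x. if x \<in> {a<..<b} then g x else 0) \<in> borel_measurable lebesgue"
  proof (rule borel_measurable_AE)
    show "AE x in lebesgue. (if x \<in> {a<..<b} then f x else 0) = (if x \<in> {a<..<b} then g x else 0)"
      using assms(2) by (auto simp: AE_restrict_space_iff elim!: eventually_mono)
  qed
  then have m: "g \<in> borel_measurable (mu a b)"
    by (rule borel_measurable_if_D)
  have "integrable (mu a b) (\<lambda>x. (g x)\<^sup>2) = integrable (mu a b) (\<lambda>x. (f x)\<^sup>2)"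
    using m assms by (intro integrable_cong_AE) (auto simp: L2_def)
  then show ?thesis using m assms(1) by (simp add: L2_def)
qed

lemma mu_subset: "a \<le> c \<Longrightarrow> d \<le> b \<Longrightarrow> mu c d = restrict_space (mu a b) {c<..<d}"
  by (simp add: restrict_restrict_space)

lemma integrable_mu_subset:
  assumes "integrable (mu a b) (f :: real \<Rightarrow> real)" "a \<le> c" "d \<le> b"
  shows "integrable (mu c d) f"
proof -
  have "{c<..<d} \<subseteq> {a<..<b}" using assms(2,3) by auto
  moreover have "set_integrable lebesgue {a<..<b} f"
    using assms(1) by (simp add: set_integrable_eq)
  ultimately have "set_integrable lebesgue {c<..<d} f"
    by (auto intro: set_integrable_subset)
  then show ?thesis by (simp add: set_integrable_eq)
qed

lemma measurable_mu_subset: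
  assumes "f \<in> borel_measurable (mu a b)" "a \<le> c" "d \<le> b"
  shows "f \<in> borel_measurable (mu c d)"
  using measurable_restrict_space1[OF assms(1), of "{c<..<d}"] by (simp flip: mu_subset[OF assms(2,3)])

lemma AE_mu_subset:
  assumes "AE x in mu a b. P x" "a \<le> c" "d \<le> b"
  shows "AE x in mu c d. P x"
  using assms by (auto simp: AE_restrict_space_iff elim!: eventually_mono)

lemma L2_subset: "L2 a b f \<Longrightarrow> a \<le> c \<Longrightarrow> d \<le> b \<Longrightarrow> L2 c d f"
  unfolding L2_def by (auto intro: integrable_mu_subset measurable_mu_subset)

lemma cauchy_schwarz_L2:
  assumes "L2 a b f" "L2 a b g"
  shows "(integral\<^sup>L (mu a b) (\<lambda>x. f x * g x))\<^sup>2
    \<le> integral\<^sup>L (mu a b) (\<lambda>x. (f x)\<^sup>2) * integral\<^sup>L (mu a b) (\<lambda>x. (g x)\<^sup>2)"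
proof -
  let ?I = "\<lambda>f. integral\<^sup>L (mu a b) f"
  have nonneg: "0 \<le> ?I (\<lambda>x. (f x)\<^sup>2) + 2 * t * ?I (\<lambda>x. f x * g x) + t\<^sup>2 * ?I (\<lambda>x. (g x)\<^sup>2)" for t
  proof -
    have "0 \<le> ?I (\<lambda>x. (f x + t * g x)\<^sup>2)" by simp
    also have "(\<lambda>x. (f x + t * g x)\<^sup>2) = (\<lambda>x. (f x)\<^sup>2 + 2 * t * (f x * g x) + t\<^sup>2 * (g x)\<^sup>2)"
      by (auto simp: power2_eq_square algebra_simps)
    also have "?I \<dots> = ?I (\<lambda>x. (f x)\<^sup>2) + 2 * t * ?I (\<lambda>x. f x * g x) + t\<^sup>2 * ?I (\<lambda>x. (g x)\<^sup>2)"
      using assms L2_mult_integrable[OF assms] by (simp add: L2_def)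
    finally show ?thesis .
  qed
  show ?thesis
  proof (cases "?I (\<lambda>x. (g x)\<^sup>2) = 0")
    case True
    have "?I (\<lambda>x. f x * g x) = 0"
    proof (rule ccontr)
      assume "?I (\<lambda>x. f x * g x) \<noteq> 0"
      then show False
        \<comment> \<open>With vanishing quadratic coefficient the polynomial is affine in
          \<open>t\<close>, and its value at this point is -1.\<close>
        using nonneg[of "- (?I (\<lambda>x. (f x)\<^sup>2) + 1) / (2 * ?I (\<lambda>x. f x * g x))"] True
          by (simp add: field_simps)
    qed
    then show ?thesis using True by simp
  next
    case False
    then have pos: "?I (\<lambda>x. (g x)\<^sup>2) > 0" by (simp add: less_le)
    show ?thesis
      \<comment> \<open>The minimiser of the quadratic polynomial.\<close>
      using mult_left_mono[OF nonneg[of "- ?I (\<lambda>x. f x * g x) / ?I (\<lambda>x. (g x)\<^sup>2)"], of "?I (\<lambda>x. (g x)\<^sup>2)"] pos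
      by (simp add: field_simps power2_eq_square)
  qed
qed

lemma integral_mu_split:
  assumes "integrable (mu a b) (f :: real \<Rightarrow> real)" "a \<le> c" "c \<le> b"
  shows "integral\<^sup>L (mu a b) f = integral\<^sup>L (mu a c) f + integral\<^sup>L (mu c b) f"
proof -
  have *: "integral\<^sup>L (mu u v) f = integral {u..v} f \<and> f integrable_on {u..v}" if "a \<le> u" "v \<le> b" for u v
  proof -
    have "integrable (mu u v) f" by (rule integrable_mu_subset[OF assms(1) that])
    then have "(f has_integral integral\<^sup>L (mu u v) f) {u<..<v}"
      by (rule has_integral_integral_lebesgue_on) simp
    then have "(f has_integral integral\<^sup>L (mu u v) f) {u..v}"
      by (simp add: has_integral_Icc_iff_Ioo)
    then show ?thesis
      by (metis integral_unique has_integral_integrable)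
  qed
  show ?thesis
    using *[of a b] *[of a c] *[of c b] assms Henstock_Kurzweil_Integration.integral_combine[of a c b f] by auto
qed

lemma nn_integral_mu_subset:
  assumes "a \<le> c" "d \<le> b"
  shows "(\<integral>\<^sup>+x. f x \<partial>mu c d) \<le> (\<integral>\<^sup>+x. f x \<partial>mu a b)"
  using assms by (auto simp: nn_integral_restrict_space split: split_indicator intro!: nn_integral_mono)

lemma nn_integral_mu_split:
  assumes "f \<in> borel_measurable (mu a b)" "a \<le> c" "c \<le> b"
  shows "(\<integral>\<^sup>+x. f x \<partial>mu a b) = (\<integral>\<^sup>+x. f x \<partial>mu a c) + (\<integral>\<^sup>+x. f x \<partial>mu c b)"
proof -
  have m: "(\<lambda>x. f x * indicator {u<..<v} x) \<in> borel_measurable lebesgue" if "a \<le> u" "v \<le> b" for u v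
  proof -
    have "f \<in> borel_measurable (mu u v)" using assms(1) that by (rule measurable_mu_subset)
    then show ?thesis by (simp add: borel_measurable_restrict_space_iff_ennreal)
  qed
  have "AE x in lebesgue. f x * indicator {a<..<b} x
      = f x * indicator {a<..<c} x + f x * indicator {c<..<b} x"
  proof (rule AE_I'[of "{c}"])
    show "{c} \<in> null_sets lebesgue" by simp
  qed (use assms in \<open>auto split: split_indicator\<close>)
  then have "(\<integral>\<^sup>+x. f x * indicator {a<..<b} x \<partial>lebesgue)
      = (\<integral>\<^sup>+x. f x * indicator {a<..<c} x + f x * indicator {c<..<b} x \<partial>lebesgue)"
    by (rule nn_integral_cong_AE)
  also have "\<dots> = (\<integral>\<^sup>+x. f x * indicator {a<..<c} x \<partial>lebesgue) + (\<integral>\<^sup>+x. f x * indicator {c<..<b} x \<partial>lebesgue)"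
    using assms by (intro nn_integral_add m) auto
  finally show ?thesis by (simp add: nn_integral_restrict_space)
qed

text \<open>The end points are written \<open>t 0\<close> and \<open>t N\<close>, so that the
  induction on \<open>N\<close> goes through; callers fold them with the equations for the first and
  last node.\<close>

lemma integral_mu_partition:
  assumes "integrable (mu (t 0) (t N)) (f :: real \<Rightarrow> real)" "\<And>n. n < N \<Longrightarrow> t n \<le> t (Suc n)"
  shows "integral\<^sup>L (mu (t 0) (t N)) f = (\<Sum>n<N. integral\<^sup>L (mu (t n) (t (Suc n))) f)"
  using assms
proof (induction N)
  case (Suc N)
  have le: "t 0 \<le> t N" using Suc.prems(2) by (induction N) (auto intro: order_trans)
  have "integrable (mu (t 0) (t N)) f"
    using Suc.prems by (intro integrable_mu_subset[OF Suc.prems(1)]) auto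
  then show ?case
    using Suc integral_mu_split[OF Suc.prems(1) le] by simp
qed simp

lemma nn_integral_mu_partition:
  assumes "f \<in> borel_measurable (mu (t 0) (t N))" "\<And>n. n < N \<Longrightarrow> t n \<le> t (Suc n)"
  shows "(\<integral>\<^sup>+x. f x \<partial>mu (t 0) (t N)) = (\<Sum>n<N. \<integral>\<^sup>+x. f x \<partial>mu (t n) (t (Suc n)))"
  using assms
proof (induction N)
  case (Suc N)
  have le: "t 0 \<le> t N" using Suc.prems(2) by (induction N) (auto intro: order_trans)
  have "f \<in> borel_measurable (mu (t 0) (t N))"
    using Suc.prems by (intro measurable_mu_subset[OF Suc.prems(1)]) auto
  then show ?case
    using Suc nn_integral_mu_split[OF Suc.prems(1) le] by simp
qed (simp add: nn_integral_restrict_space)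

section \<open>Polynomials in L2 and the projection\<close>

definition ip :: "real \<Rightarrow> real \<Rightarrow> (real \<Rightarrow> real) \<Rightarrow> (real \<Rightarrow> real) \<Rightarrow> real" where
  "ip a b f g = integral\<^sup>L (mu a b) (\<lambda>x. f x * g x)"

definition nsq :: "real \<Rightarrow> real \<Rightarrow> (real \<Rightarrow> real) \<Rightarrow> real" where
  "nsq a b f = integral\<^sup>L (mu a b) (\<lambda>x. (f x)\<^sup>2)"

lemma ip_self: "ip a b f f = nsq a b f"
  by (simp add: ip_def nsq_def power2_eq_square)

lemma ip_commute: "ip a b f g = ip a b g f"
  by (simp add: ip_def mult.commute)

lemma ip_add_left: "L2 a b f \<Longrightarrow> L2 a b g \<Longrightarrow> L2 a b h \<Longrightarrow>
    ip a b (\<lambda>x. f x + g x) h = ip a b f h + ip a b g h"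
  by (simp add: ip_def distrib_right L2_mult_integrable)

lemma ip_diff_left: "L2 a b f \<Longrightarrow> L2 a b g \<Longrightarrow> L2 a b h \<Longrightarrow>
    ip a b (\<lambda>x. f x - g x) h = ip a b f h - ip a b g h"
  by (simp add: ip_def left_diff_distrib L2_mult_integrable)

lemma ip_cmult_left: "ip a b (\<lambda>x. c * f x) h = c * ip a b f h"
  by (simp add: ip_def mult.assoc)

lemma ip_add_right: "L2 a b f \<Longrightarrow> L2 a b g \<Longrightarrow> L2 a b h \<Longrightarrow>
    ip a b h (\<lambda>x. f x + g x) = ip a b h f + ip a b h g"
  using ip_add_left[of a b f g h] by (simp add: ip_commute)

lemma ip_diff_right: "L2 a b f \<Longrightarrow> L2 a b g \<Longrightarrow> L2 a b h \<Longrightarrow>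
    ip a b h (\<lambda>x. f x - g x) = ip a b h f - ip a b h g"
  using ip_diff_left[of a b f g h] by (simp add: ip_commute)

lemma ip_cmult_right: "ip a b h (\<lambda>x. c * f x) = c * ip a b h f"
  using ip_cmult_left[of a b c f h] by (simp add: ip_commute)

lemma nsq_nonneg: "0 \<le> nsq a b f"
  by (simp add: nsq_def)

lemma ip_cong_AE:
  assumes "AE x in mu a b. f x = f' x" "L2 a b f" "L2 a b h"
  shows "ip a b f h = ip a b f' h"
  unfolding ip_def
  using assms L2_cong_AE[OF assms(2,1)] by (intro integral_cong_AE) (auto simp: L2_def)

lemma nsq_cong_AE:
  assumes "AE x in mu a b. f x = f' x" "L2 a b f"
  shows "nsq a b f = nsq a b f'"
  unfolding nsq_def
  using assms L2_cong_AE[OF assms(2,1)] by (intro integral_cong_AE) (auto simp: L2_def)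

lemma cs_ip: "L2 a b f \<Longrightarrow> L2 a b g \<Longrightarrow> (ip a b f g)\<^sup>2 \<le> nsq a b f * nsq a b g"
  unfolding ip_def nsq_def by (rule cauchy_schwarz_L2)

lemma nsq_mono:
  assumes "L2 a b f" "L2 a b g" "\<And>x. x \<in> {a<..<b} \<Longrightarrow> (f x)\<^sup>2 \<le> (g x)\<^sup>2"
  shows "nsq a b f \<le> nsq a b g"
  unfolding nsq_def using assms by (intro integral_mono) (auto simp: L2_def)

lemma nsq_add_le:
  assumes "L2 a b f" "L2 a b g"
  shows "nsq a b (\<lambda>x. f x + g x) \<le> 2 * nsq a b f + 2 * nsq a b g"
proof -
  have "nsq a b (\<lambda>x. f x + g x) \<le> integral\<^sup>L (mu a b) (\<lambda>x. 2 * (f x)\<^sup>2 + 2 * (g x)\<^sup>2)"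
    unfolding nsq_def
  proof (rule integral_mono)
    show "integrable (mu a b) (\<lambda>x. (f x + g x)\<^sup>2)" using L2_add[OF assms] by (rule L2_square)
    show "integrable (mu a b) (\<lambda>x. 2 * (f x)\<^sup>2 + 2 * (g x)\<^sup>2)" using assms by (auto simp: L2_def)
    show "(f x + g x)\<^sup>2 \<le> 2 * (f x)\<^sup>2 + 2 * (g x)\<^sup>2" for x
      using sum_squares_bound[of "f x" "g x"] by (simp add: power2_sum)
  qed
  also have "\<dots> = 2 * nsq a b f + 2 * nsq a b g"
    using assms by (simp add: nsq_def L2_def)
  finally show ?thesis .
qed

lemma nsq_cmult: "nsq a b (\<lambda>x. c * f x) = c\<^sup>2 * nsq a b f"
  by (simp add: nsq_def power_mult_distrib)

lemma nsq_add_eq: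
  assumes "L2 a b f" "L2 a b g"
  shows "nsq a b (\<lambda>x. f x + g x) = nsq a b f + 2 * ip a b f g + nsq a b g"
  using assms unfolding ip_self[symmetric]
  by (simp add: ip_add_left ip_add_right L2_add ip_commute[of a b g f])

lemma nsq_diff_eq:
  assumes "L2 a b f" "L2 a b g"
  shows "nsq a b (\<lambda>x. f x - g x) = nsq a b f - 2 * ip a b f g + nsq a b g"
  using assms unfolding ip_self[symmetric]
  by (simp add: ip_diff_left ip_diff_right L2_diff ip_commute[of a b g f])

text \<open>Expand the squared norm of \<open>f - e * g\<close>. The parameter stays free because
  the stability argument inserts two different values.\<close>

lemma ip_le_young:
  assumes "L2 a b f" "L2 a b g" "e > 0"
  shows "2 * ip a b f g \<le> e * nsq a b g + nsq a b f / e"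
proof -
  have "0 \<le> nsq a b (\<lambda>x. f x - e * g x)" by (rule nsq_nonneg)
  also have "\<dots> = nsq a b f - 2 * e * ip a b f g + e\<^sup>2 * nsq a b g"
    using assms by (simp add: nsq_diff_eq L2_cmult nsq_cmult ip_cmult_right)
  finally show ?thesis using assms(3) by (simp add: field_simps power2_eq_square)
qed

lemma nsq_restrict_mono:
  assumes "L2 a b f" "a \<le> c" "d \<le> b"
  shows "nsq c d f \<le> nsq a b f"
proof (cases "c \<le> d")
  case True
  have "nsq a b f = nsq a c f + nsq c b f" "nsq c b f = nsq c d f + nsq d b f"
    unfolding nsq_def using assms True
    by (auto intro!: integral_mu_split L2_square intro: L2_subset)
  then show ?thesis using nsq_nonneg[of a c f] nsq_nonneg[of d b f] by linarith
next
  case False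
  then show ?thesis using nsq_nonneg[of a b f] by (simp add: nsq_def integral_restrict_space)
qed

section \<open>Density of polynomials\<close>

text \<open>A measurable function is a.e. a limit of continuous ones. Cutting these off at height
  \<open>\<bar>B\<bar>\<close> keeps the limit and makes them uniformly bounded, and Weierstrass
  replaces the n-th one by a polynomial up to \<open>1 / Suc n\<close>. The uniform bound is what
  dominated convergence needs in the sequel.\<close>

lemma bounded_measurable_poly_limit:
  fixes s :: "real \<Rightarrow> real"
  assumes "s \<in> borel_measurable (mu a b)" "\<And>x. x \<in> {a<..<b} \<Longrightarrow> \<bar>s x\<bar> \<le> B"
  obtains p :: "nat \<Rightarrow> real poly"
  where "\<And>n x. x \<in> {a..b} \<Longrightarrow> \<bar>poly (p n) x\<bar> \<le> \<bar>B\<bar> + 1"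
    and "AE x in mu a b. (\<lambda>n. poly (p n) x) \<longlonglongrightarrow> s x"
proof -
  have "(\<lambda>x. if x \<in> {a<..<b} then s x else 0) \<in> borel_measurable lebesgue"
    using assms(1) by (rule borel_measurable_if_I) simp
  then have "(\<lambda>x. if x \<in> {a<..<b} then s x else 0) measurable_on UNIV"
    by (rule lebesgue_measurable_imp_measurable_on_real) simp
  then obtain N g where N: "negligible N" and g: "\<And>n. continuous_on UNIV (g n)"
    and lim: "\<And>x. x \<notin> N \<Longrightarrow> (\<lambda>n. g n x) \<longlonglongrightarrow> (if x \<in> {a<..<b} then s x else (0::real))"
    unfolding measurable_on_def by auto
  define k where "k n x = max (- \<bar>B\<bar>) (min \<bar>B\<bar> (g n x))" for n x
  have kc: "continuous_on {a..b} (k n)" for n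
    unfolding k_def by (intro continuous_intros continuous_on_subset[OF g]) auto
  have "\<exists>p. \<forall>x\<in>{a..b}. \<bar>k n x - poly p x\<bar> < 1 / real (Suc n)" for n
  proof -
    obtain q where q: "real_polynomial_function q" "\<And>x. x \<in> {a..b} \<Longrightarrow> \<bar>k n x - q x\<bar> < 1 / real (Suc n)"
      using Stone_Weierstrass_real_polynomial_function[OF compact_Icc kc[of n], of "1 / real (Suc n)"] by auto
    then obtain c m where c: "q = (\<lambda>x. \<Sum>i\<le>m. c i * x ^ i)"
      unfolding real_polynomial_function_iff_sum by auto
    have "poly (\<Sum>i\<le>m. monom (c i) i) = q"
      unfolding c by (auto simp: poly_sum poly_monom)
    with q(2) show ?thesis by metis
  qed
  then obtain p where p: "\<And>n x. x \<in> {a..b} \<Longrightarrow> \<bar>k n x - poly (p n) x\<bar> < 1 / real (Suc n)" by metis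
  show thesis
  proof
    fix n x assume x: "x \<in> {a..b}"
    have "\<bar>k n x\<bar> \<le> \<bar>B\<bar>" unfolding k_def by auto
    moreover have "1 / real (Suc n) \<le> 1" by simp
    ultimately show "\<bar>poly (p n) x\<bar> \<le> \<bar>B\<bar> + 1" using p[OF x, of n] by linarith
  next
    have "(\<lambda>n. poly (p n) x) \<longlonglongrightarrow> s x" if x: "x \<in> {a<..<b}" "x \<notin> N" for x
    proof -
      have "(\<lambda>n. k n x) \<longlonglongrightarrow> max (- \<bar>B\<bar>) (min \<bar>B\<bar> (s x))"
        unfolding k_def using lim[OF x(2)] x(1) by (intro tendsto_intros) auto
      moreover have "max (- \<bar>B\<bar>) (min \<bar>B\<bar> (s x)) = s x"
        using assms(2)[OF x(1)] by auto
      ultimately have 1: "(\<lambda>n. k n x) \<longlonglongrightarrow> s x" by simp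
      have "(\<lambda>n. k n x - poly (p n) x) \<longlonglongrightarrow> 0"
      proof (rule Lim_null_comparison)
        show "\<forall>\<^sub>F n in sequentially. norm (k n x - poly (p n) x) \<le> 1 / real (Suc n)"
          using p[of x] x by (intro always_eventually) (auto intro: less_imp_le)
        show "(\<lambda>n. 1 / real (Suc n)) \<longlonglongrightarrow> 0"
          using LIMSEQ_inverse_real_of_nat by (simp add: inverse_eq_divide)
      qed
      from tendsto_diff[OF 1 this] show ?thesis by simp
    qed
    moreover have "AE x in lebesgue. x \<notin> N"
      using N by (auto simp: negligible_iff_null_sets intro: AE_not_in)
    ultimately show "AE x in mu a b. (\<lambda>n. poly (p n) x) \<longlonglongrightarrow> s x"
      by (auto simp: AE_restrict_space_iff elim!: eventually_mono)
  qed
qed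

lemma poly_measurable_mu: "poly p \<in> borel_measurable (mu a b)"
  using L2_poly by (rule L2_measurable)

text \<open>Polynomials that converge boundedly to \<open>sgn g\<close> turn the hypothesis into a
  vanishing integral of \<open>\<bar>g\<bar>\<close>. Integrability of \<open>g\<close> is enough
  for this, and uniqueness of weak derivatives relies on it; density in L2 would ask for a square
  integrable \<open>g\<close>.\<close>

lemma AE_zero_if_orthogonal_polys:
  assumes g: "integrable (mu a b) (g :: real \<Rightarrow> real)"
    and orth: "\<And>p. integral\<^sup>L (mu a b) (\<lambda>x. g x * poly p x) = 0"
  shows "AE x in mu a b. g x = 0"
proof -
  have gm: "g \<in> borel_measurable (mu a b)" using g by auto
  have sgn_meas: "(\<lambda>x. sgn (g x)) \<in> borel_measurable (mu a b)" using gm unfolding sgn_if by measurable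
  have sb: "\<bar>sgn (g x)\<bar> \<le> 1" for x by (simp add: sgn_if)
  obtain p where p: "\<And>n x. x \<in> {a..b} \<Longrightarrow> \<bar>poly (p n) x\<bar> \<le> \<bar>1\<bar> + 1"
    and lim: "AE x in mu a b. (\<lambda>n. poly (p n) x) \<longlonglongrightarrow> sgn (g x)"
    using bounded_measurable_poly_limit[OF sgn_meas sb] by metis
  have "(\<lambda>n. integral\<^sup>L (mu a b) (\<lambda>x. g x * poly (p n) x)) \<longlonglongrightarrow> integral\<^sup>L (mu a b) (\<lambda>x. \<bar>g x\<bar>)"
  proof (rule integral_dominated_convergence[where w = "\<lambda>x. 2 * \<bar>g x\<bar>"])
    show "AE x in mu a b. (\<lambda>n. g x * poly (p n) x) \<longlonglongrightarrow> \<bar>g x\<bar>"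
      using lim by eventually_elim (auto simp: abs_sgn intro!: tendsto_mult_left)
    show "AE x in mu a b. norm (g x * poly (p n) x) \<le> 2 * \<bar>g x\<bar>" for n
    proof (rule AE_I2)
      fix x assume "x \<in> space (mu a b)"
      then show "norm (g x * poly (p n) x) \<le> 2 * \<bar>g x\<bar>"
        using mult_right_mono[OF p[of x n], of "\<bar>g x\<bar>"] by (simp add: abs_mult mult.commute)
    qed
  qed (use g gm poly_measurable_mu in \<open>auto intro!: borel_measurable_times\<close>)
  then have "integral\<^sup>L (mu a b) (\<lambda>x. \<bar>g x\<bar>) = 0"
    by (simp add: orth LIMSEQ_const_iff)
  then have "AE x in mu a b. \<bar>g x\<bar> = 0"
    using g by (subst (asm) integral_nonneg_eq_0_iff_AE) auto
  then show ?thesis by auto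
qed

lemma L2_poly_dense_bounded:
  assumes "s \<in> borel_measurable (mu a b)" "\<And>x. x \<in> {a<..<b} \<Longrightarrow> \<bar>s x\<bar> \<le> B" "e > 0"
  obtains p where "nsq a b (\<lambda>x. s x - poly p x) < e"
proof -
  obtain p where p: "\<And>n x. x \<in> {a..b} \<Longrightarrow> \<bar>poly (p n) x\<bar> \<le> \<bar>B\<bar> + 1"
    and lim: "AE x in mu a b. (\<lambda>n. poly (p n) x) \<longlonglongrightarrow> s x"
    using bounded_measurable_poly_limit[OF assms(1,2)] by metis
  have "(\<lambda>n. nsq a b (\<lambda>x. s x - poly (p n) x)) \<longlonglongrightarrow> integral\<^sup>L (mu a b) (\<lambda>x. 0)"
    unfolding nsq_def
  proof (rule integral_dominated_convergence[where w = "\<lambda>x. (2 * \<bar>B\<bar> + 1)\<^sup>2"])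
    show "AE x in mu a b. (\<lambda>n. (s x - poly (p n) x)\<^sup>2) \<longlonglongrightarrow> 0"
      using lim by eventually_elim (auto intro!: tendsto_eq_intros)
    show "AE x in mu a b. norm ((s x - poly (p n) x)\<^sup>2) \<le> (2 * \<bar>B\<bar> + 1)\<^sup>2" for n
    proof (rule AE_I2)
      fix x assume "x \<in> space (mu a b)"
      then have "\<bar>s x - poly (p n) x\<bar> \<le> 2 * \<bar>B\<bar> + 1"
        using p[of x n] assms(2)[of x] by auto
      then show "norm ((s x - poly (p n) x)\<^sup>2) \<le> (2 * \<bar>B\<bar> + 1)\<^sup>2"
        using power_mono[of "\<bar>s x - poly (p n) x\<bar>" _ 2] by simp
    qed
    show "integrable (mu a b) (\<lambda>x. (2 * \<bar>B\<bar> + 1)\<^sup>2)" by (rule integrable_mu_const)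
  qed (use assms poly_measurable_mu in \<open>auto intro!: borel_measurable_power borel_measurable_diff\<close>)
  then have "(\<lambda>n. nsq a b (\<lambda>x. s x - poly (p n) x)) \<longlonglongrightarrow> 0" by simp
  then have "\<forall>\<^sub>F n in sequentially. nsq a b (\<lambda>x. s x - poly (p n) x) < e"
    using assms(3) by (rule order_tendstoD)
  then show thesis using that by (auto dest: eventually_happens)
qed

text \<open>Truncation at height \<open>n\<close> reduces to the bounded case, with the truncation
  error dominated by \<open>(f x)\<^sup>2\<close>. Passing through the truncation costs a factor 2
  for each part, hence two errors below \<open>e / 4\<close>.\<close>

lemma L2_poly_dense:
  assumes f: "L2 a b f" and "e > 0"
  obtains p where "nsq a b (\<lambda>x. f x - poly p x) < e"
proof -
  define t where "t n x = max (- real n) (min (real n) (f x))" for n x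
  have fm: "f \<in> borel_measurable (mu a b)" by (rule L2_measurable[OF f])
  have tm: "t n \<in> borel_measurable (mu a b)" for n unfolding t_def using fm by measurable
  have "(\<lambda>n. nsq a b (\<lambda>x. f x - t n x)) \<longlonglongrightarrow> integral\<^sup>L (mu a b) (\<lambda>x. 0)"
    unfolding nsq_def
  proof (rule integral_dominated_convergence[where w = "\<lambda>x. (f x)\<^sup>2"])
    have "(\<lambda>n. (f x - t n x)\<^sup>2) \<longlonglongrightarrow> 0" for x
    proof (rule tendsto_eventually)
      show "\<forall>\<^sub>F n in sequentially. (f x - t n x)\<^sup>2 = 0"
        using eventually_ge_at_top[of "nat \<lceil>\<bar>f x\<bar>\<rceil>"]
        by eventually_elim (auto simp: t_def ceiling_le_iff nat_le_iff)
    qed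
    then show "AE x in mu a b. (\<lambda>n. (f x - t n x)\<^sup>2) \<longlonglongrightarrow> 0" by auto
    have "\<bar>f x - t n x\<bar> \<le> \<bar>f x\<bar>" for x n unfolding t_def by auto
    then show "AE x in mu a b. norm ((f x - t n x)\<^sup>2) \<le> (f x)\<^sup>2" for n
      by (simp add: abs_le_square_iff)
    show "integrable (mu a b) (\<lambda>x. (f x)\<^sup>2)" using f by (rule L2_square)
  qed (use fm tm in \<open>auto intro!: borel_measurable_power borel_measurable_diff\<close>)
  then have "(\<lambda>n. nsq a b (\<lambda>x. f x - t n x)) \<longlonglongrightarrow> 0" by simp
  then have "\<forall>\<^sub>F n in sequentially. nsq a b (\<lambda>x. f x - t n x) < e / 4"
    using assms(2) by (intro order_tendstoD) auto
  then obtain n where n: "nsq a b (\<lambda>x. f x - t n x) < e / 4" by (auto dest: eventually_happens)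
  have tb: "\<bar>t n x\<bar> \<le> real n" for x unfolding t_def by auto
  obtain p where p: "nsq a b (\<lambda>x. t n x - poly p x) < e / 4"
    using L2_poly_dense_bounded[OF tm tb, of "e / 4"] assms(2) by auto
  have tL: "L2 a b (t n)" using tm tb by (rule L2_bounded)
  have "nsq a b (\<lambda>x. (f x - t n x) + (t n x - poly p x))
      \<le> 2 * nsq a b (\<lambda>x. f x - t n x) + 2 * nsq a b (\<lambda>x. t n x - poly p x)"
    by (intro nsq_add_le L2_diff f tL L2_poly)
  with n p show thesis by (intro that[of p]) simp
qed

text \<open>Degree less than \<open>n\<close>, so that \<open>n = 0\<close> leaves only the zero polynomial.\<close>

definition plt :: "nat \<Rightarrow> real poly \<Rightarrow> bool" where
  "plt n p \<longleftrightarrow> (\<forall>i\<ge>n. coeff p i = 0)"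

lemma plt_degree: "plt (Suc m) p \<longleftrightarrow> degree p \<le> m"
  unfolding plt_def by (auto simp: Suc_le_eq intro: degree_le coeff_eq_0)

lemma plt_0: "plt n 0" by (simp add: plt_def)
lemma plt_zero: "plt 0 p \<longleftrightarrow> p = 0" by (auto simp: plt_def poly_eq_iff)
lemma plt_add: "plt n p \<Longrightarrow> plt n q \<Longrightarrow> plt n (p + q)" by (simp add: plt_def)
lemma plt_diff: "plt n p \<Longrightarrow> plt n q \<Longrightarrow> plt n (p - q)" by (simp add: plt_def)
lemma plt_smult: "plt n p \<Longrightarrow> plt n (Polynomial.smult c p)" by (simp add: plt_def)
lemma plt_mono: "plt n p \<Longrightarrow> n \<le> m \<Longrightarrow> plt m p" by (simp add: plt_def)
lemma plt_sum: "(\<And>i. i \<in> I \<Longrightarrow> plt n (f i)) \<Longrightarrow> plt n (\<Sum>i\<in>I. f i)"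
  by (induction I rule: infinite_finite_induct) (auto intro: plt_add plt_0)
lemma plt_ex: "\<exists>n. plt n p"
  using plt_degree[of "degree p" p] by blast
lemma plt_pderiv: "plt (Suc n) p \<Longrightarrow> plt n (pderiv p)"
  by (simp add: plt_def coeff_pderiv)

lemma poly_diff_fun: "poly (p - q :: real poly) = (\<lambda>x. poly p x - poly q x)"
  by (rule ext) simp

lemma poly_0_if_nsq_0:
  assumes "a < b" "nsq a b (poly p) = 0"
  shows "p = 0"
proof (rule ccontr)
  assume "p \<noteq> 0"
  then have fin: "finite {x. poly p x = 0}" by (rule poly_roots_finite)
  have "AE x in mu a b. (poly p x)\<^sup>2 = 0"
    using assms(2) L2_square[OF L2_poly[of a b p]] unfolding nsq_def
    by (subst (asm) integral_nonneg_eq_0_iff_AE) auto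
  then have "AE x in lebesgue. x \<in> {a<..<b} \<longrightarrow> poly p x = 0"
    by (simp add: AE_restrict_space_iff)
  moreover have "AE x in lebesgue. x \<notin> {x. poly p x = 0}"
    using fin by (intro AE_not_in) (auto simp: negligible_iff_null_sets[symmetric] intro: negligible_finite)
  ultimately have "AE x in lebesgue. x \<notin> {a<..<b}" by eventually_elim auto
  then have "emeasure lebesgue {a<..<b} = 0" by (subst (asm) AE_iff_measurable[of "{a<..<b}"]) auto
  with assms(1) show False by simp
qed

section \<open>Orthogonal projection and squared approximation error\<close>

text \<open>One Gram-Schmidt step: the component added at degree \<open>n\<close> points along
  \<open>g\<close>, the monomial minus its own projection to lower degree. The induction is over
  arbitrary \<open>f\<close> because it is used both for \<open>f\<close> and for the
  monomial.\<close>

lemma L2_proj_exists: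
  "L2 a b f \<Longrightarrow> \<exists>p. plt n p \<and> (\<forall>q. plt n q \<longrightarrow> ip a b (\<lambda>x. f x - poly p x) (poly q) = 0)"
proof (induction n arbitrary: f)
  case 0
  show ?case by (intro exI[of _ 0]) (auto simp: plt_zero ip_def)
next
  case (Suc n)
  obtain p0 where p0: "plt n p0" "\<And>q. plt n q \<Longrightarrow> ip a b (\<lambda>x. f x - poly p0 x) (poly q) = 0"
    using Suc by blast
  obtain m where m: "plt n m" "\<And>q. plt n q \<Longrightarrow> ip a b (\<lambda>x. poly (monom 1 n) x - poly m x) (poly q) = 0"
    using Suc.IH[OF L2_poly[of a b "monom 1 n"]] by blast
  define g where "g = monom 1 n - m"
  have g_plt: "plt (Suc n) g" using m(1) unfolding g_def plt_def by auto
  have g_n: "coeff g n = 1" using m(1) unfolding g_def plt_def by auto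
  have g_orth: "ip a b (poly g) (poly q) = 0" if "plt n q" for q
    using m(2)[OF that] by (simp add: g_def poly_diff_fun)
  define c where "c = ip a b f (poly g) / nsq a b (poly g)"
  \<comment> \<open>The order of the end points is not fixed here, so \<open>g\<close> may have norm
    0. Then Cauchy-Schwarz makes the right side vanish, and the division by zero in \<open>c\<close>
    does no harm.\<close>
  have c: "c * nsq a b (poly g) = ip a b f (poly g)"
  proof (cases "nsq a b (poly g) = 0")
    case True
    then have "(ip a b f (poly g))\<^sup>2 \<le> 0" using cs_ip[OF Suc.prems L2_poly[of a b g]] by simp
    then show ?thesis using True by simp
  qed (simp add: c_def)
  show ?case
  proof (intro exI conjI allI impI)
    show "plt (Suc n) (p0 + Polynomial.smult c g)" by (intro plt_add plt_smult g_plt plt_mono[OF p0(1)]) simp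
    fix q assume q: "plt (Suc n) q"
    define q' where "q' = q - Polynomial.smult (coeff q n) g"
    have q': "plt n q'"
      unfolding plt_def
    proof (intro allI impI)
      fix i assume "n \<le> i"
      then show "coeff q' i = 0"
        using q g_plt g_n unfolding q'_def plt_def by (cases "i = n") auto
    qed
    have q_eq: "poly q = (\<lambda>x. coeff q n * poly g x + poly q' x)" by (auto simp: q'_def)
    have L: "L2 a b f" "\<And>p. L2 a b (poly p)" using Suc.prems L2_poly by auto
    have p0g: "ip a b (poly p0) (poly g) = 0" using g_orth[OF p0(1)] by (simp add: ip_commute)
    have fq': "ip a b f (poly q') = ip a b (poly p0) (poly q')"
      using p0(2)[OF q'] L by (simp add: ip_diff_left)
    have eq: "poly (p0 + Polynomial.smult c g) = (\<lambda>x. poly p0 x + c * poly g x)" by auto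
    have "ip a b (\<lambda>x. f x - poly (p0 + Polynomial.smult c g) x) (poly r)
        = ip a b f (poly r) - (ip a b (poly p0) (poly r) + c * ip a b (poly g) (poly r))" for r
      unfolding eq using L by (simp add: ip_diff_left ip_add_left ip_cmult_left L2_add L2_cmult)
    moreover have "ip a b h (poly q) = coeff q n * ip a b h (poly g) + ip a b h (poly q')" if "L2 a b h" for h
      unfolding q_eq using L that by (simp add: ip_add_right ip_cmult_right L2_cmult)
    ultimately show "ip a b (\<lambda>x. f x - poly (p0 + Polynomial.smult c g) x) (poly q) = 0"
      using L g_orth[OF q'] p0g c fq' by (simp add: L2_diff ip_self del: poly_add poly_smult)
  qed
qed

text \<open>A choice instead of a definite description, because uniqueness is available only for
  \<open>a < b\<close>; see \<open>pr_unique\<close>.\<close>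

definition pr :: "real \<Rightarrow> real \<Rightarrow> nat \<Rightarrow> (real \<Rightarrow> real) \<Rightarrow> real poly" where
  "pr a b n f = (SOME p. plt n p \<and> (\<forall>q. plt n q \<longrightarrow> ip a b (\<lambda>x. f x - poly p x) (poly q) = 0))"

lemma pr_plt: "L2 a b f \<Longrightarrow> plt n (pr a b n f)"
  and pr_orth: "L2 a b f \<Longrightarrow> plt n q \<Longrightarrow> ip a b (\<lambda>x. f x - poly (pr a b n f) x) (poly q) = 0"
  unfolding pr_def using someI_ex[OF L2_proj_exists[of a b f n]] by auto

lemma pr_ip: "L2 a b f \<Longrightarrow> plt n q \<Longrightarrow> ip a b (poly (pr a b n f)) (poly q) = ip a b f (poly q)"
  using pr_orth[of a b f n q] by (simp add: ip_diff_left L2_poly)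

lemma pr_unique:
  assumes "a < b" "L2 a b f" "plt n p" "\<And>q. plt n q \<Longrightarrow> ip a b (poly p) (poly q) = ip a b f (poly q)"
  shows "pr a b n f = p"
proof -
  have pl: "plt n (pr a b n f - p)" using assms pr_plt plt_diff by blast
  have "nsq a b (poly (pr a b n f - p)) = ip a b (\<lambda>x. poly (pr a b n f) x - poly p x) (poly (pr a b n f - p))"
    by (simp add: ip_def nsq_def power2_eq_square)
  also have "\<dots> = 0" using assms pl by (simp add: ip_diff_left L2_poly pr_ip)
  finally show ?thesis using poly_0_if_nsq_0[OF assms(1)] by (metis eq_iff_diff_eq_0)
qed

text \<open>The distance is kept squared, since squares add up over components and over
  cells.\<close>

definition err :: "real \<Rightarrow> real \<Rightarrow> nat \<Rightarrow> (real \<Rightarrow> real) \<Rightarrow> real" where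
  "err a b n f = nsq a b (\<lambda>x. f x - poly (pr a b n f) x)"

lemma err_nonneg: "0 \<le> err a b n f"
  by (simp add: err_def nsq_nonneg)

lemma nsq_pythagoras:
  assumes "L2 a b f" "plt n q"
  shows "nsq a b (\<lambda>x. f x - poly q x) = err a b n f + nsq a b (poly (pr a b n f - q))"
proof -
  have "nsq a b (\<lambda>x. (f x - poly (pr a b n f) x) + poly (pr a b n f - q) x) =
    err a b n f + 2 * ip a b (\<lambda>x. f x - poly (pr a b n f) x) (poly (pr a b n f - q)) + nsq a b (poly (pr a b n f - q))"
    unfolding err_def by (intro nsq_add_eq L2_diff L2_poly assms)
  also have "ip a b (\<lambda>x. f x - poly (pr a b n f) x) (poly (pr a b n f - q)) = 0"
    using assms by (intro pr_orth plt_diff pr_plt)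
  finally show ?thesis by (simp add: poly_diff_fun)
qed

lemma err_le: "L2 a b f \<Longrightarrow> plt n q \<Longrightarrow> err a b n f \<le> nsq a b (\<lambda>x. f x - poly q x)"
  by (simp add: nsq_pythagoras nsq_nonneg)

lemma err_le_nsq: "L2 a b f \<Longrightarrow> err a b n f \<le> nsq a b f"
  using err_le[of a b f n 0] by (simp add: plt_0)

lemma nsq_pr_le: "L2 a b f \<Longrightarrow> nsq a b (poly (pr a b n f)) \<le> nsq a b f"
  using nsq_pythagoras[of a b f n 0] err_nonneg[of a b n f] by (simp add: plt_0)

lemma err_0: "L2 a b f \<Longrightarrow> err a b 0 f = nsq a b f"
  using pr_plt[of a b f 0] by (simp add: err_def plt_zero)

text \<open>The projection of \<open>f - q\<close>, plus \<open>q\<close>, is a competitor for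
  \<open>f\<close>. In this direction the inequality permits subtracting a suitable polynomial
  before estimating.\<close>

lemma err_shift_le:
  assumes "L2 a b f" "plt n q"
  shows "err a b n f \<le> err a b n (\<lambda>x. f x - poly q x)"
proof -
  have L: "L2 a b (\<lambda>x. f x - poly q x)" by (intro L2_diff assms L2_poly)
  have "err a b n f \<le> nsq a b (\<lambda>x. f x - poly (q + pr a b n (\<lambda>x. f x - poly q x)) x)"
    by (intro err_le assms plt_add pr_plt L)
  then show ?thesis unfolding err_def[of a b n "\<lambda>x. f x - poly q x"] by (simp add: algebra_simps)
qed

lemma err_add_le:
  assumes "L2 a b f" "L2 a b g"
  shows "err a b n (\<lambda>x. f x + g x) \<le> 2 * err a b n f + 2 * err a b n g"
proof -
  have "err a b n (\<lambda>x. f x + g x) \<le> nsq a b (\<lambda>x. (f x + g x) - poly (pr a b n f + pr a b n g) x)"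
    by (intro err_le L2_add assms plt_add pr_plt)
  also have "\<dots> = nsq a b (\<lambda>x. (f x - poly (pr a b n f) x) + (g x - poly (pr a b n g) x))"
    by (simp add: algebra_simps)
  also have "\<dots> \<le> 2 * err a b n f + 2 * err a b n g"
    unfolding err_def by (intro nsq_add_le L2_diff assms L2_poly)
  finally show ?thesis .
qed

lemma pr_cong_AE:
  assumes "AE x in mu a b. f x = g x" "L2 a b f"
  shows "pr a b n f = pr a b n g"
proof -
  have "ip a b (\<lambda>x. f x - poly p x) (poly q) = ip a b (\<lambda>x. g x - poly p x) (poly q)" for p q
    using assms by (intro ip_cong_AE L2_diff L2_poly) auto
  then show ?thesis by (simp add: pr_def)
qed

lemma err_cong_AE:
  assumes "AE x in mu a b. f x = g x" "L2 a b f"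
  shows "err a b n f = err a b n g"
  unfolding err_def pr_cong_AE[OF assms]
  using assms by (intro nsq_cong_AE L2_diff L2_poly) auto

section \<open>Spectral gap of the Legendre operator and approximation of primitives\<close>

text \<open>For \<open>x \<le> a\<close> the interval is empty and the value is 0, so primitives are
  used only to the right of \<open>a\<close>.\<close>

definition prim :: "real \<Rightarrow> (real \<Rightarrow> real) \<Rightarrow> real \<Rightarrow> real" where
  "prim a f x = integral\<^sup>L (mu a x) f"

lemma prim_eq_integral:
  assumes "integrable (mu a b) f" "x \<le> b"
  shows "prim a f x = integral {a..x} f" and "f integrable_on {a..x}"
proof -
  have "integrable (mu a x) f" using assms by (intro integrable_mu_subset[OF assms(1)]) auto
  then have "(f has_integral prim a f x) {a<..<x}"
    unfolding prim_def by (rule has_integral_integral_lebesgue_on) simp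
  then have "(f has_integral prim a f x) {a..x}"
    by (simp add: has_integral_Icc_iff_Ioo)
  then show "prim a f x = integral {a..x} f" "f integrable_on {a..x}"
    by (auto simp: integral_unique intro: has_integral_integrable)
qed

lemma prim_continuous:
  assumes "integrable (mu a b) f"
  shows "continuous_on {a..b} (prim a f)"
proof -
  have "continuous_on {a..b} (\<lambda>x. integral {a..x} f)"
    by (rule indefinite_integral_continuous_1) (rule prim_eq_integral[OF assms order_refl])
  then show ?thesis
    by (rule continuous_on_eq) (use assms prim_eq_integral in auto)
qed

lemma prim_self: "prim a f a = 0"
  by (simp add: prim_def integral_restrict_space)

lemma prim_split: "integrable (mu a b) f \<Longrightarrow> a \<le> c \<Longrightarrow> c \<le> x \<Longrightarrow> x \<le> b \<Longrightarrow>
    prim a f x = prim a f c + prim c f x"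
  unfolding prim_def by (rule integral_mu_split) (auto intro: integrable_mu_subset)

lemma prim_diff: "integrable (mu a b) f \<Longrightarrow> integrable (mu a b) g \<Longrightarrow> x \<le> b \<Longrightarrow>
    prim a (\<lambda>x. f x - g x) x = prim a f x - prim a g x"
  unfolding prim_def by (intro Bochner_Integration.integral_diff) (auto intro: integrable_mu_subset)

lemma prim_sum: "(\<And>i. i \<in> I \<Longrightarrow> integrable (mu a b) (f i)) \<Longrightarrow> x \<le> b \<Longrightarrow>
    prim a (\<lambda>x. \<Sum>i\<in>I. f i x) x = (\<Sum>i\<in>I. prim a (f i) x)"
  unfolding prim_def by (intro Bochner_Integration.integral_sum) (auto intro: integrable_mu_subset)

lemma prim_cmult: "prim a (\<lambda>x. c * f x) x = c * prim a f x"
  by (simp add: prim_def)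

lemma L2_prim: "L2 a b f \<Longrightarrow> L2 a b (prim a f)"
  by (rule L2_continuous[OF prim_continuous[OF L2_integrable]])

lemma nsq_const: "a \<le> b \<Longrightarrow> nsq a b (\<lambda>x. c) = c\<^sup>2 * (b - a)"
  by (simp add: nsq_def integral_mu_const del: Bochner_Integration.lebesgue_integral_const)

lemma prim_bound:
  assumes "L2 a b f" "a \<le> x" "x \<le> b"
  shows "(prim a f x)\<^sup>2 \<le> (x - a) * nsq a x f"
proof -
  have "(ip a x f (\<lambda>_. 1))\<^sup>2 \<le> nsq a x f * nsq a x (\<lambda>_. 1)"
    by (intro cs_ip L2_const L2_subset[OF assms(1)]) (use assms in auto)
  then show ?thesis using assms by (simp add: ip_def prim_def nsq_const mult.commute)
qed

lemma prim_bound_interval: 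
  assumes "L2 a b f" "a \<le> x" "x \<le> b"
  shows "(prim a f x)\<^sup>2 \<le> (b - a) * nsq a b f"
proof -
  have "(prim a f x)\<^sup>2 \<le> (x - a) * nsq a x f" by (rule prim_bound[OF assms])
  also have "\<dots> \<le> (b - a) * nsq a b f"
    using assms by (intro mult_mono nsq_restrict_mono nsq_nonneg) auto
  finally show ?thesis .
qed

lemma nsq_prim_le:
  assumes "L2 a b f" "a \<le> b"
  shows "nsq a b (prim a f) \<le> (b - a)\<^sup>2 * nsq a b f"
proof -
  have "nsq a b (prim a f) \<le> integral\<^sup>L (mu a b) (\<lambda>x. (b - a) * nsq a b f)"
    unfolding nsq_def[of a b "prim a f"]
    by (intro integral_mono L2_square[OF L2_prim[OF assms(1)]] integrable_mu_const prim_bound_interval[OF assms(1)]) auto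
  also have "\<dots> = (b - a)\<^sup>2 * nsq a b f"
    using assms(2) by (simp add: integral_mu_const power2_eq_square del: Bochner_Integration.lebesgue_integral_const)
  finally show ?thesis .
qed

lemma integral_mu_FTC:
  assumes "a \<le> b" "\<And>x. x \<in> {a..b} \<Longrightarrow> (F has_real_derivative f x) (at x within {a..b})"
    and "continuous_on {a..b} f"
  shows "integral\<^sup>L (mu a b) f = F b - F a"
proof -
  have "(f has_integral (F b - F a)) {a..b}"
    using assms by (intro fundamental_theorem_of_calculus) (auto simp: has_real_derivative_iff_has_vector_derivative)
  moreover have "integral {a..b} f = integral\<^sup>L (mu a b) f"
    using prim_eq_integral(1)[OF integrable_mu_continuous[OF assms(3)] order_refl] by (simp add: prim_def)
  ultimately show ?thesis by (simp add: integral_unique)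
qed

lemma integral_mu_pderiv: "a \<le> b \<Longrightarrow> integral\<^sup>L (mu a b) (poly (pderiv p)) = poly p b - poly p a"
  by (rule integral_mu_FTC) (auto intro: poly_DERIV DERIV_subset continuous_intros)

lemma pderiv_sum: "pderiv (\<Sum>i\<in>A. f i :: real poly) = (\<Sum>i\<in>A. pderiv (f i))"
  by (induction A rule: infinite_finite_induct) (auto simp: pderiv_add)

lemma poly_antiderivative:
  fixes Z :: "real poly"
  obtains G :: "real poly" where "pderiv G = Z" "\<And>n. plt n Z \<Longrightarrow> plt (Suc n) G"
proof
  let ?G = "\<Sum>i\<le>degree Z. monom (coeff Z i / real (Suc i)) (Suc i)"
  have "pderiv ?G = (\<Sum>i\<le>degree Z. monom (coeff Z i) i)"
    by (simp add: pderiv_sum pderiv_monom del: of_nat_Suc)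
  then show "pderiv ?G = Z" by (simp add: poly_as_sum_of_monoms)
  show "plt (Suc n) ?G" if "plt n Z" for n
    using that by (intro plt_sum) (auto simp: plt_def)
qed

lemma prim_pderiv: "a \<le> x \<Longrightarrow> prim a (poly (pderiv p)) x = poly p x - poly p a"
  unfolding prim_def by (rule integral_mu_pderiv)

lemma ip_poly_parts:
  assumes "a \<le> b"
  shows "ip a b (poly (pderiv p)) (poly q) = poly p b * poly q b - poly p a * poly q a - ip a b (poly p) (poly (pderiv q))"
proof -
  have "poly p b * poly q b - poly p a * poly q a = integral\<^sup>L (mu a b) (poly (pderiv (p * q)))"
    using integral_mu_pderiv[OF assms, of "p * q"] by simp
  also have "poly (pderiv (p * q)) = (\<lambda>x. poly (pderiv p) x * poly q x + poly p x * poly (pderiv q) x)"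
    by (auto simp: pderiv_mult algebra_simps)
  also have "integral\<^sup>L (mu a b) \<dots> = ip a b (poly (pderiv p)) (poly q) + ip a b (poly p) (poly (pderiv q))"
    by (simp add: ip_def L2_mult_integrable L2_poly)
  finally show ?thesis by simp
qed

text \<open>The Legendre operator of \<open>(a, b)\<close>, whose eigenvalues are \<open>n (n + 1)\<close>.\<close>

definition wt :: "real \<Rightarrow> real \<Rightarrow> real poly" where
  "wt a b = [:- a, 1:] * [:b, - 1:]"

definition legop :: "real \<Rightarrow> real \<Rightarrow> real poly \<Rightarrow> real poly" where
  "legop a b p = - pderiv (wt a b * pderiv p)"

text \<open>Only the term of degree two in the weight compensates the two derivatives, so the
  operator is triangular with respect to degree, with diagonal entries \<open>i * (i + 1)\<close>.
  Indices above \<open>n\<close>, where both sides are 0, are included because they show that the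
  degree does not grow.\<close>

lemma coeff_legop:
  assumes "plt (Suc n) p" "i \<ge> n"
  shows "coeff (legop a b p) i = real (i * (i + 1)) * coeff p i"
proof -
  have wt: "wt a b * q = Polynomial.smult (- a * b) q + pCons 0 (Polynomial.smult (a + b) q) - pCons 0 (pCons 0 q)" for q
    by (rule poly_ext) (simp add: wt_def algebra_simps)
  have "coeff (legop a b p) i = - real (Suc i) * coeff (wt a b * pderiv p) (Suc i)"
    by (simp only: legop_def coeff_minus coeff_pderiv)
  also have "coeff (wt a b * pderiv p) (Suc i) = - real i * coeff p i"
    unfolding wt using assms by (cases i) (auto simp: coeff_pderiv plt_def coeff_pCons algebra_simps)
  finally show ?thesis by (simp add: algebra_simps)
qed

lemma plt_legop: "plt n p \<Longrightarrow> plt n (legop a b p)"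
proof (cases n)
  case 0
  then show "plt n p \<Longrightarrow> ?thesis" by (simp add: plt_zero legop_def)
next
  case (Suc m)
  assume p: "plt n p"
  show ?thesis
    unfolding plt_def
  proof (intro allI impI)
    fix i assume i: "n \<le> i"
    have "coeff (legop a b p) i = real (i * (i + 1)) * coeff p i"
      by (rule coeff_legop[of m]) (use p i Suc in auto)
    then show "coeff (legop a b p) i = 0" using p i by (simp add: plt_def)
  qed
qed

lemma wt_ends: "poly (wt a b) a = 0" "poly (wt a b) b = 0"
  by (simp_all add: wt_def)

text \<open>The weight vanishes at both ends, so integration by parts leaves no boundary term.
  Symmetry and nonnegativity of the operator are read off the right side.\<close>

lemma legop_ip:
  assumes "a \<le> b"
  shows "ip a b (poly (legop a b p)) (poly q) = integral\<^sup>L (mu a b) (\<lambda>x. poly (wt a b) x * (poly (pderiv p) x * poly (pderiv q) x))"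
proof -
  have "ip a b (poly (legop a b p)) (poly q) = - ip a b (poly (pderiv (wt a b * pderiv p))) (poly q)"
    by (simp add: legop_def ip_def)
  also have "\<dots> = ip a b (poly (wt a b * pderiv p)) (poly (pderiv q))"
    unfolding ip_poly_parts[OF assms] by (simp add: wt_ends)
  finally show ?thesis by (simp add: ip_def mult.assoc)
qed

lemma legop_sym: "a \<le> b \<Longrightarrow> ip a b (poly (legop a b p)) (poly q) = ip a b (poly p) (poly (legop a b q))"
  by (simp add: legop_ip ip_commute[of a b "poly p"] mult.commute)

lemma wt_bounds:
  assumes "x \<in> {a<..<b}"
  shows "0 \<le> poly (wt a b) x" "poly (wt a b) x \<le> ((b - a) / 2)\<^sup>2"
proof -
  have "0 \<le> (x - a) * (b - x)" using assms by simp
  then show "0 \<le> poly (wt a b) x" by (simp add: wt_def algebra_simps)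
  have "0 \<le> (x - (a + b) / 2)\<^sup>2" by simp
  then show "poly (wt a b) x \<le> ((b - a) / 2)\<^sup>2"
    by (simp add: wt_def power2_eq_square field_simps)
qed

lemma legop_nonneg: "a \<le> b \<Longrightarrow> 0 \<le> ip a b (poly (legop a b p)) (poly p)"
  unfolding legop_ip
  by (rule integral_nonneg_AE) (auto intro!: AE_I2 mult_nonneg_nonneg[OF wt_bounds(1)])

lemma legop_le:
  assumes "a \<le> b"
  shows "ip a b (poly (legop a b p)) (poly p) \<le> ((b - a) / 2)\<^sup>2 * nsq a b (poly (pderiv p))"
proof -
  have "ip a b (poly (legop a b p)) (poly p) \<le> integral\<^sup>L (mu a b) (\<lambda>x. ((b - a) / 2)\<^sup>2 * (poly (pderiv p) x)\<^sup>2)"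
    unfolding legop_ip[OF assms]
  proof (rule integral_mono)
    show "poly (wt a b) x * (poly (pderiv p) x * poly (pderiv p) x) \<le> ((b - a) / 2)\<^sup>2 * (poly (pderiv p) x)\<^sup>2"
      if "x \<in> space (mu a b)" for x
      unfolding power2_eq_square[of "poly (pderiv p) x"] using that by (intro mult_right_mono wt_bounds) auto
  qed (auto intro!: integrable_mu_continuous continuous_intros)
  then show ?thesis by (simp add: nsq_def)
qed

lemma legop_add: "legop a b (p + q) = legop a b p + legop a b q"
  by (simp add: legop_def pderiv_add ring_distribs)

lemma poly_add_fun: "poly (p + q :: real poly) = (\<lambda>x. poly p x + poly q x)"
  by (rule ext) simp

lemma ip_poly_add_left: "ip a b (poly (p + q)) (poly r) = ip a b (poly p) (poly r) + ip a b (poly q) (poly r)"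
  unfolding poly_add_fun by (intro ip_add_left L2_poly)

lemma ip_poly_add_right: "ip a b (poly r) (poly (p + q)) = ip a b (poly r) (poly p) + ip a b (poly r) (poly q)"
  unfolding poly_add_fun by (intro ip_add_right L2_poly)

lemma ip_poly_diff_left: "ip a b (poly (p - q)) (poly r) = ip a b (poly p) (poly r) - ip a b (poly q) (poly r)"
  unfolding poly_diff_fun by (intro ip_diff_left L2_poly)

lemma ip_poly_smult_left: "ip a b (poly (Polynomial.smult c q)) (poly r) = c * ip a b (poly q) (poly r)"
proof -
  have "poly (Polynomial.smult c q) = (\<lambda>x. c * poly q x)" by auto
  then show ?thesis by (simp add: ip_cmult_left)
qed

text \<open>Induction over the degree bound \<open>N\<close>. Peel off the top component
  \<open>v\<close>, which is orthogonal to all lower degrees: \<open>legop\<close> maps it to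
  \<open>N * (N + 1)\<close> times itself up to lower degree, which \<open>v\<close> does not see,
  and by symmetry the mixed terms with the rest \<open>u\<close> vanish. So \<open>v\<close>
  contributes its eigenvalue, which is at least the gap, and \<open>u\<close> is left to the
  induction hypothesis.\<close>

lemma legop_gap:
  assumes "a \<le> b" "plt N w" "\<And>q. plt n q \<Longrightarrow> ip a b (poly w) (poly q) = 0"
  shows "real (n * (n + 1)) * nsq a b (poly w) \<le> ip a b (poly (legop a b w)) (poly w)"
  using assms(2,3)
proof (induction N arbitrary: w)
  case 0
  then have "nsq a b (poly w) = 0" by (simp add: plt_zero nsq_def)
  then show ?case using legop_nonneg[OF assms(1)] by simp
next
  case (Suc N)
  show ?case
  proof (cases "Suc N \<le> n")
    case True
    \<comment> \<open>Of degree below \<open>n\<close>, \<open>w\<close> is orthogonal to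
      itself.\<close>
    then have "plt n w" using Suc.prems(1) by (rule plt_mono[rotated])
    then have "nsq a b (poly w) = 0" using Suc.prems(2)[of w] by (simp add: ip_self)
    then show ?thesis using legop_nonneg[OF assms(1)] by simp
  next
    case False
    define u where "u = pr a b N (poly w)"
    define v where "v = w - u"
    have w: "w = u + v" by (simp add: v_def)
    have u: "plt N u" unfolding u_def by (intro pr_plt L2_poly)
    have v: "plt (Suc N) v" unfolding v_def by (intro plt_diff Suc.prems(1) plt_mono[OF u]) simp
    have v_orth: "ip a b (poly v) (poly q) = 0" if "plt N q" for q
      using pr_orth[OF L2_poly that, of a b w] by (simp add: v_def u_def poly_diff_fun)
    have u_orth: "ip a b (poly u) (poly q) = 0" if q: "plt n q" for q
    proof -
      have "ip a b (poly v) (poly q) = 0" using False by (intro v_orth plt_mono[OF q]) simp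
      then show ?thesis using Suc.prems(2)[OF q] by (simp add: v_def ip_poly_diff_left)
    qed
    have uv: "ip a b (poly u) (poly v) = 0" using v_orth[OF u] by (simp add: ip_commute)
    have Auv: "ip a b (poly (legop a b u)) (poly v) = 0"
      using v_orth[OF plt_legop[OF u, of a b]] by (simp add: ip_commute)
    then have Avu: "ip a b (poly (legop a b v)) (poly u) = 0"
      using legop_sym[OF assms(1), of u v] by (simp add: ip_commute)
    have "plt N (legop a b v - Polynomial.smult (real (N * (N + 1))) v)"
      unfolding plt_def
    proof (intro allI impI)
      fix i assume i: "N \<le> i"
      show "coeff (legop a b v - Polynomial.smult (real (N * (N + 1))) v) i = 0"
        using coeff_legop[OF v i, of a b] v i by (cases "i = N") (auto simp: plt_def)
    qed
    from v_orth[OF this]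
    have Avv: "ip a b (poly (legop a b v)) (poly v) = real (N * (N + 1)) * nsq a b (poly v)"
      by (simp add: ip_commute[of a b "poly v"] ip_poly_diff_left ip_poly_smult_left ip_self del: of_nat_mult)
    have "real (n * (n + 1)) * nsq a b (poly w) = real (n * (n + 1)) * nsq a b (poly u) + real (n * (n + 1)) * nsq a b (poly v)"
      unfolding w poly_add_fun using uv by (simp add: nsq_add_eq L2_poly ring_distribs)
    also have "\<dots> \<le> ip a b (poly (legop a b u)) (poly u) + real (N * (N + 1)) * nsq a b (poly v)"
    proof (intro add_mono mult_right_mono nsq_nonneg)
      show "real (n * (n + 1)) \<le> real (N * (N + 1))" using False by (intro of_nat_mono mult_le_mono) auto
    qed (intro Suc.IH u u_orth)
    also have "\<dots> = ip a b (poly (legop a b w)) (poly w)"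
      unfolding w legop_add using Auv Avu Avv by (simp add: ip_poly_add_left ip_poly_add_right)
    finally show ?thesis .
  qed
qed

text \<open>Projection and projection error are orthogonal for the weighted form too, so the form of
  \<open>v\<close> dominates that of the error. The gap bounds the latter from below; the maximum
  \<open>((b - a) / 2)\<^sup>2\<close> of the weight bounds the former from above.\<close>

lemma err_poly_le:
  assumes "a \<le> b" "n \<ge> 1"
  shows "err a b n (poly v) \<le> ((b - a) / (2 * real n))\<^sup>2 * nsq a b (poly (pderiv v))"
proof -
  define u where "u = pr a b n (poly v)"
  define w where "w = v - u"
  have v: "v = u + w" by (simp add: w_def)
  have u: "plt n u" unfolding u_def by (intro pr_plt L2_poly)
  have w_orth: "ip a b (poly w) (poly q) = 0" if "plt n q" for q
    using pr_orth[OF L2_poly that, of a b v] by (simp add: w_def u_def poly_diff_fun)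
  have Auw: "ip a b (poly (legop a b u)) (poly w) = 0"
    using w_orth[OF plt_legop[OF u, of a b]] by (simp add: ip_commute)
  then have Awu: "ip a b (poly (legop a b w)) (poly u) = 0"
    using legop_sym[OF assms(1), of u w] by (simp add: ip_commute)
  obtain N where "plt N w" using plt_ex by blast
  then have "real (n * (n + 1)) * nsq a b (poly w) \<le> ip a b (poly (legop a b w)) (poly w)"
    by (rule legop_gap[OF assms(1) _ w_orth])
  also have "\<dots> \<le> ip a b (poly (legop a b v)) (poly v)"
    unfolding v legop_add using Auw Awu legop_nonneg[OF assms(1), of u]
    by (simp add: ip_poly_add_left ip_poly_add_right)
  also have "\<dots> \<le> ((b - a) / 2)\<^sup>2 * nsq a b (poly (pderiv v))" by (rule legop_le[OF assms(1)])
  finally have *: "real (n * (n + 1)) * nsq a b (poly w) \<le> ((b - a) / 2)\<^sup>2 * nsq a b (poly (pderiv v))" .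
  have "(real n)\<^sup>2 * nsq a b (poly w) \<le> real (n * (n + 1)) * nsq a b (poly w)"
    by (intro mult_right_mono nsq_nonneg) (simp add: power2_eq_square)
  with * have "(real n)\<^sup>2 * nsq a b (poly w) \<le> ((b - a) / 2)\<^sup>2 * nsq a b (poly (pderiv v))" by linarith
  moreover have "err a b n (poly v) = nsq a b (poly w)"
    by (simp add: err_def w_def u_def poly_diff_fun)
  ultimately show ?thesis using assms(2) by (simp add: field_simps power2_eq_square)
qed

text \<open>Approximate \<open>z\<close> by a polynomial and integrate. The two squared triangle
  inequalities lose a factor 4 in the main term, exactly the factor that \<open>err_poly_le\<close>
  has to spare.\<close>

lemma err_le_nsq_deriv:
  assumes "a \<le> b" "n \<ge> 1" and z: "L2 a b z" and g: "AE x in mu a b. g x = c + prim a z x"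
  shows "err a b n g \<le> ((b - a) / n)\<^sup>2 * nsq a b z"
proof (rule field_le_epsilon)
  fix d :: real assume "d > 0"
  define h where "h = b - a"
  \<comment> \<open>The error terms below add up to
    \<open>(2 * h\<^sup>2 + (h / n)\<^sup>2) * e\<close>; the additional 1 keeps the denominator
    positive.\<close>
  define e where "e = d / (2 * h\<^sup>2 + (h / n)\<^sup>2 + 1)"
  have pos: "2 * h\<^sup>2 + (h / n)\<^sup>2 + 1 > 0" by (intro add_nonneg_pos) auto
  then have e: "e > 0" using \<open>d > 0\<close> by (simp add: e_def)
  obtain Z where Z: "nsq a b (\<lambda>x. z x - poly Z x) < e" using L2_poly_dense[OF z e] .
  obtain G where G: "pderiv G = Z" using poly_antiderivative .
  define H where "H = G + [:c - poly G a:]"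
  have gL: "L2 a b g"
  proof (rule L2_cong_AE)
    show "L2 a b (\<lambda>x. c + prim a z x)" by (intro L2_add L2_const L2_prim z)
  qed (use g in auto)
  have zZ: "L2 a b (\<lambda>x. z x - poly Z x)" by (intro L2_diff z L2_poly)
  have "AE x in mu a b. prim a (\<lambda>x. z x - poly Z x) x = g x - poly H x"
    using g
  proof (rule AE_mp, intro AE_I2 impI)
    fix x assume "x \<in> space (mu a b)" and gx: "g x = c + prim a z x"
    then have x: "a \<le> x" "x \<le> b" by auto
    have "prim a (\<lambda>x. z x - poly Z x) x = prim a z x - prim a (poly Z) x"
      by (intro prim_diff[of a b] L2_integrable z L2_poly x)
    also have "prim a (poly Z) x = poly G x - poly G a" unfolding G[symmetric] by (rule prim_pderiv[OF x(1)])
    finally show "prim a (\<lambda>x. z x - poly Z x) x = g x - poly H x" using gx by (simp add: H_def)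
  qed
  then have "nsq a b (\<lambda>x. g x - poly H x) = nsq a b (prim a (\<lambda>x. z x - poly Z x))"
    by (intro nsq_cong_AE[symmetric] L2_prim zZ)
  also have "\<dots> \<le> h\<^sup>2 * nsq a b (\<lambda>x. z x - poly Z x)"
    unfolding h_def by (intro nsq_prim_le zZ assms)
  also have "\<dots> \<le> h\<^sup>2 * e" using Z by (intro mult_left_mono) auto
  finally have 1: "nsq a b (\<lambda>x. g x - poly H x) \<le> h\<^sup>2 * e" .
  have "nsq a b (poly Z) = nsq a b (\<lambda>x. z x + - (z x - poly Z x))" by simp
  also have "\<dots> \<le> 2 * nsq a b z + 2 * nsq a b (\<lambda>x. - (z x - poly Z x))"
    by (intro nsq_add_le z L2_minus zZ)
  also have "nsq a b (\<lambda>x. - (z x - poly Z x)) = nsq a b (\<lambda>x. z x - poly Z x)"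
    by (simp add: nsq_def power2_commute)
  finally have 2: "nsq a b (poly Z) \<le> 2 * nsq a b z + 2 * e" using Z by simp
  have "pderiv H = Z" by (simp add: H_def pderiv_add pderiv_pCons G)
  then have 3: "err a b n (poly H) \<le> (h / (2 * real n))\<^sup>2 * nsq a b (poly Z)"
    using err_poly_le[OF assms(1,2), of H] by (simp add: h_def)
  have "err a b n g = err a b n (\<lambda>x. (g x - poly H x) + poly H x)" by simp
  also have "\<dots> \<le> 2 * err a b n (\<lambda>x. g x - poly H x) + 2 * err a b n (poly H)"
    by (intro err_add_le L2_diff gL L2_poly)
  also have "\<dots> \<le> 2 * (h\<^sup>2 * e) + 2 * ((h / (2 * real n))\<^sup>2 * (2 * nsq a b z + 2 * e))"
  proof (intro add_mono mult_left_mono)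
    show "err a b n (\<lambda>x. g x - poly H x) \<le> h\<^sup>2 * e"
      by (intro order_trans[OF err_le_nsq 1] L2_diff gL L2_poly)
    have "(h / (2 * real n))\<^sup>2 * nsq a b (poly Z) \<le> (h / (2 * real n))\<^sup>2 * (2 * nsq a b z + 2 * e)"
      by (intro mult_left_mono 2) simp
    with 3 show "err a b n (poly H) \<le> (h / (2 * real n))\<^sup>2 * (2 * nsq a b z + 2 * e)" by linarith
  qed auto
  also have "\<dots> = (h / n)\<^sup>2 * nsq a b z + (2 * h\<^sup>2 + (h / n)\<^sup>2) * e"
    using assms(2) by (simp add: field_simps power2_eq_square)
  also have "(2 * h\<^sup>2 + (h / n)\<^sup>2) * e \<le> d"
  proof -
    have "(2 * h\<^sup>2 + (h / n)\<^sup>2 + 1) * e = d" using pos unfolding e_def by auto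
    then show ?thesis using e by (simp add: ring_distribs)
  qed
  finally show "err a b n g \<le> ((b - a) / n)\<^sup>2 * nsq a b z + d" by (simp only: h_def)
qed

text \<open>Subtract from \<open>g\<close> an antiderivative \<open>Q\<close> of the projection of
  \<open>z\<close> to degree below \<open>n - 1\<close>. Since \<open>Q\<close> has degree below
  \<open>n\<close>, \<open>err_shift_le\<close> applies, and the derivative that remains is the
  projection error of \<open>z\<close>.\<close>

lemma err_le_err_deriv:
  assumes "a \<le> b" "n \<ge> 1" and z: "L2 a b z" and g: "AE x in mu a b. g x = c + prim a z x"
  shows "err a b n g \<le> ((b - a) / n)\<^sup>2 * err a b (n - 1) z"
proof -
  define P where "P = pr a b (n - 1) z"
  obtain Q where Q: "pderiv Q = P" "\<And>n. plt n P \<Longrightarrow> plt (Suc n) Q"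
    using poly_antiderivative[of P] by metis
  have "plt (n - 1) P" unfolding P_def by (rule pr_plt[OF z])
  from Q(2)[OF this] have Qn: "plt n Q" using assms(2) by simp
  have gL: "L2 a b g"
  proof (rule L2_cong_AE)
    show "L2 a b (\<lambda>x. c + prim a z x)" by (intro L2_add L2_const L2_prim z)
  qed (use g in auto)
  have "err a b n g \<le> err a b n (\<lambda>x. g x - poly Q x)" by (rule err_shift_le[OF gL Qn])
  also have "\<dots> \<le> ((b - a) / n)\<^sup>2 * nsq a b (\<lambda>x. z x - poly P x)"
  proof (rule err_le_nsq_deriv[where c = "c - poly Q a"])
    show "AE x in mu a b. g x - poly Q x = c - poly Q a + prim a (\<lambda>x. z x - poly P x) x"
      using g
    proof (rule AE_mp, intro AE_I2 impI)
      fix x assume "x \<in> space (mu a b)" and gx: "g x = c + prim a z x"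
      then have x: "a \<le> x" "x \<le> b" by auto
      have "prim a (\<lambda>x. z x - poly P x) x = prim a z x - prim a (poly P) x"
        by (intro prim_diff[of a b] L2_integrable z L2_poly x)
      also have "prim a (poly P) x = poly Q x - poly Q a" unfolding Q(1)[symmetric] by (rule prim_pderiv[OF x(1)])
      finally show "g x - poly Q x = c - poly Q a + prim a (\<lambda>x. z x - poly P x) x" using gx by simp
    qed
  qed (use assms in \<open>auto intro!: L2_diff L2_poly\<close>)
  finally show ?thesis by (simp add: err_def P_def)
qed

text \<open>Both sides are continuous in \<open>z\<close> for the L2 norm and agree for polynomials
  by the fundamental theorem, hence they agree for all \<open>z\<close> by density. \<open>D\<close>
  is the defect of the identity.\<close>

lemma ip_prim_parts:
  assumes ab: "a \<le> b" and z: "L2 a b z"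
    and F: "\<And>x. x \<in> {a..b} \<Longrightarrow> (F has_real_derivative f x) (at x within {a..b})"
    and f: "continuous_on {a..b} f"
  shows "ip a b (prim a z) f + ip a b z F = prim a z b * F b"
proof -
  have Fc: "continuous_on {a..b} F"
    using F by (meson DERIV_continuous_on)
  have fL: "L2 a b f" and FL: "L2 a b F" using f Fc by (auto intro: L2_continuous)
  define D where "D u = ip a b (prim a u) f + ip a b u F - prim a u b * F b" for u
  \<comment> \<open>The factor 3 comes from the square of a sum of three terms; each summand bounds
    one term of the defect.\<close>
  define K where "K = 3 * ((b - a)\<^sup>2 * nsq a b f + nsq a b F + (b - a) * (F b)\<^sup>2)"
  have K: "K \<ge> 0" unfolding K_def using ab nsq_nonneg by (auto intro!: add_nonneg_nonneg mult_nonneg_nonneg)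
  have D_bound: "(D u)\<^sup>2 \<le> K * nsq a b u" if u: "L2 a b u" for u
  proof -
    have "(ip a b (prim a u) f)\<^sup>2 \<le> nsq a b (prim a u) * nsq a b f"
      by (intro cs_ip L2_prim u fL)
    also have "\<dots> \<le> ((b - a)\<^sup>2 * nsq a b u) * nsq a b f"
      by (intro mult_right_mono nsq_prim_le u ab nsq_nonneg)
    finally have 1: "(ip a b (prim a u) f)\<^sup>2 \<le> (b - a)\<^sup>2 * nsq a b u * nsq a b f" .
    have 2: "(ip a b u F)\<^sup>2 \<le> nsq a b u * nsq a b F" by (intro cs_ip u FL)
    have "(prim a u b)\<^sup>2 * (F b)\<^sup>2 \<le> ((b - a) * nsq a b u) * (F b)\<^sup>2"
      by (intro mult_right_mono prim_bound_interval u ab) auto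
    then have 3: "(prim a u b * F b)\<^sup>2 \<le> (b - a) * nsq a b u * (F b)\<^sup>2" by (simp add: power_mult_distrib)
    have "(x + y - w)\<^sup>2 \<le> 3 * (x\<^sup>2 + y\<^sup>2 + w\<^sup>2)" for x y w :: real
    proof -
      have "0 \<le> (x - y)\<^sup>2 + (x + w)\<^sup>2 + (y + w)\<^sup>2" by simp
      then show ?thesis by (simp add: power2_eq_square algebra_simps)
    qed
    then have "(D u)\<^sup>2 \<le> 3 * ((ip a b (prim a u) f)\<^sup>2 + (ip a b u F)\<^sup>2 + (prim a u b * F b)\<^sup>2)"
      unfolding D_def .
    also have "\<dots> \<le> K * nsq a b u" unfolding K_def using 1 2 3 by (simp add: algebra_simps)
    finally show ?thesis .
  qed
  have D_poly: "D (poly Z) = 0" for Z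
  proof -
    obtain G where G: "pderiv G = Z" using poly_antiderivative .
    define H where "H = G + [:- poly G a:]"
    have H: "pderiv H = Z" by (simp add: H_def pderiv_add pderiv_pCons G)
    have Ha: "poly H a = 0" by (simp add: H_def)
    have pr: "prim a (poly Z) x = poly H x" if "a \<le> x" for x
      using prim_pderiv[OF that, of H] by (simp add: H Ha)
    have "integral\<^sup>L (mu a b) (\<lambda>x. poly H x * f x + poly Z x * F x) = poly H b * F b - poly H a * F a"
    proof (rule integral_mu_FTC[OF ab])
      show "((\<lambda>x. poly H x * F x) has_real_derivative poly H x * f x + poly Z x * F x) (at x within {a..b})"
        if "x \<in> {a..b}" for x
        using DERIV_mult[OF DERIV_subset[OF poly_DERIV[of H x], of "{a..b}"] F[OF that]] unfolding H
        by (simp add: algebra_simps)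
      show "continuous_on {a..b} (\<lambda>x. poly H x * f x + poly Z x * F x)"
        by (intro continuous_intros f Fc)
    qed
    moreover have "ip a b (prim a (poly Z)) f = ip a b (poly H) f"
      unfolding ip_def by (rule Bochner_Integration.integral_cong) (auto simp: pr)
    ultimately show ?thesis
      unfolding D_def using ab Ha
      by (simp add: pr ip_def L2_mult_integrable L2_poly fL FL)
  qed
  have "(D z)\<^sup>2 \<le> 0"
  proof (rule field_le_epsilon)
    fix e :: real assume e: "e > 0"
    obtain Z where Z: "nsq a b (\<lambda>x. z x - poly Z x) < e / (K + 1)"
      using L2_poly_dense[OF z, of "e / (K + 1)"] e K by auto
    have "prim a (\<lambda>x. z x - poly Z x) x = prim a z x - prim a (poly Z) x" if "x \<le> b" for x
      by (intro prim_diff[of a b] L2_integrable z L2_poly that)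
    then have "ip a b (prim a (\<lambda>x. z x - poly Z x)) f = ip a b (\<lambda>x. prim a z x - prim a (poly Z) x) f"
      and "prim a (\<lambda>x. z x - poly Z x) b = prim a z b - prim a (poly Z) b"
      unfolding ip_def by (auto intro!: Bochner_Integration.integral_cong)
    then have "D (\<lambda>x. z x - poly Z x) = D z - D (poly Z)"
      unfolding D_def using z fL FL
      by (simp add: ip_diff_left L2_prim L2_poly left_diff_distrib)
    then have "(D z)\<^sup>2 \<le> K * nsq a b (\<lambda>x. z x - poly Z x)"
      using D_bound[of "\<lambda>x. z x - poly Z x"] z by (simp add: D_poly L2_diff L2_poly)
    also have "\<dots> \<le> K * (e / (K + 1))" using Z K by (intro mult_left_mono) auto
    also have "\<dots> \<le> e" using K e by (simp add: field_simps)
    finally show "(D z)\<^sup>2 \<le> 0 + e" by simp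
  qed
  then show ?thesis by (simp add: D_def)
qed

section \<open>Functions with several derivatives\<close>

text \<open>The Sobolev space of order \<open>k\<close> without test functions: each entry is a.e. a
  primitive of the next one, up to a constant. Equality is only a.e. because the entries will be
  chosen representatives of weak derivatives.\<close>

definition chain :: "real \<Rightarrow> real \<Rightarrow> nat \<Rightarrow> (nat \<Rightarrow> real \<Rightarrow> real) \<Rightarrow> bool" where
  "chain a b k g \<longleftrightarrow> (\<forall>j\<le>k. L2 a b (g j)) \<and>
     (\<forall>j<k. \<exists>c. AE x in mu a b. g j x = c + prim a (g (Suc j)) x)"

lemma chain_subset:
  assumes "chain a b k g" "a \<le> c" "d \<le> b"
  shows "chain c d k g"
  unfolding chain_def
proof (intro conjI allI impI)
  show "L2 c d (g j)" if "j \<le> k" for j using assms that by (auto simp: chain_def intro: L2_subset)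
  fix j assume j: "j < k"
  then obtain e where e: "AE x in mu a b. g j x = e + prim a (g (Suc j)) x"
    using assms(1) by (auto simp: chain_def)
  have i: "integrable (mu a b) (g (Suc j))" using assms(1) j by (auto simp: chain_def intro!: L2_integrable)
  have "AE x in mu c d. g j x = e + prim a (g (Suc j)) x" by (rule AE_mu_subset[OF e assms(2,3)])
  then have "AE x in mu c d. g j x = (e + prim a (g (Suc j)) c) + prim c (g (Suc j)) x"
  proof (rule AE_mp, intro AE_I2 impI)
    fix x assume "x \<in> space (mu c d)" and gx: "g j x = e + prim a (g (Suc j)) x"
    then show "g j x = (e + prim a (g (Suc j)) c) + prim c (g (Suc j)) x"
      using prim_split[OF i, of c x] assms by auto
  qed
  then show "\<exists>e. AE x in mu c d. g j x = e + prim c (g (Suc j)) x" by blast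
qed

text \<open>Each use of \<open>err_le_err_deriv\<close> consumes one derivative and one degree, so
  the denominators run down from \<open>n\<close>.\<close>

lemma chain_err_prod:
  assumes "a \<le> b" "chain a b k g" "k \<le> n"
  shows "err a b n (g 0) \<le> (\<Prod>i<k. ((b - a) / real (n - i))\<^sup>2) * err a b (n - k) (g k)"
  using assms(2,3)
proof (induction k)
  case (Suc k)
  then have "chain a b k g" "k \<le> n" by (auto simp: chain_def)
  from Suc.IH[OF this]
  have "err a b n (g 0) \<le> (\<Prod>i<k. ((b - a) / real (n - i))\<^sup>2) * err a b (n - k) (g k)" .
  also have "\<dots> \<le> (\<Prod>i<k. ((b - a) / real (n - i))\<^sup>2) *
      (((b - a) / real (n - k))\<^sup>2 * err a b (n - k - 1) (g (Suc k)))"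
  proof (intro mult_left_mono prod_nonneg)
    obtain c where "AE x in mu a b. g k x = c + prim a (g (Suc k)) x"
      using Suc.prems by (auto simp: chain_def)
    then show "err a b (n - k) (g k) \<le> ((b - a) / real (n - k))\<^sup>2 * err a b (n - k - 1) (g (Suc k))"
      using Suc.prems by (intro err_le_err_deriv assms(1)) (auto simp: chain_def)
  qed auto
  finally show ?case by (simp add: mult.assoc)
qed simp

lemma chain_err:
  assumes "a \<le> b" "chain a b k g" "k \<le> n"
  shows "err a b n (g 0) \<le> (real k * (b - a) / real n) ^ (2 * k) * err a b (n - k) (g k)"
proof -
  have "(\<Prod>i<k. ((b - a) / real (n - i))\<^sup>2) \<le> (\<Prod>i<k. (real k * (b - a) / real n)\<^sup>2)"
  proof (intro prod_mono conjI power_mono)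
    fix i assume "i \<in> {..<k}"
    then have i: "i < k" by simp
    have "real n \<le> real k * real (n - i)"
    proof -
      \<comment> \<open>\<open>(k - 1) * (n - k)\<close> is nonnegative, which says
        \<open>n \<le> k * (n - k + 1)\<close>, and \<open>i < k\<close>. So replacing a denominator
        by \<open>n\<close> costs at most a factor \<open>k\<close>.\<close>
      have "n \<le> k * (n - i)"
      proof -
        have "0 \<le> (int k - 1) * (int n - int k)" using i assms(3) by simp
        then have "int n \<le> int k * (int n - (int k - 1))" by (simp add: algebra_simps)
        also have "\<dots> \<le> int k * (int n - int i)" using i by (intro mult_left_mono) auto
        also have "\<dots> = int (k * (n - i))" using i assms(3) by (simp add: of_nat_diff)
        finally show ?thesis by linarith
      qed
      then show ?thesis by (metis of_nat_le_iff of_nat_mult)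
    qed
    then have "(b - a) * real n \<le> (b - a) * (real k * real (n - i))"
      using assms(1) by (intro mult_left_mono) auto
    then show "(b - a) / real (n - i) \<le> real k * (b - a) / real n"
      using i assms(3) by (simp add: field_simps)
  qed (use assms in auto)
  also have "\<dots> = (real k * (b - a) / real n) ^ (2 * k)" by (simp add: power_mult)
  finally show ?thesis
    using chain_err_prod[OF assms] err_nonneg[of a b "n - k" "g k"]
    by (meson mult_right_mono order_trans)
qed

section \<open>Approximation in fractional spaces\<close>

text \<open>The double integral of \<open>(w x - w y)\<^sup>2\<close> over the product of \<open>(c, d)\<close> and \<open>(c', d')\<close>.\<close>

definition sq_diff_integral :: "(real \<Rightarrow> real) \<Rightarrow> real \<Rightarrow> real \<Rightarrow> real \<Rightarrow> real \<Rightarrow> real" where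
  "sq_diff_integral w c d c' d' = (d' - c') * nsq c d w - 2 * prim c w d * prim c' w d' + (d - c) * nsq c' d' w"

text \<open>Expanding the square gives the inner integral in closed form as a function of
  \<open>x\<close>, so the iterated integral is computed without any argument on the product
  space.\<close>

lemma nn_integral_sq_diff:
  assumes L: "\<And>i. i < M \<Longrightarrow> L2 a b (w i)"
    and J: "a \<le> c" "c \<le> d" "d \<le> b" "a \<le> c'" "c' \<le> d'" "d' \<le> b"
  shows "(\<integral>\<^sup>+x. \<integral>\<^sup>+y. ennreal (\<Sum>i<M. (w i x - w i y)\<^sup>2) \<partial>mu c' d' \<partial>mu c d)
    = ennreal (\<Sum>i<M. sq_diff_integral (w i) c d c' d')"
proof -
  have L1: "L2 c d (w i)" and L1': "L2 c' d' (w i)" if "i < M" for i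
    using L[OF that] J by (auto intro: L2_subset)
  define I where "I i x = (d' - c') * (w i x)\<^sup>2 - 2 * prim c' (w i) d' * w i x + nsq c' d' (w i)" for i x
  have has1: "has_bochner_integral (mu c' d') (\<lambda>y. (w i x - w i y)\<^sup>2) (I i x)" if "i < M" for i x
  proof -
    have "(\<lambda>y. (w i x - w i y)\<^sup>2) = (\<lambda>y. (w i x)\<^sup>2 - 2 * w i x * w i y + (w i y)\<^sup>2)"
      by (auto simp: power2_diff)
    moreover have "integrable (mu c' d') (\<lambda>y. (w i x)\<^sup>2 - 2 * w i x * w i y + (w i y)\<^sup>2)"
      using L2_integrable[OF L1'[OF that]] L2_square[OF L1'[OF that]] integrable_mu_const by auto
    moreover have "integral\<^sup>L (mu c' d') (\<lambda>y. (w i x)\<^sup>2 - 2 * w i x * w i y + (w i y)\<^sup>2) = I i x"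
      using L2_integrable[OF L1'[OF that]] L2_square[OF L1'[OF that]] integrable_mu_const[of c' d'] J
      by (simp add: I_def nsq_def prim_def integral_mu_const algebra_simps del: Bochner_Integration.lebesgue_integral_const)
    ultimately show ?thesis by (simp add: has_bochner_integral_iff)
  qed
  have inner: "(\<integral>\<^sup>+y. ennreal (\<Sum>i<M. (w i x - w i y)\<^sup>2) \<partial>mu c' d') = ennreal (\<Sum>i<M. I i x)" for x
    using has_bochner_integral_sum[of "{..<M}" "mu c' d'" "\<lambda>i y. (w i x - w i y)\<^sup>2" "\<lambda>i. I i x"] has1
    by (subst nn_integral_eq_integral) (auto simp: has_bochner_integral_iff sum_nonneg)
  have I_nonneg: "0 \<le> I i x" if "i < M" for i x
  proof -
    have "I i x = integral\<^sup>L (mu c' d') (\<lambda>y. (w i x - w i y)\<^sup>2)"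
      using has1[OF that, of x] by (simp add: has_bochner_integral_iff)
    then show ?thesis by simp
  qed
  have has2: "has_bochner_integral (mu c d) (I i) (sq_diff_integral (w i) c d c' d')" if "i < M" for i
    unfolding I_def sq_diff_integral_def has_bochner_integral_iff
    using L2_integrable[OF L1[OF that]] L2_square[OF L1[OF that]] integrable_mu_const[of c d] J
    by (auto simp: nsq_def prim_def integral_mu_const algebra_simps simp del: Bochner_Integration.lebesgue_integral_const)
  show ?thesis
    unfolding inner
    using has_bochner_integral_sum[of "{..<M}" "mu c d" "\<lambda>i. I i"] has2 I_nonneg
    by (subst nn_integral_eq_integral) (auto simp: has_bochner_integral_iff intro!: AE_I2 sum_nonneg)
qed

text \<open>The classical variance identity; both sides are expanded.\<close>

lemma nsq_diff_mean:
  assumes "c < d" "L2 c d w"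
  shows "nsq c d (\<lambda>x. w x - prim c w d / (d - c)) = sq_diff_integral w c d c d / (2 * (d - c))"
proof -
  let ?m = "prim c w d / (d - c)"
  have "ip c d w (\<lambda>x. ?m) = ?m * prim c w d"
    by (simp add: ip_def prim_def)
  then have "nsq c d (\<lambda>x. w x - ?m) = nsq c d w - 2 * (?m * prim c w d) + ?m\<^sup>2 * (d - c)"
    using assms by (simp add: nsq_diff_eq L2_const nsq_const)
  also have "\<dots> = sq_diff_integral w c d c d / (2 * (d - c))"
  proof -
    have "Q - 2 * (P / h * P) + (P / h)\<^sup>2 * h = (h * Q - 2 * P * P + h * Q) / (2 * h)" if "h > 0" for P Q h :: real
      using that by (simp add: field_simps power2_eq_square)
    then show ?thesis unfolding sq_diff_integral_def using assms(1) by simp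
  qed
  finally show ?thesis .
qed

text \<open>Jensen's inequality for the difference of two averages. After expansion it is
  Cauchy-Schwarz against the constant 1 on each cell.\<close>

lemma mean_diff_le:
  assumes "L2 c d w" "L2 d e w" "d - c = h" "e - d = h" "h > 0"
  shows "h * (prim d w e / h - prim c w d / h)\<^sup>2 \<le> sq_diff_integral w c d d e / h"
proof -
  have "(prim c w d)\<^sup>2 \<le> h * nsq c d w" "(prim d w e)\<^sup>2 \<le> h * nsq d e w"
    using prim_bound_interval[OF assms(1), of d] prim_bound_interval[OF assms(2), of e] assms by auto
  then have "(prim d w e - prim c w d)\<^sup>2 \<le> sq_diff_integral w c d d e"
    using assms(3,4) by (simp add: sq_diff_integral_def power2_diff algebra_simps)
  then have "(prim d w e - prim c w d)\<^sup>2 / h \<le> sq_diff_integral w c d d e / h"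
    using assms(5) by (intro divide_right_mono) auto
  moreover have "h * (prim d w e / h - prim c w d / h)\<^sup>2 = (prim d w e - prim c w d)\<^sup>2 / h"
    using assms(5) by (simp add: power2_eq_square field_simps)
  ultimately show ?thesis by simp
qed

lemma indicator_measurable_mu: "indicat_real {c<..<d} \<in> borel_measurable (mu a b)"
  by (rule measurable_restrict_space1, rule borel_measurable_indicator) simp

text \<open>Compare with the continuous piecewise linear function that interpolates the cell averages.\<close>

lemma err_le_cells:
  fixes a b :: real and n :: nat
  assumes ab: "a < b" and n: "n \<ge> 1" and w: "L2 a b w"
  defines "h \<equiv> (b - a) / n"
  defines "t \<equiv> \<lambda>c::nat. a + c * h"
  shows "err a b n w \<le> (\<Sum>c<n. (2 * sq_diff_integral w (t c) (t (Suc c)) (t c) (t (Suc c)) +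
     6 * (if Suc c < n then sq_diff_integral w (t c) (t (Suc c)) (t (Suc c)) (t (Suc (Suc c))) else 0)) / h)"
proof -
  have h: "h > 0" using ab n by (simp add: h_def)
  have t0: "t 0 = a" by (simp add: t_def)
  have tn: "t n = b" using n by (simp add: t_def h_def)
  have tS: "t (Suc c) = t c + h" for c by (simp add: t_def algebra_simps)
  have t_mono: "t c \<le> t c'" if "c \<le> c'" for c c' using that h by (auto simp: t_def intro!: mult_right_mono)
  have ta: "a \<le> t c" for c using t_mono[of 0 c] t0 by simp
  have tb: "t c \<le> b" if "c \<le> n" for c using t_mono[OF that] tn by simp
  have wL: "L2 (t c) (t (Suc c)) w" if "c < n" for c
    using w ta[of c] tb[of "Suc c"] that by (auto intro: L2_subset)
  \<comment> \<open>The average over cell \<open>c\<close>. The \<open>min\<close> repeats the last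
    average, which makes the interpolant constant on the last cell.\<close>
  define m where "m c = prim (t (min c (n - 1))) w (t (Suc (min c (n - 1)))) / h" for c
  have m_eq: "m c = prim (t c) w (t (Suc c)) / h" if "c < n" for c
    using that by (simp add: m_def min_absorb1)
  have m_n: "m (Suc c) = m c" if "Suc c = n" for c
    using that by (auto simp: m_def)
  \<comment> \<open>Slopes: on cell \<open>c\<close> the interpolant runs from \<open>m c\<close> at
    the left node to \<open>m (Suc c)\<close> at the right node, so averages are attached to left
    nodes.\<close>
  define d where "d c = (m (Suc c) - m c) / h" for c
  define z where "z x = (\<Sum>c<n. d c * indicator {t c<..<t (Suc c)} x)" for x
  define G' where "G' c = (if Suc c < n then sq_diff_integral w (t c) (t (Suc c)) (t (Suc c)) (t (Suc (Suc c))) else 0)" for c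
  have jump: "h * (m (Suc c) - m c)\<^sup>2 \<le> G' c / h" if "c < n" for c
  proof (cases "Suc c < n")
    case True
    then show ?thesis
      unfolding G'_def m_eq[OF that] m_eq[OF True]
      using mean_diff_le[OF wL[OF that] wL[OF True], of h] h by (simp add: tS)
  next
    case False
    have "m (Suc c) = m c" by (rule m_n) (use False that in simp)
    with False show ?thesis by (simp add: G'_def)
  qed
  have z_cell: "z x = d c" if "c < n" "x \<in> {t c<..<t (Suc c)}" for c x
  proof -
    have "d c' * indicator {t c'<..<t (Suc c')} x = (if c' = c then d c else 0)" for c'
      using that(2) t_mono[of "Suc c" c'] t_mono[of "Suc c'" c]
      by (cases c' c rule: linorder_cases) auto
    then show ?thesis using that(1) by (simp add: z_def)
  qed
  have zL: "L2 a b z"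
    unfolding z_def
    by (intro L2_sum L2_cmult L2_bounded[where B = 1]) (auto split: split_indicator intro!: indicator_measurable_mu)
  have zi: "integrable (mu a b) z" by (rule L2_integrable[OF zL])
  have prim_in_cell: "prim (t c) z x = d c * (x - t c)" if "c < n" "t c \<le> x" "x \<le> t (Suc c)" for c x
  proof -
    have "prim (t c) z x = integral\<^sup>L (mu (t c) x) (\<lambda>_. d c)"
      unfolding prim_def by (rule Bochner_Integration.integral_cong) (use that z_cell in auto)
    then show ?thesis using that(2) by (simp add: integral_mu_const del: Bochner_Integration.lebesgue_integral_const)
  qed
  have prim_node: "prim a z (t c) = m c - m 0" if "c \<le> n" for c
    using that
  proof (induction c)
    case 0
    then show ?case by (simp add: t0 prim_self)
  next
    case (Suc c)
    have "prim a z (t (Suc c)) = prim a z (t c) + prim (t c) z (t (Suc c))"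
      using Suc.prems by (intro prim_split[OF zi] ta t_mono tb) auto
    also have "prim (t c) z (t (Suc c)) = d c * h"
      using Suc.prems h by (subst prim_in_cell) (auto simp: tS)
    finally show ?case using Suc h by (simp add: d_def)
  qed
  define g where "g x = m 0 + prim a z x" for x
  have gL: "L2 a b g" unfolding g_def by (intro L2_add L2_const L2_prim zL)
  have g_cell: "g x = m c + d c * (x - t c)" if "c < n" "x \<in> {t c<..<t (Suc c)}" for c x
  proof -
    have "prim a z x = prim a z (t c) + prim (t c) z x"
      using that tb[of "Suc c"] by (intro prim_split[OF zi] ta) auto
    then show ?thesis using that prim_node[of c] prim_in_cell[of c x] by (simp add: g_def)
  qed
  have cell: "nsq (t c) (t (Suc c)) (\<lambda>x. w x - g x) \<le> sq_diff_integral w (t c) (t (Suc c)) (t c) (t (Suc c)) / h + 2 * G' c / h"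
    if c: "c < n" for c
  proof -
    have gLc: "L2 (t c) (t (Suc c)) g" using gL ta[of c] tb[of "Suc c"] c by (auto intro: L2_subset)
    have "nsq (t c) (t (Suc c)) (\<lambda>x. w x - g x) = nsq (t c) (t (Suc c)) (\<lambda>x. (w x - m c) + (m c - g x))" by simp
    also have "\<dots> \<le> 2 * nsq (t c) (t (Suc c)) (\<lambda>x. w x - m c) + 2 * nsq (t c) (t (Suc c)) (\<lambda>x. m c - g x)"
      by (intro nsq_add_le L2_diff L2_const wL c gLc)
    also have "nsq (t c) (t (Suc c)) (\<lambda>x. w x - m c) = sq_diff_integral w (t c) (t (Suc c)) (t c) (t (Suc c)) / (2 * h)"
      using nsq_diff_mean[OF _ wL[OF c]] h c by (simp add: m_eq[OF c] tS)
    also have "nsq (t c) (t (Suc c)) (\<lambda>x. m c - g x) \<le> nsq (t c) (t (Suc c)) (\<lambda>x. m (Suc c) - m c)"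
    proof (intro nsq_mono L2_diff L2_const gLc)
      fix x assume x: "x \<in> {t c<..<t (Suc c)}"
      have "\<bar>m c - g x\<bar> = \<bar>d c\<bar> * (x - t c)" using x by (simp add: g_cell[OF c x] abs_mult)
      also have "\<dots> \<le> \<bar>d c\<bar> * h" using x by (intro mult_left_mono) (auto simp: tS)
      also have "\<dots> = \<bar>m (Suc c) - m c\<bar>" using h by (simp add: d_def)
      finally show "(m c - g x)\<^sup>2 \<le> (m (Suc c) - m c)\<^sup>2" by (simp add: abs_le_square_iff)
    qed
    also have "nsq (t c) (t (Suc c)) (\<lambda>x. m (Suc c) - m c) = h * (m (Suc c) - m c)\<^sup>2"
      using h by (simp add: nsq_const tS)
    also have "\<dots> \<le> G' c / h" by (rule jump[OF c])
    finally show ?thesis by simp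
  qed
  have "nsq a b (\<lambda>x. w x - g x) = (\<Sum>c<n. nsq (t c) (t (Suc c)) (\<lambda>x. w x - g x))"
    unfolding nsq_def t0[symmetric] tn[symmetric]
    by (rule integral_mu_partition) (auto simp: t0 tn tS h less_imp_le intro!: L2_square L2_diff w gL)
  also have "\<dots> \<le> (\<Sum>c<n. sq_diff_integral w (t c) (t (Suc c)) (t c) (t (Suc c)) / h + 2 * G' c / h)"
    by (intro sum_mono cell) auto
  finally have 1: "nsq a b (\<lambda>x. w x - g x) \<le> (\<Sum>c<n. sq_diff_integral w (t c) (t (Suc c)) (t c) (t (Suc c)) / h + 2 * G' c / h)" .
  have "nsq a b z = (\<Sum>c<n. nsq (t c) (t (Suc c)) z)"
    unfolding nsq_def t0[symmetric] tn[symmetric]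
    by (rule integral_mu_partition) (auto simp: t0 tn tS h less_imp_le intro!: L2_square zL)
  also have "\<dots> = (\<Sum>c<n. (d c)\<^sup>2 * h)"
  proof (rule sum.cong)
    fix c assume "c \<in> {..<n}"
    then have "nsq (t c) (t (Suc c)) z = nsq (t c) (t (Suc c)) (\<lambda>_. d c)"
      unfolding nsq_def by (intro Bochner_Integration.integral_cong) (auto simp: z_cell)
    then show "nsq (t c) (t (Suc c)) z = (d c)\<^sup>2 * h" using h by (simp add: nsq_const tS)
  qed simp
  finally have "h\<^sup>2 * nsq a b z = (\<Sum>c<n. h * (m (Suc c) - m c)\<^sup>2)"
    using h by (simp add: sum_distrib_left d_def power2_eq_square)
  also have "\<dots> \<le> (\<Sum>c<n. G' c / h)" by (intro sum_mono jump) auto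
  finally have 2: "h\<^sup>2 * nsq a b z \<le> (\<Sum>c<n. G' c / h)" .
  have "err a b n w = err a b n (\<lambda>x. (w x - g x) + g x)" by simp
  also have "\<dots> \<le> 2 * err a b n (\<lambda>x. w x - g x) + 2 * err a b n g"
    by (intro err_add_le L2_diff w gL)
  also have "err a b n (\<lambda>x. w x - g x) \<le> nsq a b (\<lambda>x. w x - g x)" by (intro err_le_nsq L2_diff w gL)
  \<comment> \<open>There are as many cells as admissible degrees, so the factor
    \<open>(b - a) / n\<close> for the derivative of the interpolant is the cell length.\<close>
  also have "err a b n g \<le> h\<^sup>2 * nsq a b z"
    unfolding h_def using ab n zL by (intro err_le_nsq_deriv[where c = "m 0"]) (auto simp: g_def)
  finally have "err a b n w \<le> 2 * nsq a b (\<lambda>x. w x - g x) + 2 * (h\<^sup>2 * nsq a b z)" by simp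
  also have "\<dots> \<le> 2 * (\<Sum>c<n. sq_diff_integral w (t c) (t (Suc c)) (t c) (t (Suc c)) / h + 2 * G' c / h) + 2 * (\<Sum>c<n. G' c / h)"
    by (intro add_mono mult_left_mono 1 2) auto
  \<comment> \<open>\<open>6 = 4 + 2\<close>: the jumps of the averages enter through
    \<open>w - g\<close> and through the slopes.\<close>
  also have "\<dots> = (\<Sum>c<n. (2 * sq_diff_integral w (t c) (t (Suc c)) (t c) (t (Suc c)) + 6 * G' c) / h)"
    unfolding sum_distrib_left sum.distrib[symmetric] by (intro sum.cong) (auto simp: add_divide_distrib)
  finally show ?thesis by (simp add: G'_def)
qed

text \<open>For the Slobodeckij seminorm \<open>s x\<close> is the inner integral, for the Hoelder seminorm it is constant.\<close>

definition mod_bound :: "real \<Rightarrow> real \<Rightarrow> nat \<Rightarrow> (nat \<Rightarrow> real \<Rightarrow> real) \<Rightarrow> real \<Rightarrow> (real \<Rightarrow> ennreal) \<Rightarrow> bool" where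
  "mod_bound a b M w \<sigma> s \<longleftrightarrow> (\<forall>c d \<rho>. a \<le> c \<longrightarrow> c < d \<longrightarrow> d \<le> b \<longrightarrow> \<rho> > 0 \<longrightarrow>
     (AE x in mu a b. (\<forall>y\<in>{c<..<d}. \<bar>x - y\<bar> \<le> \<rho>) \<longrightarrow>
       (\<integral>\<^sup>+y. ennreal (\<Sum>i<M. (w i x - w i y)\<^sup>2) \<partial>mu c d) \<le> ennreal (\<rho> powr (1 + 2 * \<sigma>)) * s x))"

lemma mod_bound_subset: "mod_bound a b M w \<sigma> s \<Longrightarrow> a \<le> c \<Longrightarrow> d \<le> b \<Longrightarrow> mod_bound c d M w \<sigma> s"
  unfolding mod_bound_def by (meson AE_mu_subset order_trans)

lemma mod_bound_sq_diff_integral: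
  assumes mod: "mod_bound a b M w \<sigma> s" and L: "\<And>i. i < M \<Longrightarrow> L2 a b (w i)"
    and J: "a \<le> c" "c \<le> d" "d \<le> b" "a \<le> c'" "c' < d'" "d' \<le> b" and \<rho>: "\<rho> > 0"
    and dist: "\<And>x y. x \<in> {c<..<d} \<Longrightarrow> y \<in> {c'<..<d'} \<Longrightarrow> \<bar>x - y\<bar> \<le> \<rho>"
    and s: "s \<in> borel_measurable (mu a b)"
  shows "ennreal (\<Sum>i<M. sq_diff_integral (w i) c d c' d') \<le> ennreal (\<rho> powr (1 + 2 * \<sigma>)) * (\<integral>\<^sup>+x. s x \<partial>mu c d)"
proof -
  have "ennreal (\<Sum>i<M. sq_diff_integral (w i) c d c' d') =
      (\<integral>\<^sup>+x. \<integral>\<^sup>+y. ennreal (\<Sum>i<M. (w i x - w i y)\<^sup>2) \<partial>mu c' d' \<partial>mu c d)"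
    by (rule nn_integral_sq_diff[symmetric, of M a b]) (use L J in auto)
  also have "\<dots> \<le> (\<integral>\<^sup>+x. ennreal (\<rho> powr (1 + 2 * \<sigma>)) * s x \<partial>mu c d)"
  proof (rule nn_integral_mono_AE)
    have "AE x in mu a b. (\<forall>y\<in>{c'<..<d'}. \<bar>x - y\<bar> \<le> \<rho>) \<longrightarrow>
       (\<integral>\<^sup>+y. ennreal (\<Sum>i<M. (w i x - w i y)\<^sup>2) \<partial>mu c' d') \<le> ennreal (\<rho> powr (1 + 2 * \<sigma>)) * s x"
      using mod J \<rho> unfolding mod_bound_def by blast
    from AE_mu_subset[OF this J(1,3)]
    show "AE x in mu c d. (\<integral>\<^sup>+y. ennreal (\<Sum>i<M. (w i x - w i y)\<^sup>2) \<partial>mu c' d') \<le> ennreal (\<rho> powr (1 + 2 * \<sigma>)) * s x"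
      by (rule AE_mp) (use dist in \<open>auto intro!: AE_I2\<close>)
  qed
  also have "\<dots> = ennreal (\<rho> powr (1 + 2 * \<sigma>)) * (\<integral>\<^sup>+x. s x \<partial>mu c d)"
    using measurable_mu_subset[OF s J(1,3)] by (rule nn_integral_cmult)
  finally show ?thesis .
qed

text \<open>In \<open>err_le_cells\<close> only equal and adjacent cells occur, so all pairs of
  points are at distance at most twice the cell length and \<open>mod_bound\<close> applies with
  that radius. Summing over the cells restores the full integral of \<open>s\<close>.\<close>

lemma err_mod_bound:
  fixes a b :: real and n :: nat
  assumes ab: "a < b" and n: "n \<ge> 1" and L: "\<And>i. i < M \<Longrightarrow> L2 a b (w i)"
    and mod: "mod_bound a b M w \<sigma> s" and s: "s \<in> borel_measurable (mu a b)"
    and \<sigma>: "0 \<le> \<sigma>" "\<sigma> \<le> 1"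
  shows "ennreal (\<Sum>i<M. err a b n (w i)) \<le> ennreal (64 * ((b - a) / n) powr (2 * \<sigma>)) * (\<integral>\<^sup>+x. s x \<partial>mu a b)"
proof -
  define h where "h = (b - a) / n"
  define t where "t c = a + c * h" for c :: nat
  have h: "h > 0" using ab n by (simp add: h_def)
  have t0: "t 0 = a" by (simp add: t_def)
  have tn: "t n = b" using n by (simp add: t_def h_def)
  have tS: "t (Suc c) = t c + h" for c by (simp add: t_def algebra_simps)
  have t_mono: "t c \<le> t c'" if "c \<le> c'" for c c' using that h by (auto simp: t_def intro!: mult_right_mono)
  have ta: "a \<le> t c" for c using t_mono[of 0 c] t0 by simp
  have tb: "t c \<le> b" if "c \<le> n" for c using t_mono[OF that] tn by simp
  define G where "G c = (\<Sum>i<M. sq_diff_integral (w i) (t c) (t (Suc c)) (t c) (t (Suc c)))" for c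
  define G' where "G' c = (if Suc c < n then \<Sum>i<M. sq_diff_integral (w i) (t c) (t (Suc c)) (t (Suc c)) (t (Suc (Suc c))) else 0)" for c
  define K where "K = (2 * h) powr (1 + 2 * \<sigma>)"
  define S where "S c = (\<integral>\<^sup>+x. s x \<partial>mu (t c) (t (Suc c)))" for c
  have G: "ennreal (G c) \<le> ennreal K * S c" if "c < n" for c
    unfolding G_def K_def S_def using that h ta[of c] tb[of "Suc c"]
    by (intro mod_bound_sq_diff_integral[OF mod L _ _ _ _ _ _ _ _ s]) (auto simp: tS)
  have G': "ennreal (G' c) \<le> ennreal K * S c" if "c < n" for c
  proof (cases "Suc c < n")
    case True
    then show ?thesis
      unfolding G'_def K_def S_def using that h ta[of c] ta[of "Suc c"] tb[of "Suc c"] tb[of "Suc (Suc c)"]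
      by (simp only: if_True, intro mod_bound_sq_diff_integral[OF mod L _ _ _ _ _ _ _ _ s]) (auto simp: tS)
  qed (simp add: G'_def)
  have nonneg: "0 \<le> sq_diff_integral (w i) (t c) (t (Suc c)) (t c) (t (Suc c))"
    "Suc c < n \<Longrightarrow> 0 \<le> sq_diff_integral (w i) (t c) (t (Suc c)) (t (Suc c)) (t (Suc (Suc c)))" if "i < M" "c < n" for i c
  proof -
    have wL: "L2 (t c) (t (Suc c)) (w i)" if "c < n" for c
      using L[OF \<open>i < M\<close>] ta[of c] tb[of "Suc c"] that by (auto intro: L2_subset)
    have "0 \<le> sq_diff_integral (w i) (t c) (t (Suc c)) (t c) (t (Suc c)) / (2 * (t (Suc c) - t c))"
      using nsq_diff_mean[OF _ wL[OF that(2)]] nsq_nonneg h by (metis less_add_same_cancel1 tS)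
    then show "0 \<le> sq_diff_integral (w i) (t c) (t (Suc c)) (t c) (t (Suc c))" using h by (simp add: tS zero_le_divide_iff)
    assume "Suc c < n"
    have "0 \<le> h * (prim (t (Suc c)) (w i) (t (Suc (Suc c))) / h - prim (t c) (w i) (t (Suc c)) / h)\<^sup>2" using h by simp
    also have "\<dots> \<le> sq_diff_integral (w i) (t c) (t (Suc c)) (t (Suc c)) (t (Suc (Suc c))) / h"
      using \<open>Suc c < n\<close> that h by (intro mean_diff_le wL) (auto simp: tS)
    finally show "0 \<le> sq_diff_integral (w i) (t c) (t (Suc c)) (t (Suc c)) (t (Suc (Suc c)))"
      using h by (simp add: zero_le_divide_iff)
  qed
  have Gn: "0 \<le> G c" "0 \<le> G' c" if "c < n" for c
    unfolding G_def G'_def using nonneg that by (auto intro!: sum_nonneg)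
  have "(\<Sum>i<M. err a b n (w i)) \<le> (\<Sum>i<M. \<Sum>c<n. (2 * sq_diff_integral (w i) (t c) (t (Suc c)) (t c) (t (Suc c)) +
     6 * (if Suc c < n then sq_diff_integral (w i) (t c) (t (Suc c)) (t (Suc c)) (t (Suc (Suc c))) else 0)) / h)"
    unfolding t_def h_def by (intro sum_mono err_le_cells ab n L) auto
  also have "\<dots> = (\<Sum>c<n. (2 * G c + 6 * G' c) / h)"
    by (subst sum.swap) (auto intro!: sum.cong simp: G_def G'_def sum.distrib sum_distrib_left sum_divide_distrib add_divide_distrib)
  finally have "ennreal (\<Sum>i<M. err a b n (w i)) \<le> ennreal (\<Sum>c<n. (2 * G c + 6 * G' c) / h)"
    by (rule ennreal_leI)
  also have "\<dots> = (\<Sum>c<n. ennreal ((2 * G c + 6 * G' c) / h))"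
    using Gn h by (intro sum_ennreal[symmetric]) auto
  also have "\<dots> \<le> (\<Sum>c<n. ennreal (8 * K / h) * S c)"
  proof (rule sum_mono)
    fix c assume "c \<in> {..<n}"
    then have c: "c < n" by simp
    have "ennreal ((2 * G c + 6 * G' c) / h) = ennreal (2 / h) * ennreal (G c) + ennreal (6 / h) * ennreal (G' c)"
      using Gn[OF c] h by (simp add: ennreal_mult[symmetric] ennreal_plus[symmetric] add_divide_distrib del: ennreal_plus)
    also have "\<dots> \<le> ennreal (2 / h) * (ennreal K * S c) + ennreal (6 / h) * (ennreal K * S c)"
      by (intro add_mono mult_left_mono G G' c) auto
    also have "\<dots> = (ennreal (2 / h) * ennreal K + ennreal (6 / h) * ennreal K) * S c"
      by (simp add: ring_distribs mult.assoc)
    also have "ennreal (2 / h) * ennreal K + ennreal (6 / h) * ennreal K = ennreal (8 * K / h)"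
      using h by (simp add: K_def ennreal_mult[symmetric] ennreal_plus[symmetric] del: ennreal_plus)
    finally show "ennreal ((2 * G c + 6 * G' c) / h) \<le> ennreal (8 * K / h) * S c" .
  qed
  also have "\<dots> = ennreal (8 * K / h) * (\<Sum>c<n. S c)" by (simp add: sum_distrib_left)
  also have "(\<Sum>c<n. S c) = (\<integral>\<^sup>+x. s x \<partial>mu a b)"
    unfolding S_def t0[symmetric] tn[symmetric]
    by (rule nn_integral_mu_partition[symmetric]) (use s h in \<open>auto simp: t0 tn tS\<close>)
  also have "ennreal (8 * K / h) * (\<integral>\<^sup>+x. s x \<partial>mu a b) \<le> ennreal (64 * h powr (2 * \<sigma>)) * (\<integral>\<^sup>+x. s x \<partial>mu a b)"
  proof (intro mult_right_mono ennreal_leI)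
    \<comment> \<open>\<open>8 * 2 powr (1 + 2 * \<sigma>)\<close> is at most
      \<open>8 * 2 powr 3 = 64\<close> because \<open>\<sigma> \<le> 1\<close>.\<close>
    have "K = 2 powr (1 + 2 * \<sigma>) * (h * h powr (2 * \<sigma>))"
      using h by (simp add: K_def powr_mult powr_add)
    also have "\<dots> \<le> 2 powr 3 * (h * h powr (2 * \<sigma>))"
      using h \<sigma> by (intro mult_right_mono powr_mono) auto
    finally have "K \<le> 8 * h * h powr (2 * \<sigma>)" by simp
    then show "8 * K / h \<le> 64 * h powr (2 * \<sigma>)" using h by (simp add: field_simps)
  qed auto
  finally show ?thesis by (simp add: h_def)
qed

section \<open>Approximation of Sobolev families\<close>

text \<open>\<open>s\<close> bounds the densities of the squared norms of order up to \<open>q\<close> of a family of functions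
  whose \<open>j\<close>-th derivatives are \<open>g j i\<close>.\<close>

definition sob_fam :: "real \<Rightarrow> real \<Rightarrow> nat \<Rightarrow> real \<Rightarrow> (nat \<Rightarrow> nat \<Rightarrow> real \<Rightarrow> real) \<Rightarrow> (real \<Rightarrow> ennreal) \<Rightarrow> bool" where
  "sob_fam a b M q g s \<longleftrightarrow>
     (\<forall>i<M. chain a b (nat \<lfloor>q\<rfloor>) (\<lambda>j. g j i)) \<and>
     (\<forall>j\<le>nat \<lfloor>q\<rfloor>. AE x in mu a b. ennreal (\<Sum>i<M. (g j i x)\<^sup>2) \<le> s x) \<and>
     s \<in> borel_measurable (mu a b) \<and>
     (frac q \<noteq> 0 \<longrightarrow> mod_bound a b M (g (nat \<lfloor>q\<rfloor>)) (frac q) s)"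

lemma sob_fam_subset:
  assumes "sob_fam a b M q g s" "a \<le> c" "d \<le> b"
  shows "sob_fam c d M q g s"
  using assms unfolding sob_fam_def
  by (meson chain_subset AE_mu_subset measurable_mu_subset mod_bound_subset)

lemma sum_nsq_le_mass:
  assumes "\<And>i. i < M \<Longrightarrow> L2 a b (w i)" "AE x in mu a b. ennreal (\<Sum>i<M. (w i x)\<^sup>2) \<le> s x"
  shows "ennreal (\<Sum>i<M. nsq a b (w i)) \<le> (\<integral>\<^sup>+x. s x \<partial>mu a b)"
proof -
  have "(\<Sum>i<M. nsq a b (w i)) = integral\<^sup>L (mu a b) (\<lambda>x. \<Sum>i<M. (w i x)\<^sup>2)"
    unfolding nsq_def using assms(1) by (intro Bochner_Integration.integral_sum[symmetric]) (auto intro: L2_square)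
  also have "ennreal \<dots> = (\<integral>\<^sup>+x. ennreal (\<Sum>i<M. (w i x)\<^sup>2) \<partial>mu a b)"
    using assms(1) by (intro nn_integral_eq_integral[symmetric] Bochner_Integration.integrable_sum AE_I2 sum_nonneg)
      (auto intro: L2_square)
  also have "\<dots> \<le> (\<integral>\<^sup>+x. s x \<partial>mu a b)" by (rule nn_integral_mono_AE[OF assms(2)])
  finally show ?thesis .
qed

lemma powr_sq: "((x::real) powr q)\<^sup>2 = x powr (2 * q)"
  by (simp add: power2_eq_square powr_add[symmetric])

text \<open>64 comes from the comparison with the interpolant of averages; the power of
  \<open>q + 1\<close> pays for replacing the reduced degrees by \<open>r\<close> in all
  denominators.\<close>

definition hp_const :: "real \<Rightarrow> real" where
  "hp_const q = 64 * (q + 1) powr (2 * q)"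

text \<open>Two regimes. If \<open>r \<le> nat \<lfloor>q\<rfloor>\<close>, degrees run out before
  derivatives and only \<open>r\<close> derivatives are used. Otherwise all integer derivatives are
  used and \<open>err_mod_bound\<close> treats the fractional rest with the remaining
  degree.\<close>

lemma sob_fam_err:
  assumes ab: "a < b" and r: "r \<ge> 1" and q: "q \<ge> 0" and sob: "sob_fam a b M q g s"
  shows "ennreal (\<Sum>i<M. err a b r (g 0 i))
    \<le> ennreal (hp_const q * ((b - a) powr min (real r) q / real r powr q)\<^sup>2) * (\<integral>\<^sup>+x. s x \<partial>mu a b)"
proof -
  define h where "h = b - a"
  have h: "h > 0" using ab by (simp add: h_def)
  define k where "k = nat \<lfloor>q\<rfloor>"
  have chain: "\<And>i. i < M \<Longrightarrow> chain a b k (\<lambda>j. g j i)"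
    and dens: "\<And>j. j \<le> k \<Longrightarrow> AE x in mu a b. ennreal (\<Sum>i<M. (g j i x)\<^sup>2) \<le> s x"
    and meas: "s \<in> borel_measurable (mu a b)"
    and mod: "frac q \<noteq> 0 \<Longrightarrow> mod_bound a b M (g k) (frac q) s"
    using sob by (auto simp: sob_fam_def k_def)
  have L: "L2 a b (g j i)" if "i < M" "j \<le> k" for i j using chain[OF that(1)] that(2) by (auto simp: chain_def)
  have qk: "q = real k + frac q" using q by (simp add: k_def frac_def)
  have kq: "real k \<le> q" using q by (simp add: k_def)
  define S where "S = (\<integral>\<^sup>+x. s x \<partial>mu a b)"
  have goal: ?thesis if E: "ennreal (\<Sum>i<M. err a b r (g 0 i)) \<le> ennreal E * S"
    and EC: "E \<le> hp_const q * (h powr min (real r) q / real r powr q)\<^sup>2" for E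
    using order_trans[OF E mult_right_mono[OF ennreal_leI[OF EC]]] by (simp add: S_def h_def)
  have chain_sum: "(\<Sum>i<M. err a b r (g 0 i)) \<le> (real l * h / real r) ^ (2 * l) * (\<Sum>i<M. err a b (r - l) (g l i))"
    if "l \<le> k" "l \<le> r" for l
    unfolding sum_distrib_left h_def
  proof (intro sum_mono chain_err)
    show "chain a b l (\<lambda>j. g j i)" if "i \<in> {..<M}" for i
      using chain[of i] that \<open>l \<le> k\<close> by (auto simp: chain_def)
  qed (use ab that in auto)
  show ?thesis
  proof (cases "r \<le> k")
    case True
    have "(\<Sum>i<M. err a b r (g 0 i)) \<le> (real r * h / real r) ^ (2 * r) * (\<Sum>i<M. err a b 0 (g r i))"
      using chain_sum[OF True] by simp
    also have "\<dots> = h ^ (2 * r) * (\<Sum>i<M. nsq a b (g r i))"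
      using r True L by (simp add: err_0)
    finally have "ennreal (\<Sum>i<M. err a b r (g 0 i)) \<le> ennreal (h ^ (2 * r)) * ennreal (\<Sum>i<M. nsq a b (g r i))"
      using h by (simp add: ennreal_mult[symmetric] ennreal_leI sum_nonneg nsq_nonneg)
    also have "\<dots> \<le> ennreal (h ^ (2 * r)) * S"
      unfolding S_def by (intro mult_left_mono sum_nsq_le_mass dens L True) auto
    finally show ?thesis
    proof (rule goal)
      \<comment> \<open>In this regime \<open>r\<close> is at most \<open>q\<close>, so the missing
        powers of \<open>1 / r\<close> are only a constant.\<close>
      have "real r powr (2 * q) \<le> (q + 1) powr (2 * q)"
        using True kq q by (intro powr_mono2) auto
      then have "h ^ (2 * r) * real r powr (2 * q) \<le> 64 * ((q + 1) powr (2 * q) * h ^ (2 * r))"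
        using h by (simp add: mult.commute[of "h ^ _"]) (smt (verit, best) mult_right_mono zero_less_power powr_ge_zero mult_nonneg_nonneg)
      moreover have "(h powr min (real r) q / real r powr q)\<^sup>2 = h ^ (2 * r) / real r powr (2 * q)"
      proof -
        have "min (real r) q = real r" using True kq by simp
        moreover have "(h powr real r)\<^sup>2 = h ^ (2 * r)"
          using h by (simp add: powr_realpow power_mult[symmetric] mult.commute)
        ultimately show ?thesis by (simp add: power_divide powr_sq)
      qed
      ultimately show "h ^ (2 * r) \<le> hp_const q * (h powr min (real r) q / real r powr q)\<^sup>2"
        using r by (simp only: hp_const_def) (simp add: pos_le_divide_eq mult_ac)
    qed
  next
    case False
    have minq: "min (real r) q = q"
      using False frac_lt_1[of q] qk by (simp add: min_def)
    have fac: "(real k * h / real r) ^ (2 * k) \<le> ((q + 1) * h / real r) powr (2 * real k)"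
    proof -
      have "(real k * h / real r) ^ (2 * k) \<le> ((q + 1) * h / real r) ^ (2 * k)"
        using kq q h by (intro power_mono divide_right_mono mult_right_mono) auto
      also have "\<dots> = ((q + 1) * h / real r) powr (2 * real k)"
        using q h r by (subst powr_realpow[symmetric]) auto
      finally show ?thesis .
    qed
    have target: "hp_const q * (h powr min (real r) q / real r powr q)\<^sup>2 = 64 * ((q + 1) * h / real r) powr (2 * q)"
      unfolding minq hp_const_def using q h r
      by (simp add: powr_mult powr_divide power_divide powr_sq)
    \<comment> \<open>For integer \<open>q\<close> the last derivative is merely square integrable
      and nothing further is gained.\<close>
    define E where "E = (if frac q = 0 then 1 else 64 * (h / real (r - k)) powr (2 * frac q))"
    have "ennreal (\<Sum>i<M. err a b (r - k) (g k i)) \<le> ennreal E * S"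
    proof (cases "frac q = 0")
      case True
      have "ennreal (\<Sum>i<M. err a b (r - k) (g k i)) \<le> ennreal (\<Sum>i<M. nsq a b (g k i))"
        by (intro ennreal_leI sum_mono err_le_nsq L) auto
      also have "\<dots> \<le> S" unfolding S_def by (intro sum_nsq_le_mass dens L) auto
      finally show ?thesis using True by (simp add: E_def)
    next
      case frac: False
      have "ennreal (\<Sum>i<M. err a b (r - k) (g k i)) \<le> ennreal (64 * (h / real (r - k)) powr (2 * frac q)) * S"
        unfolding h_def S_def using False ab
        by (intro err_mod_bound[OF _ _ L mod[OF frac] meas]) (auto intro: frac_ge_0 less_imp_le[OF frac_lt_1])
      then show ?thesis using frac by (simp add: E_def)
    qed
    moreover have "ennreal (\<Sum>i<M. err a b r (g 0 i))
        \<le> ennreal ((real k * h / real r) ^ (2 * k)) * ennreal (\<Sum>i<M. err a b (r - k) (g k i))"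
      using chain_sum[of k] False h by (simp add: ennreal_mult[symmetric] ennreal_leI sum_nonneg err_nonneg)
    ultimately have "ennreal (\<Sum>i<M. err a b r (g 0 i))
        \<le> ennreal ((real k * h / real r) ^ (2 * k)) * (ennreal E * S)"
      by (meson mult_left_mono order_trans zero_le)
    also have "\<dots> = ennreal ((real k * h / real r) ^ (2 * k) * E) * S"
      using h by (simp add: ennreal_mult' mult.assoc)
    finally show ?thesis
    proof (rule goal)
      have E: "E \<le> 64 * ((q + 1) * h / real r) powr (2 * frac q)"
      proof (cases "frac q = 0")
        case True
        have "(q + 1) * h / real r > 0" using q h r by simp
        then show ?thesis unfolding E_def True using q h r by simp
      next
        case frac: False
        \<comment> \<open>\<open>(k + 1) * (r - k) - r = k * (r - k - 1)\<close>, which is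
          nonnegative because \<open>k < r\<close>. The reduced degree costs at most a factor
          \<open>q + 1\<close>.\<close>
        have "r \<le> (k + 1) * (r - k)"
        proof -
          have "0 \<le> int k * (int r - int k - 1)" using False by simp
          then have "int r \<le> (int k + 1) * (int r - int k)" by (simp add: algebra_simps)
          also have "\<dots> = int ((k + 1) * (r - k))" using False by (simp only: of_nat_mult of_nat_add of_nat_1 of_nat_diff[OF less_imp_le[OF not_le_imp_less[OF False]]])
          finally show ?thesis by linarith
        qed
        then have "real r \<le> real (k + 1) * real (r - k)" by (metis of_nat_le_iff of_nat_mult)
        also have "\<dots> \<le> (q + 1) * real (r - k)" using kq by (intro mult_right_mono) auto
        finally have "h * real r \<le> h * ((q + 1) * real (r - k))" using h by (intro mult_left_mono) auto
        then have "h / real (r - k) \<le> (q + 1) * h / real r"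
          using False r by (simp add: field_simps)
        then have "(h / real (r - k)) powr (2 * frac q) \<le> ((q + 1) * h / real r) powr (2 * frac q)"
          using h by (intro powr_mono2) (auto simp: frac_ge_0)
        then show ?thesis using frac by (simp add: E_def)
      qed
      have "(real k * h / real r) ^ (2 * k) * E
          \<le> ((q + 1) * h / real r) powr (2 * real k) * (64 * ((q + 1) * h / real r) powr (2 * frac q))"
        by (intro mult_mono fac E) (auto simp: E_def)
      also have "\<dots> = 64 * ((q + 1) * h / real r) powr (2 * real k + 2 * frac q)"
        by (simp add: powr_add)
      also have "2 * real k + 2 * frac q = 2 * q" using qk by linarith
      finally show "(real k * h / real r) ^ (2 * k) * E \<le> hp_const q * (h powr min (real r) q / real r powr q)\<^sup>2"
        unfolding target .
    qed
  qed
qed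

section \<open>The integrated projection error\<close>

text \<open>Orthogonality to constants, available from \<open>r \<ge> 1\<close> on. It makes the
  integrated projection exact at the right node as well.\<close>

lemma prim_err_end:
  assumes "L2 a b z" "r \<ge> 1"
  shows "prim a (\<lambda>x. z x - poly (pr a b r z) x) b = 0"
proof -
  have "ip a b (\<lambda>x. z x - poly (pr a b r z) x) (poly 1) = 0"
    using assms by (intro pr_orth) (auto simp: plt_def)
  then show ?thesis by (simp add: ip_def prim_def)
qed

text \<open>Duality: \<open>z\<close> minus its projection is orthogonal to the projection of the second primitive \<open>F\<close>
  of that difference.\<close>

lemma nsq_prim_err:
  assumes ab: "a < b" and z: "L2 a b z" and r: "r \<ge> 1"
  shows "nsq a b (prim a (\<lambda>x. z x - poly (pr a b r z) x)) \<le> ((b - a) / r)\<^sup>2 * err a b r z"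
proof -
  define u where "u x = z x - poly (pr a b r z) x" for x
  define \<eta> where "\<eta> = prim a u"
  define F where "F x = prim a \<eta> x" for x
  have u: "L2 a b u" unfolding u_def by (intro L2_diff z L2_poly)
  have \<eta>c: "continuous_on {a..b} \<eta>" unfolding \<eta>_def by (intro prim_continuous L2_integrable u)
  have \<eta>L: "L2 a b \<eta>" using \<eta>c by (rule L2_continuous)
  have F: "(F has_real_derivative \<eta> x) (at x within {a..b})" if x: "x \<in> {a..b}" for x
  proof -
    have "((\<lambda>x. integral {a..x} \<eta>) has_vector_derivative \<eta> x) (at x within {a..b})"
      by (rule integral_has_vector_derivative[OF \<eta>c x])
    then have "((\<lambda>x. integral {a..x} \<eta>) has_real_derivative \<eta> x) (at x within {a..b})"
      by (simp add: has_real_derivative_iff_has_vector_derivative)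
    then show ?thesis
      by (rule has_field_derivative_transform_within[where d = 1])
        (use x in \<open>auto simp: F_def prim_eq_integral[OF integrable_mu_continuous[OF \<eta>c]]\<close>)
  qed
  have FL: "L2 a b F" unfolding F_def by (rule L2_prim[OF \<eta>L])
  \<comment> \<open>Integration by parts; the only boundary term carries the factor
    \<open>\<eta> b\<close>, which is 0.\<close>
  have "ip a b \<eta> \<eta> + ip a b u F = \<eta> b * F b"
    unfolding \<eta>_def by (rule ip_prim_parts) (use ab u F \<eta>c in \<open>auto simp: \<eta>_def\<close>)
  moreover have "\<eta> b = 0" unfolding \<eta>_def u_def by (rule prim_err_end[OF z r])
  moreover have "ip a b u (poly (pr a b r F)) = 0"
    unfolding u_def by (intro pr_orth z pr_plt FL)
  ultimately have "nsq a b \<eta> = - ip a b u (\<lambda>x. F x - poly (pr a b r F) x)"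
    by (simp add: ip_self ip_diff_right u FL L2_poly)
  then have "(nsq a b \<eta>)\<^sup>2 = (ip a b u (\<lambda>x. F x - poly (pr a b r F) x))\<^sup>2" by simp
  also have "\<dots> \<le> nsq a b u * err a b r F"
    unfolding err_def by (intro cs_ip u L2_diff FL L2_poly)
  also have "\<dots> \<le> nsq a b u * (((b - a) / r)\<^sup>2 * nsq a b \<eta>)"
    using ab r \<eta>L by (intro mult_left_mono nsq_nonneg err_le_nsq_deriv[where c = 0]) (auto simp: F_def)
  finally have "nsq a b \<eta> * nsq a b \<eta> \<le> (((b - a) / r)\<^sup>2 * nsq a b u) * nsq a b \<eta>"
    by (simp add: power2_eq_square algebra_simps)
  then have "nsq a b \<eta> \<le> ((b - a) / r)\<^sup>2 * nsq a b u"
    using nsq_nonneg[of a b \<eta>] nsq_nonneg[of a b u] by (cases "nsq a b \<eta> = 0") auto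
  then show ?thesis by (simp add: \<eta>_def u_def[abs_def] err_def)
qed

lemma prim_err_sup:
  assumes "L2 a b z" "x \<in> {a..b}"
  shows "(prim a (\<lambda>x. z x - poly (pr a b r z) x) x)\<^sup>2 \<le> (b - a) * err a b r z"
  unfolding err_def using assms by (intro prim_bound_interval) (auto intro!: L2_diff L2_poly)

section \<open>Stability and error of the Galerkin method\<close>

lemma pr_add:
  assumes "a < b" "L2 a b f" "L2 a b g"
  shows "pr a b n (\<lambda>x. f x + g x) = pr a b n f + pr a b n g"
  using assms by (intro pr_unique L2_add plt_add pr_plt)
    (simp_all add: ip_poly_add_left ip_add_left L2_poly pr_ip)

lemma pr_cmult:
  assumes "a < b" "L2 a b f"
  shows "pr a b n (\<lambda>x. c * f x) = Polynomial.smult c (pr a b n f)"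
  using assms by (intro pr_unique L2_cmult plt_smult pr_plt)
    (simp_all add: ip_poly_smult_left ip_cmult_left pr_ip)

lemma pr_lincomb:
  assumes "a < b" "\<And>j. j \<in> J \<Longrightarrow> L2 a b (f j)"
  shows "pr a b n (\<lambda>x. \<Sum>j\<in>J. c j * f j x) = (\<Sum>j\<in>J. Polynomial.smult (c j) (pr a b n (f j)))"
  using assms(2)
proof (induction J rule: infinite_finite_induct)
  case (insert j J)
  then show ?case by (simp add: pr_add[OF assms(1)] pr_cmult[OF assms(1)] L2_cmult L2_sum)
qed (auto intro!: pr_unique[OF assms(1)] L2_const plt_0 simp: ip_def)

text \<open>\<open>n\<^sup>2\<close> is the sum of the odd numbers \<open>2 * k + 1\<close> for
  \<open>k < n\<close>, one for each Legendre polynomial. The top component \<open>v\<close>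
  satisfies its part with equality: \<open>W\<close> vanishes at the opposite end \<open>c\<close>,
  \<open>W * pderiv v\<close> is \<open>n * v\<close> up to lower degree, and integrating the
  derivative of \<open>W * v\<close> against \<open>v\<close> by parts produces the value at
  \<open>e\<close>.\<close>

lemma endpoint_bound:
  assumes ab: "a < b" and p: "plt n p" and e: "(e = b \<and> c = a) \<or> (e = a \<and> c = b)"
  shows "(b - a) * (poly p e)\<^sup>2 \<le> (real n)\<^sup>2 * nsq a b (poly p)"
  using p
proof (induction n arbitrary: p)
  case 0
  then show ?case by (simp add: plt_zero)
next
  case (Suc n)
  define u where "u = pr a b n (poly p)"
  define v where "v = p - u"
  have puv: "p = u + v" by (simp add: v_def)
  have u: "plt n u" unfolding u_def by (intro pr_plt L2_poly)
  have v: "plt (Suc n) v" unfolding v_def by (intro plt_diff Suc.prems plt_mono[OF u]) simp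
  have v_orth: "ip a b (poly v) (poly q) = 0" if "plt n q" for q
    using pr_orth[OF L2_poly that, of a b p] by (simp add: v_def u_def poly_diff_fun)
  define W where "W = [:- c, 1:]"
  have "plt n (W * pderiv v - Polynomial.smult (real n) v)"
    unfolding plt_def
  proof (intro allI impI)
    fix i assume "n \<le> i"
    then consider "i = n" | "Suc n \<le> i" by linarith
    then show "coeff (W * pderiv v - Polynomial.smult (real n) v) i = 0"
      using v by cases (cases i; auto simp: W_def plt_def coeff_pCons coeff_pderiv algebra_simps)+
  qed
  from v_orth[OF this]
  have Wv: "ip a b (poly (W * pderiv v)) (poly v) = real n * nsq a b (poly v)"
    by (simp only: ip_commute[of a b "poly v"] ip_poly_diff_left ip_poly_smult_left ip_self)
  have "ip a b (poly (pderiv (W * v))) (poly v) = poly (W * v) b * poly v b - poly (W * v) a * poly v a - ip a b (poly (W * v)) (poly (pderiv v))"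
    by (rule ip_poly_parts) (use ab in simp)
  moreover have "ip a b (poly (pderiv (W * v))) (poly v) = nsq a b (poly v) + ip a b (poly (W * pderiv v)) (poly v)"
  proof -
    have "pderiv W = 1" by (simp add: W_def pderiv_pCons)
    then have "pderiv (W * v) = v + W * pderiv v"
      by (simp add: pderiv_mult)
    then show ?thesis by (simp only: ip_poly_add_left ip_self)
  qed
  moreover have "ip a b (poly (W * v)) (poly (pderiv v)) = ip a b (poly (W * pderiv v)) (poly v)"
    by (simp add: ip_def mult_ac)
  moreover have "poly (W * v) b * poly v b - poly (W * v) a * poly v a = (b - a) * (poly v e)\<^sup>2"
    using e by (auto simp: W_def power2_eq_square algebra_simps)
  ultimately have ve: "(b - a) * (poly v e)\<^sup>2 = (2 * real n + 1) * nsq a b (poly v)"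
    unfolding Wv by (simp add: algebra_simps)
  have ue: "(b - a) * (poly u e)\<^sup>2 \<le> (real n)\<^sup>2 * nsq a b (poly u)" by (rule Suc.IH[OF u])
  have "ip a b (poly u) (poly v) = 0" using v_orth[OF u] by (simp add: ip_commute)
  then have nsq: "nsq a b (poly p) = nsq a b (poly u) + nsq a b (poly v)"
    unfolding puv poly_add_fun by (simp add: nsq_add_eq L2_poly)
  show ?case
  proof (cases "n = 0")
    case True
    then have "u = 0" using u by (simp add: plt_zero)
    then show ?thesis using ve True puv by simp
  next
    case False
    define \<alpha> \<beta> where "\<alpha> = (real n)\<^sup>2" and "\<beta> = 2 * real n + 1"
    have pos: "\<alpha> > 0" "\<beta> > 0" using False by (auto simp: \<alpha>_def \<beta>_def)
    \<comment> \<open>Cauchy-Schwarz with the weights \<open>\<alpha>\<close> and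
      \<open>\<beta>\<close>, the constants of the two components.\<close>
    have "0 \<le> (\<beta> * poly u e - \<alpha> * poly v e)\<^sup>2" by simp
    then have "\<alpha> * \<beta> * (poly u e + poly v e)\<^sup>2 \<le> (\<alpha> + \<beta>) * (\<beta> * (poly u e)\<^sup>2 + \<alpha> * (poly v e)\<^sup>2)"
      by (simp add: power2_eq_square algebra_simps)
    then have "(b - a) * (\<alpha> * \<beta> * (poly u e + poly v e)\<^sup>2)
        \<le> (b - a) * ((\<alpha> + \<beta>) * (\<beta> * (poly u e)\<^sup>2 + \<alpha> * (poly v e)\<^sup>2))"
      using ab by (intro mult_left_mono) auto
    also have "\<dots> = (\<alpha> + \<beta>) * (\<beta> * ((b - a) * (poly u e)\<^sup>2) + \<alpha> * ((b - a) * (poly v e)\<^sup>2))"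
      by (simp add: algebra_simps)
    also have "\<dots> \<le> (\<alpha> + \<beta>) * (\<beta> * (\<alpha> * nsq a b (poly u)) + \<alpha> * (\<beta> * nsq a b (poly v)))"
      using pos ue ve by (intro mult_left_mono add_mono) (auto simp: \<alpha>_def \<beta>_def)
    also have "\<dots> = \<alpha> * \<beta> * ((\<alpha> + \<beta>) * nsq a b (poly p))" by (simp add: nsq algebra_simps)
    finally have "\<alpha> * \<beta> * ((b - a) * (poly p e)\<^sup>2) \<le> \<alpha> * \<beta> * ((\<alpha> + \<beta>) * nsq a b (poly p))"
      by (simp add: puv algebra_simps)
    then have "(b - a) * (poly p e)\<^sup>2 \<le> (\<alpha> + \<beta>) * nsq a b (poly p)" using pos by simp
    also have "\<alpha> + \<beta> = (real (Suc n))\<^sup>2" by (simp add: \<alpha>_def \<beta>_def power2_eq_square algebra_simps)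
    finally show ?thesis .
  qed
qed

text \<open>Cut at \<open>x\<close> and keep the longer part. There \<open>x\<close> is an end
  point, and the length is at least half of \<open>b - a\<close>, which accounts for the factor
  2.\<close>

lemma inverse_inequality:
  assumes ab: "a < b" and p: "plt n p" and x: "x \<in> {a..b}"
  shows "(b - a) * (poly p x)\<^sup>2 \<le> 2 * (real n)\<^sup>2 * nsq a b (poly p)"
proof (cases "x \<ge> (a + b) / 2")
  case True
  then have "a < x" using ab by (simp add: field_simps)
  from endpoint_bound[OF this p, of x a]
  have "(x - a) * (poly p x)\<^sup>2 \<le> (real n)\<^sup>2 * nsq a x (poly p)" by simp
  also have "\<dots> \<le> (real n)\<^sup>2 * nsq a b (poly p)"
    using x by (intro mult_left_mono nsq_restrict_mono L2_poly) auto
  moreover have "(b - a) * (poly p x)\<^sup>2 \<le> (2 * (x - a)) * (poly p x)\<^sup>2"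
    using True by (intro mult_right_mono) auto
  ultimately show ?thesis by linarith
next
  case False
  then have "x < b" using ab by (simp add: field_simps)
  from endpoint_bound[OF this p, of x b]
  have "(b - x) * (poly p x)\<^sup>2 \<le> (real n)\<^sup>2 * nsq x b (poly p)" by simp
  also have "\<dots> \<le> (real n)\<^sup>2 * nsq a b (poly p)"
    using x by (intro mult_left_mono nsq_restrict_mono L2_poly) auto
  moreover have "(b - a) * (poly p x)\<^sup>2 \<le> (2 * (b - x)) * (poly p x)\<^sup>2"
    using False by (intro mult_right_mono) (auto simp: field_simps)
  ultimately show ?thesis by linarith
qed

text \<open>The equation holds pointwise, so it can be tested with \<open>W * P i\<close> for any
  weight that is nonnegative on the interval, and the quadratic form of \<open>D\<close> drops out.
  Stability uses the weights 1 and \<open>[:b, - 1:]\<close>.\<close>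

lemma dissipative_integral:
  assumes ab: "a \<le> b" and D: "\<And>v. (\<Sum>i<M. \<Sum>j<M. v i * D i j * v j) \<le> (0::real)"
    and W: "\<And>x. x \<in> {a<..<b} \<Longrightarrow> 0 \<le> poly W x"
    and ode: "\<And>i x. i < M \<Longrightarrow> x \<in> {a<..<b} \<Longrightarrow>
      poly (p' i) x = (\<Sum>j<M. D i j * poly (P j) x) + poly (f i) x"
  shows "(\<Sum>i<M. ip a b (poly (W * p' i)) (poly (P i))) \<le> (\<Sum>i<M. ip a b (poly (W * f i)) (poly (P i)))"
proof -
  have int: "integrable (mu a b) (\<lambda>x. \<Sum>i<M. poly (W * q i) x * poly (P i) x)" for q
    by (intro integrable_mu_continuous continuous_intros)
  have "(\<Sum>i<M. ip a b (poly (W * q i)) (poly (P i))) = integral\<^sup>L (mu a b) (\<lambda>x. \<Sum>i<M. poly (W * q i) x * poly (P i) x)" for q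
    unfolding ip_def by (intro Bochner_Integration.integral_sum[symmetric] integrable_mu_continuous continuous_intros)
  moreover have "integral\<^sup>L (mu a b) (\<lambda>x. \<Sum>i<M. poly (W * p' i) x * poly (P i) x)
     \<le> integral\<^sup>L (mu a b) (\<lambda>x. \<Sum>i<M. poly (W * f i) x * poly (P i) x)"
  proof (rule integral_mono[OF int int])
    fix x assume "x \<in> space (mu a b)"
    then have x: "x \<in> {a<..<b}" by simp
    have "(\<Sum>i<M. poly (W * p' i) x * poly (P i) x) =
      (\<Sum>i<M. poly (W * f i) x * poly (P i) x) + poly W x * (\<Sum>i<M. \<Sum>j<M. poly (P i) x * D i j * poly (P j) x)"
      unfolding sum_distrib_left sum.distrib[symmetric]
    proof (rule sum.cong[OF refl])
      fix i assume "i \<in> {..<M}"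
      then have "poly (W * p' i) x * poly (P i) x = poly W x * ((\<Sum>j<M. D i j * poly (P j) x) + poly (f i) x) * poly (P i) x"
        using ode[of i x] x by simp
      then show "poly (W * p' i) x * poly (P i) x = poly (W * f i) x * poly (P i) x +
          (\<Sum>j<M. poly W x * (poly (P i) x * D i j * poly (P j) x))"
        by (simp add: algebra_simps sum_distrib_left sum_distrib_right)
    qed
    also have "\<dots> \<le> (\<Sum>i<M. poly (W * f i) x * poly (P i) x)"
      using mult_nonneg_nonpos[OF W[OF x] D[of "\<lambda>i. poly (P i) x"]] by simp
    finally show "(\<Sum>i<M. poly (W * p' i) x * poly (P i) x) \<le> (\<Sum>i<M. poly (W * f i) x * poly (P i) x)" .
  qed
  ultimately show ?thesis by simp
qed

text \<open>Testing with the projection of \<open>(b - x) p\<close> controls the interior of the interval: up to terms of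
  lower degree \<open>(b - x) p'\<close> is \<open>- r p\<close>, so replacing \<open>P\<close> by \<open>p\<close> has a favourable sign.\<close>

lemma galerkin_local:
  assumes ab: "a < b" and p: "\<And>i. i < M \<Longrightarrow> plt (Suc r) (p i)"
    and D: "\<And>v. (\<Sum>i<M. \<Sum>j<M. v i * D i j * v j) \<le> (0::real)"
    and ode: "\<And>i x. i < M \<Longrightarrow> x \<in> {a<..<b} \<Longrightarrow>
      poly (pderiv (p i)) x = (\<Sum>j<M. D i j * poly (pr a b r (poly (p j))) x) + poly (f i) x"
    and e: "e > 0"
  defines "\<Theta> \<equiv> \<Sum>i<M. nsq a b (poly (p i))" and "F \<equiv> \<Sum>i<M. nsq a b (poly (f i))"
    and "A \<equiv> \<Sum>i<M. (poly (p i) a)\<^sup>2" and "B \<equiv> \<Sum>i<M. (poly (p i) b)\<^sup>2"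
  shows "B \<le> A + (e * \<Theta> + F / e)" "\<Theta> \<le> (b - a) * A + (b - a) * (e * \<Theta> + F / e)"
proof -
  define P where "P i = pr a b r (poly (p i))" for i
  have P_plt: "plt r (P i)" for i unfolding P_def by (intro pr_plt L2_poly)
  have P_ip: "ip a b (poly q) (poly (P i)) = ip a b (poly q) (poly (p i))" if "plt r q" for q i
    using pr_ip[OF L2_poly that, of a b "p i"] by (simp add: P_def ip_commute)
  have P_le: "nsq a b (poly (P i)) \<le> nsq a b (poly (p i))" for i
    unfolding P_def by (intro nsq_pr_le L2_poly)
  have ode': "poly (pderiv (p i)) x = (\<Sum>j<M. D i j * poly (P j) x) + poly (f i) x"
    if "i < M" "x \<in> {a<..<b}" for i x using ode[OF that] by (simp add: P_def)
  \<comment> \<open>The derivative of \<open>p i\<close> has degree below \<open>r\<close>, so it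
    cannot distinguish \<open>p i\<close> from its projection.\<close>
  have "B - A = 2 * (\<Sum>i<M. ip a b (poly (pderiv (p i))) (poly (P i)))"
    unfolding A_def B_def sum_distrib_left sum_subtractf[symmetric]
  proof (rule sum.cong[OF refl])
    fix i assume "i \<in> {..<M}"
    then show "(poly (p i) b)\<^sup>2 - (poly (p i) a)\<^sup>2 = 2 * ip a b (poly (pderiv (p i))) (poly (P i))"
      using ip_poly_parts[of a b "p i" "p i"] ab P_ip[OF plt_pderiv[OF p], of i i]
      by (simp add: ip_commute[of a b "poly (p i)"] power2_eq_square)
  qed
  also have "\<dots> \<le> 2 * (\<Sum>i<M. ip a b (poly (f i)) (poly (P i)))"
    using dissipative_integral[where W = 1 and p' = "\<lambda>i. pderiv (p i)", OF less_imp_le[OF ab] D _ ode'] by simp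
  also have "\<dots> \<le> (\<Sum>i<M. e * nsq a b (poly (p i)) + nsq a b (poly (f i)) / e)"
    unfolding sum_distrib_left
  proof (rule sum_mono)
    fix i
    have "2 * ip a b (poly (f i)) (poly (P i)) \<le> e * nsq a b (poly (P i)) + nsq a b (poly (f i)) / e"
      by (rule ip_le_young[OF L2_poly L2_poly e])
    also have "e * nsq a b (poly (P i)) \<le> e * nsq a b (poly (p i))"
      using e by (intro mult_left_mono P_le) simp
    finally show "2 * ip a b (poly (f i)) (poly (P i)) \<le> e * nsq a b (poly (p i)) + nsq a b (poly (f i)) / e"
      by simp
  qed
  finally show "B \<le> A + (e * \<Theta> + F / e)"
    by (simp add: \<Theta>_def F_def sum.distrib sum_distrib_left sum_divide_distrib)
next
  define P where "P i = pr a b r (poly (p i))" for i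
  have P_plt: "plt r (P i)" for i unfolding P_def by (intro pr_plt L2_poly)
  have P_orth: "ip a b (poly q) (poly (p i - P i)) = 0" if "plt r q" for q i
    using pr_orth[OF L2_poly that, of a b "p i"] by (simp add: P_def ip_commute poly_diff_fun)
  have P_le: "nsq a b (poly (P i)) \<le> nsq a b (poly (p i))" for i
    unfolding P_def by (intro nsq_pr_le L2_poly)
  have ode': "poly (pderiv (p i)) x = (\<Sum>j<M. D i j * poly (P j) x) + poly (f i) x"
    if "i < M" "x \<in> {a<..<b}" for i x using ode[OF that] by (simp add: P_def)
  define W where "W = [:b, - 1:]"
  define h where "h = b - a"
  have h: "h > 0" using ab by (simp add: h_def)
  have "nsq a b (poly (p i)) - h * (poly (p i) a)\<^sup>2 \<le> 2 * ip a b (poly (W * pderiv (p i))) (poly (P i))"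
    if i: "i < M" for i
  proof -
    \<comment> \<open>\<open>W\<close> is \<open>b - x\<close>, so the leading coefficients,
      \<open>- r\<close> and \<open>r\<close> times that of \<open>p i\<close>, cancel.\<close>
    have "plt r (W * pderiv (p i) + Polynomial.smult (real r) (p i))"
      unfolding plt_def
    proof (intro allI impI)
      fix l assume "r \<le> l"
      then consider "l = r" | "Suc r \<le> l" by linarith
      then show "coeff (W * pderiv (p i) + Polynomial.smult (real r) (p i)) l = 0"
        using p[OF i] by cases (cases l; auto simp: W_def plt_def coeff_pCons coeff_pderiv algebra_simps)+
    qed
    from P_orth[OF this, of i] P_orth[OF P_plt, of i i]
    have "ip a b (poly (W * pderiv (p i))) (poly (p i - P i)) = - real r * ip a b (poly (p i)) (poly (p i - P i))"
      by (simp add: ip_poly_add_left ip_poly_smult_left del: poly_mult)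
    also have "ip a b (poly (p i)) (poly (p i - P i)) = nsq a b (poly (p i - P i))"
      using P_orth[OF P_plt, of i i] ip_poly_diff_left[of a b "p i" "P i" "p i - P i"] by (simp add: ip_self)
    finally have 1: "ip a b (poly (W * pderiv (p i))) (poly (p i - P i)) \<le> 0"
      using nsq_nonneg[of a b "poly (p i - P i)"] by (simp del: poly_mult poly_diff)
    have "ip a b (poly (W * pderiv (p i))) (poly (p i)) =
        ip a b (poly (W * pderiv (p i))) (poly (P i)) + ip a b (poly (W * pderiv (p i))) (poly (p i - P i))"
      unfolding ip_poly_add_right[symmetric] by simp
    with 1 have 2: "ip a b (poly (W * pderiv (p i))) (poly (p i)) \<le> ip a b (poly (W * pderiv (p i))) (poly (P i))"
      by linarith
    have "pderiv W = - 1" by (simp add: W_def pderiv_pCons one_pCons)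
    then have "pderiv (W * p i) = W * pderiv (p i) - p i"
      by (simp add: pderiv_mult)
    then have "ip a b (poly (pderiv (W * p i))) (poly (p i)) = ip a b (poly (W * pderiv (p i))) (poly (p i)) - nsq a b (poly (p i))"
      by (simp only: ip_poly_diff_left ip_self)
    moreover have "ip a b (poly (pderiv (W * p i))) (poly (p i)) =
        poly (W * p i) b * poly (p i) b - poly (W * p i) a * poly (p i) a - ip a b (poly (W * p i)) (poly (pderiv (p i)))"
      by (rule ip_poly_parts) (use ab in simp)
    moreover have "ip a b (poly (W * p i)) (poly (pderiv (p i))) = ip a b (poly (W * pderiv (p i))) (poly (p i))"
      by (simp add: ip_def mult_ac)
    moreover have "poly (W * p i) b * poly (p i) b - poly (W * p i) a * poly (p i) a = - h * (poly (p i) a)\<^sup>2"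
      by (simp add: W_def h_def power2_eq_square algebra_simps)
    ultimately show ?thesis using 2 by linarith
  qed
  then have "(\<Sum>i<M. nsq a b (poly (p i)) - h * (poly (p i) a)\<^sup>2)
      \<le> (\<Sum>i<M. 2 * ip a b (poly (W * pderiv (p i))) (poly (P i)))"
    by (intro sum_mono) auto
  then have "\<Theta> - h * A \<le> 2 * (\<Sum>i<M. ip a b (poly (W * pderiv (p i))) (poly (P i)))"
    by (simp only: \<Theta>_def A_def sum_distrib_left sum_subtractf)
  also have "\<dots> \<le> 2 * (\<Sum>i<M. ip a b (poly (W * f i)) (poly (P i)))"
    by (intro mult_left_mono dissipative_integral[OF less_imp_le[OF ab] D _ ode']) (auto simp: W_def)
  also have "\<dots> \<le> (\<Sum>i<M. h * (e * nsq a b (poly (p i)) + nsq a b (poly (f i)) / e))"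
    unfolding sum_distrib_left
  proof (rule sum_mono)
    fix i
    have "nsq a b (poly (W * f i)) \<le> nsq a b (\<lambda>x. h * poly (f i) x)"
    proof (intro nsq_mono L2_poly L2_cmult)
      fix x assume "x \<in> {a<..<b}"
      then have "(b - x)\<^sup>2 * (poly (f i) x)\<^sup>2 \<le> h\<^sup>2 * (poly (f i) x)\<^sup>2"
        by (intro mult_right_mono power_mono) (auto simp: h_def)
      moreover have "poly (W * f i) x = (b - x) * poly (f i) x" by (simp add: W_def algebra_simps)
      ultimately show "(poly (W * f i) x)\<^sup>2 \<le> (h * poly (f i) x)\<^sup>2"
        by (simp only: power_mult_distrib)
    qed
    then have 1: "nsq a b (poly (W * f i)) \<le> h\<^sup>2 * nsq a b (poly (f i))" by (simp add: nsq_cmult)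
    \<comment> \<open>Young with parameter \<open>h * e\<close>, so that \<open>h\<close> can be
      taken out of both terms.\<close>
    have "2 * ip a b (poly (W * f i)) (poly (P i)) \<le> (h * e) * nsq a b (poly (P i)) + nsq a b (poly (W * f i)) / (h * e)"
      using h e by (intro ip_le_young L2_poly) auto
    also have "\<dots> \<le> (h * e) * nsq a b (poly (p i)) + (h\<^sup>2 * nsq a b (poly (f i))) / (h * e)"
      using h e by (intro add_mono mult_left_mono divide_right_mono P_le 1) auto
    also have "\<dots> = h * (e * nsq a b (poly (p i)) + nsq a b (poly (f i)) / e)"
      using h e by (simp add: field_simps power2_eq_square)
    finally show "2 * ip a b (poly (W * f i)) (poly (P i)) \<le> h * (e * nsq a b (poly (p i)) + nsq a b (poly (f i)) / e)" .
  qed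
  also have "\<dots> = h * (e * \<Theta> + F / e)"
    by (simp add: \<Theta>_def F_def sum.distrib sum_distrib_left[symmetric] sum_divide_distrib[symmetric])
  finally show "\<Theta> \<le> (b - a) * A + (b - a) * (e * \<Theta> + F / e)"
    by (simp add: h_def)
qed

text \<open>\<open>\<Theta>\<close> enters the right sides only with the free factor
  \<open>e\<close>. Summing the nodal inequality bounds every \<open>A n\<close> by
  \<open>e * S + G / e\<close>. Inserted in the interior inequality, this bounds \<open>S\<close> by
  a multiple of itself that \<open>e = 1 / (4 * T)\<close> turns into one half; it is absorbed, so
  no exponential of \<open>T\<close> arises. The bound on a single interval retains the factor
  \<open>h n\<close>, which later cancels the \<open>1 / h n\<close> of the inverse
  inequality.\<close>

lemma gronwall_free_stability:
  fixes A \<Theta> F h :: "nat \<Rightarrow> real"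
  assumes T: "(\<Sum>n<N. h n) = T" "T > 0" and h: "\<And>n. n < N \<Longrightarrow> h n > 0"
    and F: "\<And>n. n < N \<Longrightarrow> F n \<ge> 0" and \<Theta>: "\<And>n. n < N \<Longrightarrow> \<Theta> n \<ge> 0"
    and A0: "A 0 = 0"
    and step: "\<And>n e. n < N \<Longrightarrow> e > 0 \<Longrightarrow> A (Suc n) \<le> A n + (e * \<Theta> n + F n / e)"
    and inner: "\<And>n e. n < N \<Longrightarrow> e > 0 \<Longrightarrow> \<Theta> n \<le> h n * A n + h n * (e * \<Theta> n + F n / e)"
  shows "(\<Sum>n<N. \<Theta> n) \<le> 16 * T\<^sup>2 * (\<Sum>n<N. F n)"
    and "\<And>n. n < N \<Longrightarrow> \<Theta> n \<le> 20 * T * h n * (\<Sum>n<N. F n)"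
proof -
  define S where "S = (\<Sum>n<N. \<Theta> n)"
  define G where "G = (\<Sum>n<N. F n)"
  define e where "e = 1 / (4 * T)"
  have e: "e > 0" using T by (simp add: e_def)
  have nonneg: "0 \<le> e * \<Theta> n + F n / e" if "n < N" for n using that F \<Theta> e by auto
  have A_sum: "A n \<le> (\<Sum>k<n. e * \<Theta> k + F k / e)" if "n \<le> N" for n
    using that
  proof (induction n)
    case (Suc n)
    then show ?case using step[of n e] e by simp
  qed (simp add: A0)
  have total: "(\<Sum>k<N. e * \<Theta> k + F k / e) = e * S + G / e"
    by (simp add: S_def G_def sum.distrib sum_distrib_left sum_divide_distrib)
  have A_le: "A n \<le> e * S + G / e" if "n \<le> N" for n
    using order_trans[OF A_sum[OF that] sum_mono2[of "{..<N}" "{..<n}"]] nonneg that total by auto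
  have hT: "h n \<le> T" if "n < N" for n
    unfolding T(1)[symmetric] using that h by (intro member_le_sum) (auto intro: less_imp_le)
  have "(\<Sum>n<N. \<Theta> n) \<le> (\<Sum>n<N. h n * (e * S + G / e) + T * (e * \<Theta> n + F n / e))"
  proof (rule sum_mono)
    fix n assume "n \<in> {..<N}"
    then have n: "n < N" by simp
    have "\<Theta> n \<le> h n * A n + h n * (e * \<Theta> n + F n / e)" by (rule inner[OF n e])
    also have "\<dots> \<le> h n * (e * S + G / e) + T * (e * \<Theta> n + F n / e)"
      using n h[OF n] by (intro add_mono mult_left_mono mult_right_mono A_le hT nonneg) auto
    finally show "\<Theta> n \<le> h n * (e * S + G / e) + T * (e * \<Theta> n + F n / e)" .
  qed
  also have "\<dots> = (\<Sum>n<N. h n) * (e * S + G / e) + T * (\<Sum>k<N. e * \<Theta> k + F k / e)"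
    by (simp add: sum.distrib sum_distrib_left[symmetric] sum_distrib_right[symmetric])
  also have "\<dots> = 2 * T * (e * S + G / e)" unfolding total T(1) by simp
  also have "\<dots> = S / 2 + 8 * T\<^sup>2 * G"
    using T by (simp add: e_def field_simps power2_eq_square)
  finally have S: "S \<le> 16 * T\<^sup>2 * G" unfolding S_def[symmetric] by simp
  then show "(\<Sum>n<N. \<Theta> n) \<le> 16 * T\<^sup>2 * (\<Sum>n<N. F n)" by (simp add: S_def G_def)
  have "e * S + G / e \<le> e * (16 * T\<^sup>2 * G) + G / e" using S e by simp
  also have "\<dots> = 8 * T * G" using T by (simp add: e_def field_simps power2_eq_square)
  finally have A: "A n \<le> 8 * T * G" if "n \<le> N" for n using A_le[OF that] by linarith
  fix n assume n: "n < N"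
  have FG: "F n \<le> G" unfolding G_def using n F by (intro member_le_sum) auto
  \<comment> \<open>A single interval gets its own parameter \<open>1 / (2 * h n)\<close>, which
    again absorbs half of \<open>\<Theta> n\<close>; with the global parameter the load term would
    not carry the factor \<open>h n * T\<close>.\<close>
  have "\<Theta> n \<le> h n * A n + h n * (1 / (2 * h n) * \<Theta> n + F n / (1 / (2 * h n)))"
    using h[OF n] by (intro inner n) simp
  also have "\<dots> = h n * A n + \<Theta> n / 2 + 2 * h n * (h n * F n)"
    using h[OF n] by (simp add: field_simps)
  also have "\<dots> \<le> h n * (8 * T * G) + \<Theta> n / 2 + 2 * h n * (T * G)"
    using n h[OF n] F[OF n] T
    by (intro add_mono mult_left_mono mult_mono A hT FG) auto
  finally show "\<Theta> n \<le> 20 * T * h n * (\<Sum>n<N. F n)" by (simp add: G_def)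
qed

text \<open>Here only scalar components and polynomial pieces occur. Regularity beyond an L2
  derivative enters later, through bounds on \<open>E1\<close> and \<open>E2\<close>: the former
  collects the projection errors of Y', the latter those of D Y', with the factor gained by
  integrating once.\<close>

lemma galerkin_error:
  fixes D :: "nat \<Rightarrow> nat \<Rightarrow> real" and t :: "nat \<Rightarrow> real"
  assumes T: "T > 0" and part: "is_partition T N t" and r: "r \<ge> 1"
    and D: "\<And>v. (\<Sum>i<M. \<Sum>j<M. v i * D i j * v j) \<le> 0"
    and zL: "\<And>i. i < M \<Longrightarrow> L2 0 T (z i)" and RL: "\<And>i. i < M \<Longrightarrow> L2 0 T (R i)"
    and y: "\<And>i x. i < M \<Longrightarrow> x \<in> {0..T} \<Longrightarrow> y i x = y i 0 + prim 0 (z i) x"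
    and ode: "\<And>i. i < M \<Longrightarrow> AE x in mu 0 T. z i x = (\<Sum>j<M. D i j * y j x) + R i x"
    and p: "\<And>n i. n < N \<Longrightarrow> i < M \<Longrightarrow> plt (Suc r) (p n i)"
    and p0: "\<And>i. i < M \<Longrightarrow> poly (p 0 i) 0 = y i 0"
    and pc: "\<And>n i. Suc n < N \<Longrightarrow> i < M \<Longrightarrow> poly (p n i) (t (Suc n)) = poly (p (Suc n) i) (t (Suc n))"
    and pode: "\<And>n i x. n < N \<Longrightarrow> i < M \<Longrightarrow> x \<in> {t n<..<t (Suc n)} \<Longrightarrow>
      poly (pderiv (p n i)) x = (\<Sum>j<M. D i j * poly (pr (t n) (t (Suc n)) r (poly (p n j))) x)
        + poly (pr (t n) (t (Suc n)) r (R i)) x"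
  defines "E1 \<equiv> \<lambda>n. \<Sum>i<M. err (t n) (t (Suc n)) r (z i)"
    and "E2 \<equiv> \<Sum>n<N. ((t (Suc n) - t n) / r)\<^sup>2 * (\<Sum>i<M. err (t n) (t (Suc n)) r (\<lambda>x. \<Sum>j<M. D i j * z j x))"
  shows "(\<Sum>n<N. \<Sum>i<M. nsq (t n) (t (Suc n)) (\<lambda>x. y i x - poly (p n i) x))
      \<le> 2 * (\<Sum>n<N. ((t (Suc n) - t n) / r)\<^sup>2 * E1 n) + 32 * T\<^sup>2 * E2"
    and "\<And>n x. n < N \<Longrightarrow> x \<in> {t n..t (Suc n)} \<Longrightarrow>
      (\<Sum>i<M. (y i x - poly (p n i) x)\<^sup>2) \<le> 2 * (t (Suc n) - t n) * E1 n + 320 * (real r)\<^sup>2 * T * E2"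
proof -
  have t0: "t 0 = 0" and tN: "t N = T" and t_less: "\<And>n. n < N \<Longrightarrow> t n < t (Suc n)"
    using part by (auto simp: is_partition_def)
  have t_mono: "t m \<le> t n" if "m \<le> n" "n \<le> N" for m n
    using that by (induction n) (force simp: le_Suc_eq intro: order_trans[OF _ less_imp_le[OF t_less]])+
  have tr: "0 \<le> t n" "t n \<le> T" if "n \<le> N" for n
    using t_mono[of 0 n] t_mono[of n N] that t0 tN by auto
  define h where "h n = t (Suc n) - t n" for n
  have h: "h n > 0" if "n < N" for n using t_less[OF that] by (simp add: h_def)
  have sum_h: "(\<Sum>n<N. h n) = T" unfolding h_def by (simp add: sum_lessThan_telescope t0 tN)
  define u where "u n i x = z i x - poly (pr (t n) (t (Suc n)) r (z i)) x" for n i x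
  define \<eta> where "\<eta> n i = prim (t n) (u n i)" for n i
  have "\<exists>q. pderiv q = pr (t n) (t (Suc n)) r (z i) \<and> (plt r (pr (t n) (t (Suc n)) r (z i)) \<longrightarrow> plt (Suc r) q)" for n i
    using poly_antiderivative[of "pr (t n) (t (Suc n)) r (z i)"] by metis
  then obtain q where q: "\<And>n i. pderiv (q n i) = pr (t n) (t (Suc n)) r (z i)"
    and q': "\<And>n i. plt r (pr (t n) (t (Suc n)) r (z i)) \<Longrightarrow> plt (Suc r) (q n i)" by metis
  \<comment> \<open>The comparison function on interval \<open>n\<close>, normalised at the left
    node; it meets \<open>y\<close> at the right node by \<open>\<eta>_end\<close>.\<close>
  define \<pi> where "\<pi> n i = q n i + [:y i (t n) - poly (q n i) (t n):]" for n i
  define \<theta> where "\<theta> n i = \<pi> n i - p n i" for n i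
  define f where "f n i = (\<Sum>j<M. Polynomial.smult (D i j) (pr (t n) (t (Suc n)) r (\<eta> n j)))" for n i
  have zLn: "L2 (t n) (t (Suc n)) (z i)" and RLn: "L2 (t n) (t (Suc n)) (R i)" if "n < N" "i < M" for n i
    using that tr[of n] tr[of "Suc n"] zL RL by (auto intro: L2_subset)
  have uL: "L2 (t n) (t (Suc n)) (u n i)" if "n < N" "i < M" for n i
    unfolding u_def by (intro L2_diff zLn that L2_poly)
  have \<eta>L: "L2 (t n) (t (Suc n)) (\<eta> n i)" if "n < N" "i < M" for n i
    unfolding \<eta>_def by (intro L2_prim uL that)
  have split: "y i x = poly (\<pi> n i) x + \<eta> n i x" if "n < N" "i < M" "x \<in> {t n..t (Suc n)}" for n i x
  proof -
    have x: "0 \<le> t n" "t n \<le> x" "x \<le> T" using that tr[of n] tr[of "Suc n"] by auto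
    have "prim 0 (z i) x = prim 0 (z i) (t n) + prim (t n) (z i) x"
      using x that by (intro prim_split[of _ T] L2_integrable zL) auto
    then have "y i x = y i (t n) + prim (t n) (z i) x"
      using y[of i x] y[of i "t n"] x that by auto
    moreover have "\<eta> n i x = prim (t n) (z i) x - prim (t n) (poly (pr (t n) (t (Suc n)) r (z i))) x"
      unfolding \<eta>_def u_def[abs_def] using that by (intro prim_diff[of _ "t (Suc n)"] L2_integrable zLn L2_poly) auto
    moreover have "prim (t n) (poly (pr (t n) (t (Suc n)) r (z i))) x = poly (q n i) x - poly (q n i) (t n)"
      unfolding q[symmetric] by (rule prim_pderiv[OF x(2)])
    ultimately show ?thesis by (simp add: \<pi>_def)
  qed
  have \<eta>_end: "\<eta> n i (t (Suc n)) = 0" if "n < N" "i < M" for n i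
    unfolding \<eta>_def u_def[abs_def] by (intro prim_err_end zLn that r)
  have \<theta>_start: "poly (\<theta> n i) (t n) = y i (t n) - poly (p n i) (t n)" for n i
    by (simp add: \<theta>_def \<pi>_def)
  have \<theta>_end: "poly (\<theta> n i) (t (Suc n)) = y i (t (Suc n)) - poly (p n i) (t (Suc n))" if "n < N" "i < M" for n i
    using split[of n i "t (Suc n)"] \<eta>_end[OF that] that t_less[of n] by (simp add: \<theta>_def)
  have \<theta>_plt: "plt (Suc r) (\<theta> n i)" if "n < N" "i < M" for n i
    unfolding \<theta>_def \<pi>_def using that
    by (intro plt_diff plt_add p q' pr_plt zLn) (auto simp: plt_def coeff_pCons split: nat.splits)
  have \<theta>_ode: "poly (pderiv (\<theta> n i)) x = (\<Sum>j<M. D i j * poly (pr (t n) (t (Suc n)) r (poly (\<theta> n j))) x) + poly (f n i) x"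
    if n: "n < N" and i: "i < M" and x: "x \<in> {t n<..<t (Suc n)}" for n i x
  proof -
    let ?P = "pr (t n) (t (Suc n)) r"
    have yLn: "L2 (t n) (t (Suc n)) (y j)" if "j < M" for j
    proof (rule L2_cong_AE)
      show "L2 (t n) (t (Suc n)) (\<lambda>x. poly (\<pi> n j) x + \<eta> n j x)" by (intro L2_add L2_poly \<eta>L n that)
      show "AE x in mu (t n) (t (Suc n)). poly (\<pi> n j) x + \<eta> n j x = y j x"
        using split[OF n that] by (auto intro!: AE_I2)
    qed
    have "AE x in mu (t n) (t (Suc n)). z i x = (\<Sum>j<M. D i j * y j x) + R i x"
      using tr[of n] tr[of "Suc n"] n by (intro AE_mu_subset[OF ode[OF i]]) auto
    then have "?P (z i) = ?P (\<lambda>x. (\<Sum>j<M. D i j * y j x) + R i x)"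
      by (rule pr_cong_AE) (rule zLn[OF n i])
    also have "\<dots> = (\<Sum>j<M. Polynomial.smult (D i j) (?P (y j))) + ?P (R i)"
    proof -
      have "L2 (t n) (t (Suc n)) (\<lambda>x. \<Sum>j<M. D i j * y j x)" by (intro L2_sum L2_cmult yLn) simp
      moreover have "?P (\<lambda>x. \<Sum>j<M. D i j * y j x) = (\<Sum>j<M. Polynomial.smult (D i j) (?P (y j)))"
        by (intro pr_lincomb t_less n) (auto intro: yLn)
      ultimately show ?thesis using pr_add[OF t_less[OF n] _ RLn[OF n i]] by simp
    qed
    finally have Pz: "?P (z i) = (\<Sum>j<M. Polynomial.smult (D i j) (?P (y j))) + ?P (R i)" .
    have Py: "?P (y j) = ?P (poly (p n j)) + ?P (poly (\<theta> n j)) + ?P (\<eta> n j)" if "j < M" for j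
    proof -
      have "?P (y j) = ?P (\<lambda>x. (poly (p n j) x + poly (\<theta> n j) x) + \<eta> n j x)"
        using split[OF n that] by (intro pr_cong_AE yLn that) (auto intro!: AE_I2 simp: \<theta>_def)
      then show ?thesis using t_less[OF n] \<eta>L[OF n that] by (simp add: pr_add L2_add L2_poly)
    qed
    have "poly (pderiv (\<theta> n i)) x = poly (?P (z i)) x - poly (pderiv (p n i)) x"
      by (simp add: \<theta>_def \<pi>_def pderiv_diff pderiv_add pderiv_pCons q)
    also have "\<dots> = (\<Sum>j<M. D i j * poly (?P (y j)) x) - (\<Sum>j<M. D i j * poly (?P (poly (p n j))) x)"
      unfolding pode[OF n i x] Pz by (simp add: poly_sum)
    also have "\<dots> = (\<Sum>j<M. D i j * poly (?P (poly (\<theta> n j))) x + D i j * poly (?P (\<eta> n j)) x)"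
      unfolding sum_subtractf[symmetric] by (intro sum.cong) (auto simp: Py algebra_simps)
    also have "\<dots> = (\<Sum>j<M. D i j * poly (?P (poly (\<theta> n j))) x) + poly (f n i) x"
      by (simp add: f_def poly_sum sum.distrib)
    finally show ?thesis .
  qed
  \<comment> \<open>Squared nodal error, read from the piece to the left of the node, and 0 at the
    initial node. Continuity of the pieces makes it the value from the right too, which chains the
    intervals.\<close>
  define A where "A n = (\<Sum>i<M. (y i (t n) - (if n = 0 then y i 0 else poly (p (n - 1) i) (t n)))\<^sup>2)" for n
  define \<Theta> where "\<Theta> n = (\<Sum>i<M. nsq (t n) (t (Suc n)) (poly (\<theta> n i)))" for n
  define F where "F n = (\<Sum>i<M. nsq (t n) (t (Suc n)) (poly (f n i)))" for n
  have A_start: "(\<Sum>i<M. (poly (\<theta> n i) (t n))\<^sup>2) = A n" if "n < N" for n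
  proof (cases n)
    case 0
    have "poly (\<theta> 0 i) 0 = y i 0 - poly (p 0 i) 0" for i using \<theta>_start[of 0 i] t0 by simp
    then show ?thesis using 0 by (simp add: A_def p0 t0)
  next
    case (Suc m)
    then show ?thesis using pc[of m] that by (auto simp: A_def \<theta>_start intro!: sum.cong)
  qed
  have A_end: "(\<Sum>i<M. (poly (\<theta> n i) (t (Suc n)))\<^sup>2) = A (Suc n)" if "n < N" for n
    using that by (auto simp: A_def \<theta>_end intro!: sum.cong)
  have \<Theta>_nonneg: "0 \<le> \<Theta> n" and F_nonneg: "0 \<le> F n" for n
    by (auto simp: \<Theta>_def F_def intro!: sum_nonneg nsq_nonneg)
  have local: "A (Suc n) \<le> A n + (e * \<Theta> n + F n / e)" "\<Theta> n \<le> h n * A n + h n * (e * \<Theta> n + F n / e)"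
    if "n < N" "e > 0" for n e
    using galerkin_local[where p = "\<theta> n" and f = "f n" and r = r and M = M and D = D,
        OF t_less[OF that(1)] \<theta>_plt[OF that(1)] D \<theta>_ode[OF that(1)] that(2)]
      A_start[OF that(1)] A_end[OF that(1)]
    by (simp_all add: \<Theta>_def F_def h_def)
  have A0: "A 0 = 0" by (simp add: A_def t0)
  have stab1: "(\<Sum>n<N. \<Theta> n) \<le> 16 * T\<^sup>2 * (\<Sum>n<N. F n)"
    by (rule gronwall_free_stability(1)[where h = h and A = A])
      (auto intro: sum_h T h F_nonneg \<Theta>_nonneg A0 local)
  have stab2: "\<Theta> n \<le> 20 * T * h n * (\<Sum>n<N. F n)" if "n < N" for n
    by (rule gronwall_free_stability(2)[where h = h and A = A])
      (auto intro: sum_h T h F_nonneg \<Theta>_nonneg A0 local that)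
  have FE: "(\<Sum>n<N. F n) \<le> E2"
    unfolding E2_def F_def sum_distrib_left
  proof (intro sum_mono)
    fix n i assume "n \<in> {..<N}" "i \<in> {..<M}"
    then have n: "n < N" and i: "i < M" by auto
    let ?a = "t n" and ?b = "t (Suc n)"
    \<comment> \<open>\<open>D\<close> has constant entries and commutes with projection and
      primitive, so the duality bound applies to \<open>zD\<close> as a whole and no norm of
      \<open>D\<close> is needed.\<close>
    define zD where "zD x = (\<Sum>j<M. D i j * z j x)" for x
    have zDL: "L2 ?a ?b zD" unfolding zD_def by (intro L2_sum L2_cmult zLn n) auto
    have "f n i = pr ?a ?b r (\<lambda>x. \<Sum>j<M. D i j * \<eta> n j x)"
      unfolding f_def using t_less[OF n] \<eta>L[OF n] by (intro pr_lincomb[symmetric]) auto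
    then have "nsq ?a ?b (poly (f n i)) \<le> nsq ?a ?b (\<lambda>x. \<Sum>j<M. D i j * \<eta> n j x)"
      using \<eta>L[OF n] by (auto intro!: nsq_pr_le L2_sum L2_cmult)
    also have "\<dots> = nsq ?a ?b (prim ?a (\<lambda>x. \<Sum>j<M. D i j * u n j x))"
      unfolding nsq_def
    proof (rule Bochner_Integration.integral_cong[OF refl])
      fix x assume "x \<in> space (mu ?a ?b)"
      then have "prim ?a (\<lambda>x. \<Sum>j<M. D i j * u n j x) x = (\<Sum>j<M. prim ?a (\<lambda>x. D i j * u n j x) x)"
        using uL[OF n] by (intro prim_sum[of _ _ ?b]) (auto intro!: L2_integrable L2_cmult)
      then show "(\<Sum>j<M. D i j * \<eta> n j x)\<^sup>2 = (prim ?a (\<lambda>x. \<Sum>j<M. D i j * u n j x) x)\<^sup>2"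
        by (simp add: prim_cmult \<eta>_def)
    qed
    also have "(\<lambda>x. \<Sum>j<M. D i j * u n j x) = (\<lambda>x. zD x - poly (pr ?a ?b r zD) x)"
    proof -
      have "pr ?a ?b r zD = (\<Sum>j<M. Polynomial.smult (D i j) (pr ?a ?b r (z j)))"
        unfolding zD_def using t_less[OF n] zLn[OF n] by (intro pr_lincomb) auto
      then show ?thesis
        by (auto simp: zD_def u_def poly_sum sum_subtractf right_diff_distrib)
    qed
    also have "nsq ?a ?b (prim ?a \<dots>) \<le> ((?b - ?a) / r)\<^sup>2 * err ?a ?b r zD"
      by (rule nsq_prim_err[OF t_less[OF n] zDL r])
    finally show "nsq ?a ?b (poly (f n i)) \<le> ((?b - ?a) / r)\<^sup>2 * err ?a ?b r (\<lambda>x. \<Sum>j<M. D i j * z j x)"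
      by (simp add: zD_def[abs_def])
  qed
  have "(\<Sum>n<N. \<Sum>i<M. nsq (t n) (t (Suc n)) (\<lambda>x. y i x - poly (p n i) x))
      \<le> (\<Sum>n<N. 2 * ((h n / r)\<^sup>2 * E1 n) + 2 * \<Theta> n)"
  proof (rule sum_mono)
    fix n assume "n \<in> {..<N}"
    then have n: "n < N" by simp
    have "nsq (t n) (t (Suc n)) (\<lambda>x. y i x - poly (p n i) x)
        \<le> 2 * ((h n / r)\<^sup>2 * err (t n) (t (Suc n)) r (z i)) + 2 * nsq (t n) (t (Suc n)) (poly (\<theta> n i))"
      if i: "i < M" for i
    proof -
      have "nsq (t n) (t (Suc n)) (\<lambda>x. \<eta> n i x + poly (\<theta> n i) x)
          \<le> 2 * nsq (t n) (t (Suc n)) (\<eta> n i) + 2 * nsq (t n) (t (Suc n)) (poly (\<theta> n i))"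
        by (intro nsq_add_le \<eta>L n i L2_poly)
      moreover have "nsq (t n) (t (Suc n)) (\<eta> n i) \<le> (h n / r)\<^sup>2 * err (t n) (t (Suc n)) r (z i)"
        unfolding \<eta>_def u_def[abs_def] h_def by (intro nsq_prim_err t_less n zLn i r)
      moreover have "nsq (t n) (t (Suc n)) (\<lambda>x. y i x - poly (p n i) x) = nsq (t n) (t (Suc n)) (\<lambda>x. \<eta> n i x + poly (\<theta> n i) x)"
        unfolding nsq_def using split[OF n i] by (intro Bochner_Integration.integral_cong) (auto simp: \<theta>_def algebra_simps)
      ultimately show ?thesis by linarith
    qed
    then have "(\<Sum>i<M. nsq (t n) (t (Suc n)) (\<lambda>x. y i x - poly (p n i) x))
      \<le> (\<Sum>i<M. 2 * ((h n / r)\<^sup>2 * err (t n) (t (Suc n)) r (z i)) + 2 * nsq (t n) (t (Suc n)) (poly (\<theta> n i)))"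
      by (intro sum_mono) auto
    then show "(\<Sum>i<M. nsq (t n) (t (Suc n)) (\<lambda>x. y i x - poly (p n i) x)) \<le> 2 * ((h n / r)\<^sup>2 * E1 n) + 2 * \<Theta> n"
      by (simp only: E1_def \<Theta>_def sum.distrib sum_distrib_left)
  qed
  also have "\<dots> = 2 * (\<Sum>n<N. (h n / r)\<^sup>2 * E1 n) + 2 * (\<Sum>n<N. \<Theta> n)"
    by (simp only: sum.distrib sum_distrib_left)
  also have "(\<Sum>n<N. \<Theta> n) \<le> 16 * T\<^sup>2 * E2"
    by (intro order_trans[OF stab1 mult_left_mono[OF FE]]) simp
  finally show "(\<Sum>n<N. \<Sum>i<M. nsq (t n) (t (Suc n)) (\<lambda>x. y i x - poly (p n i) x))
      \<le> 2 * (\<Sum>n<N. ((t (Suc n) - t n) / r)\<^sup>2 * E1 n) + 32 * T\<^sup>2 * E2" by (simp add: h_def)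
  fix n x assume n: "n < N" and x: "x \<in> {t n..t (Suc n)}"
  have "(y i x - poly (p n i) x)\<^sup>2 \<le> 2 * (h n * err (t n) (t (Suc n)) r (z i)) +
      2 * (2 * (real (Suc r))\<^sup>2 * nsq (t n) (t (Suc n)) (poly (\<theta> n i)) / h n)" if i: "i < M" for i
  proof -
    have "(y i x - poly (p n i) x)\<^sup>2 = (\<eta> n i x + poly (\<theta> n i) x)\<^sup>2"
      using split[OF n i x] by (simp add: \<theta>_def algebra_simps)
    also have "\<dots> \<le> 2 * (\<eta> n i x)\<^sup>2 + 2 * (poly (\<theta> n i) x)\<^sup>2"
      using sum_squares_bound[of "\<eta> n i x" "poly (\<theta> n i) x"] by (simp add: power2_sum)
    also have "(\<eta> n i x)\<^sup>2 \<le> h n * err (t n) (t (Suc n)) r (z i)"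
      unfolding \<eta>_def u_def[abs_def] h_def by (intro prim_err_sup zLn n i x)
    also have "(poly (\<theta> n i) x)\<^sup>2 \<le> 2 * (real (Suc r))\<^sup>2 * nsq (t n) (t (Suc n)) (poly (\<theta> n i)) / h n"
      using inverse_inequality[OF t_less[OF n] \<theta>_plt[OF n i] x] h[OF n] by (simp add: h_def field_simps)
    finally show ?thesis by simp
  qed
  then have "(\<Sum>i<M. (y i x - poly (p n i) x)\<^sup>2) \<le> (\<Sum>i<M. 2 * (h n * err (t n) (t (Suc n)) r (z i)) +
      2 * (2 * (real (Suc r))\<^sup>2 * nsq (t n) (t (Suc n)) (poly (\<theta> n i)) / h n))"
    by (intro sum_mono) auto
  also have "\<dots> = 2 * h n * E1 n + 4 * (real (Suc r))\<^sup>2 * \<Theta> n / h n"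
    by (simp add: E1_def \<Theta>_def sum.distrib sum_distrib_left sum_divide_distrib mult.assoc)
  \<comment> \<open>\<open>Suc r \<le> 2 * r\<close>, and \<open>4 * 4 * 20 = 320\<close>.\<close>
  also have "4 * (real (Suc r))\<^sup>2 * \<Theta> n / h n \<le> 4 * (2 * real r)\<^sup>2 * (20 * T * h n * E2) / h n"
  proof (intro divide_right_mono mult_mono power_mono)
    show "\<Theta> n \<le> 20 * T * h n * E2"
      by (intro order_trans[OF stab2[OF n] mult_left_mono[OF FE]]) (use T h[OF n] in simp)
  qed (use r h[OF n] \<Theta>_nonneg in auto)
  also have "4 * (2 * real r)\<^sup>2 * (20 * T * h n * E2) / h n = 320 * (real r)\<^sup>2 * T * E2"
    using h[OF n] by simp
  finally show "(\<Sum>i<M. (y i x - poly (p n i) x)\<^sup>2) \<le> 2 * (t (Suc n) - t n) * E1 n + 320 * (real r)\<^sup>2 * T * E2"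
    by (simp add: h_def)
qed

section \<open>Test functions\<close>

text \<open>Differentiability of finite order with existentially quantified derivatives: sums,
  products and compositions follow by plain induction, whereas iterated \<open>deriv\<close> of a
  product would call for the Leibniz formula.\<close>

primrec diff_upto :: "nat \<Rightarrow> (real \<Rightarrow> real) \<Rightarrow> bool" where
  "diff_upto 0 f = True"
| "diff_upto (Suc n) f = (\<exists>f'. (\<forall>x. (f has_real_derivative f' x) (at x)) \<and> diff_upto n f')"

lemma diff_upto_SucD: "diff_upto (Suc n) f \<Longrightarrow> diff_upto n f"
  by (induction n arbitrary: f) (simp, metis diff_upto.simps(2))

lemma diff_upto_const: "diff_upto n (\<lambda>x. c)"
proof (induction n arbitrary: c)
  case (Suc n)
  show ?case by (auto intro!: exI[of _ "\<lambda>x. 0"] derivative_eq_intros Suc)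
qed simp

lemma diff_upto_add: "diff_upto n f \<Longrightarrow> diff_upto n g \<Longrightarrow> diff_upto n (\<lambda>x. f x + g x)"
proof (induction n arbitrary: f g)
  case (Suc n)
  then obtain f' g' where "\<forall>x. (f has_real_derivative f' x) (at x)" "diff_upto n f'"
    "\<forall>x. (g has_real_derivative g' x) (at x)" "diff_upto n g'" by auto
  then show ?case by (auto intro!: exI[of _ "\<lambda>x. f' x + g' x"] DERIV_add Suc.IH)
qed simp

lemma diff_upto_mult: "diff_upto n f \<Longrightarrow> diff_upto n g \<Longrightarrow> diff_upto n (\<lambda>x. f x * g x)"
proof (induction n arbitrary: f g)
  case (Suc n)
  then obtain f' g' where f': "\<forall>x. (f has_real_derivative f' x) (at x)" "diff_upto n f'"
    and g': "\<forall>x. (g has_real_derivative g' x) (at x)" "diff_upto n g'" by auto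
  have "diff_upto n f" "diff_upto n g" using Suc.prems by (auto intro: diff_upto_SucD simp del: diff_upto.simps)
  then have "diff_upto n (\<lambda>x. f' x * g x + g' x * f x)" using f' g' by (intro diff_upto_add Suc.IH) auto
  then show ?case using f' g' by (auto intro!: exI[of _ "\<lambda>x. f' x * g x + g' x * f x"] DERIV_mult)
qed simp

lemma diff_upto_poly: "diff_upto n (poly p)"
  by (induction n arbitrary: p) (auto intro: exI[of _ "poly (pderiv _)"] poly_DERIV)

lemma diff_upto_affine: "diff_upto n f \<Longrightarrow> diff_upto n (\<lambda>x. f (c * x + d))"
proof (induction n arbitrary: f)
  case (Suc n)
  then obtain f' where f': "\<forall>x. (f has_real_derivative f' x) (at x)" "diff_upto n f'" by auto
  have "((\<lambda>x. f (c * x + d)) has_real_derivative f' (c * x + d) * c) (at x)" for x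
    by (rule DERIV_chain2[OF spec[OF f'(1)]]) (auto intro!: derivative_eq_intros)
  moreover have "diff_upto n (\<lambda>x. f' (c * x + d) * c)" by (intro diff_upto_mult diff_upto_const Suc.IH f'(2))
  ultimately show ?case by (simp only: diff_upto.simps) (intro exI[of _ "\<lambda>x. f' (c * x + d) * c"] conjI allI)
qed simp

lemma diff_upto_deriv:
  assumes "diff_upto (Suc n) f"
  shows "(f has_real_derivative deriv f x) (at x)" "diff_upto n (deriv f)"
proof -
  obtain f' where f': "\<forall>x. (f has_real_derivative f' x) (at x)" "diff_upto n f'" using assms by auto
  then have "deriv f = f'" by (auto intro!: ext DERIV_imp_deriv)
  with f' show "(f has_real_derivative deriv f x) (at x)" "diff_upto n (deriv f)" by auto
qed

text \<open>Translates the smoothness clause of \<open>test_fun\<close>, stated with iterated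
  \<open>deriv\<close>, into the inductive form.\<close>

lemma infinitely_differentiable_iff: "(\<forall>n x. (deriv ^^ n) f field_differentiable at x) \<longleftrightarrow> (\<forall>n. diff_upto n f)"
proof
  assume *: "\<forall>n x. (deriv ^^ n) f field_differentiable at x"
  have "diff_upto n f" if "\<forall>n x. (deriv ^^ n) f field_differentiable at x" for n f
    using that
  proof (induction n arbitrary: f)
    case (Suc n)
    have "f field_differentiable at x" for x using Suc.prems[rule_format, of 0 x] by simp
    then have "\<forall>x. (f has_real_derivative deriv f x) (at x)" by (auto simp: DERIV_deriv_iff_field_differentiable)
    moreover have "(deriv ^^ n) (deriv f) field_differentiable at x" for n x
      using Suc.prems[rule_format, of "Suc n" x] by (simp add: funpow_Suc_right del: funpow.simps)
    ultimately show ?case using Suc.IH by auto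
  qed simp
  with * show "\<forall>n. diff_upto n f" by blast
next
  assume *: "\<forall>n. diff_upto n f"
  have "(deriv ^^ n) f field_differentiable at x" if "diff_upto (Suc n) f" for n f x
    using that
  proof (induction n arbitrary: f)
    case 0
    then show ?case by (auto simp: field_differentiable_def)
  next
    case (Suc n)
    then have "diff_upto (Suc n) (deriv f)" by (intro diff_upto_deriv)
    from Suc.IH[OF this] show ?case by (simp add: funpow_Suc_right del: funpow.simps)
  qed
  with * show "\<forall>n x. (deriv ^^ n) f field_differentiable at x" by blast
qed

text \<open>The functions \<open>p (1/x) exp (-1/x)\<close>, extended by \<open>0\<close>, form a class that is closed under
  differentiation.\<close>

definition bump :: "real poly \<Rightarrow> real \<Rightarrow> real" where
  "bump p x = (if x > 0 then poly p (1 / x) * exp (- (1 / x)) else 0)"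

lemma poly_exp_decay: "((\<lambda>x. poly p x * exp (- x)) \<longlongrightarrow> 0) (at_top :: real filter)"
proof -
  have "((\<lambda>x. \<Sum>i\<le>degree p. coeff p i * (x ^ i / exp x)) \<longlongrightarrow> 0) at_top"
    by (intro tendsto_null_sum tendsto_mult_right_zero tendsto_power_div_exp_0)
  then show ?thesis by (simp add: poly_altdef exp_minus divide_inverse sum_distrib_right mult.assoc)
qed

text \<open>In the variable \<open>1 / x\<close> the chain rule replaces \<open>p\<close> by the
  square of the variable times \<open>p - pderiv p\<close>. At 0 the right-sided difference quotient
  is again a polynomial in \<open>1 / y\<close> times the exponential, which decays.\<close>

lemma bump_has_derivative: "(bump p has_real_derivative bump (monom 1 2 * (p - pderiv p)) x) (at x)"
proof (cases x "0::real" rule: linorder_cases)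
  case less
  have "((\<lambda>x. 0) has_real_derivative 0) (at x)" by simp
  then have "(bump p has_real_derivative 0) (at x)"
    by (rule has_field_derivative_transform_within_open[of _ _ _ "{..<0}"]) (use less in \<open>auto simp: bump_def\<close>)
  then show ?thesis using less by (simp add: bump_def)
next
  case greater
  have "((\<lambda>x. poly p (1 / x) * exp (- (1 / x))) has_real_derivative
      poly (pderiv p) (1 / x) * (- 1 / x\<^sup>2) * exp (- (1 / x)) + (exp (- (1 / x)) * (1 / x\<^sup>2)) * poly p (1 / x)) (at x)"
    using greater by (intro DERIV_mult DERIV_chain2[OF poly_DERIV]) (auto intro!: derivative_eq_intros simp: power2_eq_square)
  also have "poly (pderiv p) (1 / x) * (- 1 / x\<^sup>2) * exp (- (1 / x)) + (exp (- (1 / x)) * (1 / x\<^sup>2)) * poly p (1 / x)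
      = bump (monom 1 2 * (p - pderiv p)) x"
    using greater by (simp add: bump_def poly_monom field_simps power2_eq_square)
  finally show ?thesis
    by (rule has_field_derivative_transform_within_open[of _ _ _ "{0<..}"]) (use greater in \<open>auto simp: bump_def\<close>)
next
  case equal
  \<comment> \<open>\<open>pCons 0 p\<close> supplies the extra factor \<open>1 / y\<close> of the
    difference quotient.\<close>
  have lim: "((\<lambda>y. poly (pCons 0 p) (inverse y) * exp (- inverse y)) \<longlongrightarrow> 0) (at_right (0::real))"
    by (rule filterlim_compose[OF poly_exp_decay filterlim_inverse_at_top_right])
  have "((\<lambda>y. (bump p y - bump p 0) / (y - 0)) \<longlongrightarrow> 0) (at_right 0)"
    by (rule Lim_transform_eventually[OF lim])
      (auto simp: eventually_at_filter bump_def divide_inverse)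
  moreover have "((\<lambda>y. (bump p y - bump p 0) / (y - 0)) \<longlongrightarrow> 0) (at_left 0)"
    by (rule Lim_transform_eventually[OF tendsto_const])
      (auto simp: eventually_at_filter bump_def)
  ultimately have "(bump p has_real_derivative 0) (at 0)"
    unfolding has_field_derivative_iff filterlim_at_split by simp
  then show ?thesis using equal by (simp add: bump_def)
qed

lemma diff_upto_bump: "diff_upto n (bump p)"
  by (induction n arbitrary: p) (auto intro: bump_has_derivative)

text \<open>The arguments are \<open>n\<close> times the distances to the shrunk end points. They
  are negative outside the shrunk interval, where the bumps vanish, and tend to infinity at each
  inner point, where \<open>bump 1\<close> tends to 1. They are spelled out in the form
  \<open>c * x + d\<close> of \<open>diff_upto_affine\<close>.\<close>

definition cutoff :: "real \<Rightarrow> real \<Rightarrow> nat \<Rightarrow> real \<Rightarrow> real" where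
  "cutoff a b n x = bump 1 (real n * x + - real n * (a + 1 / Suc n)) * bump 1 (- real n * x + real n * (b - 1 / Suc n))"

lemma bump_1_bounds: "0 \<le> bump 1 x" "bump 1 x \<le> 1"
  by (auto simp: bump_def)

lemma cutoff_bounds: "0 \<le> cutoff a b n x" "cutoff a b n x \<le> 1"
  unfolding cutoff_def using bump_1_bounds by (auto intro: mult_le_one)

lemma cutoff_outside:
  assumes "x \<notin> {a + 1 / Suc n..b - 1 / Suc n}"
  shows "cutoff a b n x = 0"
proof -
  have "real n * x \<le> real n * (a + 1 / Suc n) \<or> real n * (b - 1 / Suc n) \<le> real n * x"
    using assms by (auto simp: not_le intro!: mult_left_mono)
  then show ?thesis by (auto simp: cutoff_def bump_def)
qed

lemma bump_1_tendsto: "(bump 1 \<longlongrightarrow> 1) at_top"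
proof -
  have "((\<lambda>x::real. exp (- inverse x)) \<longlongrightarrow> exp (- 0)) at_top"
    by (intro tendsto_exp tendsto_minus tendsto_inverse_0_at_top filterlim_ident)
  then have "((\<lambda>x::real. exp (- inverse x)) \<longlongrightarrow> 1) at_top" by simp
  then show ?thesis
    by (rule Lim_transform_eventually)
      (use eventually_gt_at_top[of 0] in eventually_elim, simp add: bump_def divide_inverse)
qed

lemma cutoff_tendsto:
  assumes x: "x \<in> {a<..<b}"
  shows "(\<lambda>n. cutoff a b n x) \<longlonglongrightarrow> 1"
proof -
  \<comment> \<open>Both bump arguments have this form, with \<open>c\<close> the distance of
    \<open>x\<close> to an end point.\<close>
  have *: "filterlim (\<lambda>n. real n * c - real n / Suc n) at_top sequentially" if "c > 0" for c
  proof (rule filterlim_at_top_mono)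
    show "filterlim (\<lambda>n. - 1 + real n * c) at_top sequentially"
      using that by (intro filterlim_tendsto_add_at_top[OF tendsto_const] filterlim_at_top_mult_tendsto_pos[OF tendsto_const _ filterlim_real_sequentially])
    show "\<forall>\<^sub>F n in sequentially. - 1 + real n * c \<le> real n * c - real n / Suc n"
      by (intro always_eventually allI) (simp add: field_simps)
  qed
  have "(\<lambda>n. bump 1 (real n * (x - a) - real n / Suc n)) \<longlonglongrightarrow> 1"
    "(\<lambda>n. bump 1 (real n * (b - x) - real n / Suc n)) \<longlonglongrightarrow> 1"
    by (rule filterlim_compose[OF bump_1_tendsto *], use x in simp)+
  from tendsto_mult[OF this]
  show ?thesis
    by (simp add: cutoff_def algebra_simps)
qed

lemma test_funI:
  assumes "\<And>n. diff_upto n \<phi>" "a < c" "d < b" "\<And>x. x \<notin> {c..d} \<Longrightarrow> \<phi> x = 0"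
  shows "test_fun a b \<phi>"
  unfolding test_fun_def
proof (intro conjI)
  show "\<forall>n x. (deriv ^^ n) \<phi> field_differentiable at x" using assms(1) by (subst infinitely_differentiable_iff) blast
  have "{x. \<phi> x \<noteq> 0} \<subseteq> {c..d}" using assms(4) by blast
  then have sub: "closure {x. \<phi> x \<noteq> 0} \<subseteq> {c..d}" by (rule closure_minimal) simp
  then show "closure {x. \<phi> x \<noteq> 0} \<subseteq> {a<..<b}" using assms(2,3) by force
  show "compact (closure {x. \<phi> x \<noteq> 0})"
    using sub by (metis closed_closure closed_Int_compact compact_Icc inf.absorb1)
qed

lemma test_fun_diff_upto: "test_fun a b \<phi> \<Longrightarrow> diff_upto n \<phi>"
  unfolding test_fun_def infinitely_differentiable_iff by blast

lemma test_fun_support: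
  assumes "test_fun a b \<phi>" "a < b"
  obtains c d where "a < c" "c < d" "d < b" "\<And>x. x \<notin> {c..d} \<Longrightarrow> \<phi> x = 0"
proof -
  \<comment> \<open>The midpoint keeps the compact set nonempty when the test function is 0.\<close>
  let ?K = "insert ((a + b) / 2) (closure {x. \<phi> x \<noteq> 0})"
  have K: "compact ?K" "?K \<subseteq> {a<..<b}" using assms by (auto simp: test_fun_def)
  obtain l u where l: "l \<in> ?K" "\<And>x. x \<in> ?K \<Longrightarrow> l \<le> x" and u: "u \<in> ?K" "\<And>x. x \<in> ?K \<Longrightarrow> x \<le> u"
    using compact_attains_inf[OF K(1) insert_not_empty] compact_attains_sup[OF K(1) insert_not_empty] by blast
  show thesis
  proof
    have lu: "a < l" "u < b" "l \<le> u" using l u K(2) by auto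
    show "a < (a + l) / 2" "(u + b) / 2 < b" "(a + l) / 2 < (u + b) / 2" using lu by auto
    show "\<phi> x = 0" if "x \<notin> {(a + l) / 2..(u + b) / 2}" for x
    proof (rule ccontr)
      assume "\<phi> x \<noteq> 0"
      then have "x \<in> ?K" using closure_subset[of "{x. \<phi> x \<noteq> 0}"] by auto
      from l(2)[OF this] u(2)[OF this] that lu show False by auto
    qed
  qed
qed

lemma test_fun_deriv:
  assumes "test_fun a b \<phi>" "a < b"
  shows "test_fun a b (deriv \<phi>)"
proof -
  obtain c d where cd: "a < c" "c < d" "d < b" "\<And>x. x \<notin> {c..d} \<Longrightarrow> \<phi> x = 0"
    using test_fun_support[OF assms] by metis
  show ?thesis
  proof (rule test_funI[OF _ cd(1,3)])
    show "diff_upto n (deriv \<phi>)" for n using test_fun_diff_upto[OF assms(1), of "Suc n"] by (rule diff_upto_deriv)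
    fix x assume x: "x \<notin> {c..d}"
    have "((\<lambda>x. 0) has_real_derivative 0) (at x)" by simp
    then have "(\<phi> has_real_derivative 0) (at x)"
      by (rule has_field_derivative_transform_within_open[of _ _ _ "- {c..d}"])
        (use x cd(4) in \<open>auto intro: open_Compl\<close>)
    then show "deriv \<phi> x = 0" by (rule DERIV_imp_deriv)
  qed
qed

lemma test_fun_mono: "test_fun c d \<phi> \<Longrightarrow> a \<le> c \<Longrightarrow> d \<le> b \<Longrightarrow> test_fun a b \<phi>"
  unfolding test_fun_def by (meson greaterThanLessThan_subseteq_greaterThanLessThan order_trans)

lemma test_fun_cutoff: "test_fun a b (\<lambda>x. poly p x * cutoff a b n x)"
proof (rule test_funI)
  show "diff_upto m (\<lambda>x. poly p x * cutoff a b n x)" for m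
    unfolding cutoff_def by (intro diff_upto_mult diff_upto_poly diff_upto_affine diff_upto_bump)
  show "a < a + 1 / Suc n" "b - 1 / Suc n < b" by auto
qed (simp add: cutoff_outside)

lemma test_fun_continuous: "test_fun a b \<phi> \<Longrightarrow> continuous_on S \<phi>"
  using diff_upto_deriv(1)[OF test_fun_diff_upto[of a b \<phi> "Suc 0"]]
  by (meson DERIV_continuous continuous_at_imp_continuous_on)

section \<open>The fundamental lemma and the lemma of du Bois-Reymond\<close>

lemma set_integral_mu: "(LINT x:{a<..<b}|lebesgue. f x :: real) = integral\<^sup>L (mu a b) f"
  by (simp add: set_lebesgue_integral_def integral_restrict_space)

lemma integrable_mult_bounded:
  assumes "integrable (mu a b) g" "f \<in> borel_measurable (mu a b)" "\<And>x. x \<in> {a<..<b} \<Longrightarrow> \<bar>f x\<bar> \<le> B"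
  shows "integrable (mu a b) (\<lambda>x. g x * f x :: real)"
proof (rule Bochner_Integration.integrable_bound)
  show "integrable (mu a b) (\<lambda>x. B * g x)" using assms(1) by simp
  show "AE x in mu a b. norm (g x * f x) \<le> norm (B * g x)"
  proof (rule AE_I2)
    fix x assume "x \<in> space (mu a b)"
    then have "\<bar>f x\<bar> \<le> \<bar>B\<bar>" using assms(3)[of x] by auto
    then show "norm (g x * f x) \<le> norm (B * g x)"
      by (simp add: abs_mult mult.commute mult_right_mono)
  qed
qed (use assms in \<open>auto intro!: borel_measurable_times\<close>)

lemma poly_bounded_mu: obtains B :: real where "\<And>x. x \<in> {a<..<b} \<Longrightarrow> \<bar>poly p x\<bar> \<le> B"
proof -
  have "bounded (poly p ` {a..b})"
    by (intro compact_imp_bounded compact_continuous_image continuous_intros compact_Icc)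
  then obtain B where "\<And>x. x \<in> {a..b} \<Longrightarrow> \<bar>poly p x\<bar> \<le> B"
    unfolding bounded_iff by (metis imageI real_norm_def)
  then show thesis by (intro that[of B]) auto
qed

lemma cutoff_limit:
  assumes g: "integrable (mu a b) (g :: real \<Rightarrow> real)"
  shows "(\<lambda>n. integral\<^sup>L (mu a b) (\<lambda>x. g x * (poly p x * cutoff a b n x))) \<longlonglongrightarrow> integral\<^sup>L (mu a b) (\<lambda>x. g x * poly p x)"
proof -
  obtain B where B: "\<And>x. x \<in> {a<..<b} \<Longrightarrow> \<bar>poly p x\<bar> \<le> B" using poly_bounded_mu[of a b p] by metis
  show ?thesis
  proof (rule integral_dominated_convergence[where w = "\<lambda>x. \<bar>g x * poly p x\<bar>"])
    have gp: "integrable (mu a b) (\<lambda>x. g x * poly p x)"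
      by (rule integrable_mult_bounded[OF g poly_measurable_mu B])
    then show "integrable (mu a b) (\<lambda>x. \<bar>g x * poly p x\<bar>)" by simp
    show "(\<lambda>x. g x * poly p x) \<in> borel_measurable (mu a b)" using gp by auto
    show "(\<lambda>x. g x * (poly p x * cutoff a b n x)) \<in> borel_measurable (mu a b)" for n
      by (rule borel_measurable_times[OF borel_measurable_integrable[OF g]
            continuous_measurable_mu[OF test_fun_continuous[OF test_fun_cutoff]]])
    show "AE x in mu a b. (\<lambda>n. g x * (poly p x * cutoff a b n x)) \<longlonglongrightarrow> g x * poly p x"
      by (rule AE_I2) (auto intro!: tendsto_eq_intros cutoff_tendsto)
    show "AE x in mu a b. norm (g x * (poly p x * cutoff a b n x)) \<le> \<bar>g x * poly p x\<bar>" for n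
      using cutoff_bounds by (intro AE_I2) (auto simp: abs_mult intro!: mult_left_mono mult_left_le)
  qed
qed

text \<open>Polynomials times cutoffs are test functions, and dominated convergence removes the
  cutoff, which leaves orthogonality to polynomials.\<close>

lemma AE_zero_if_orthogonal_test_funs:
  assumes g: "integrable (mu a b) (g :: real \<Rightarrow> real)"
    and orth: "\<And>\<phi>. test_fun a b \<phi> \<Longrightarrow> integral\<^sup>L (mu a b) (\<lambda>x. g x * \<phi> x) = 0"
  shows "AE x in mu a b. g x = 0"
proof (rule AE_zero_if_orthogonal_polys[OF g])
  fix p show "integral\<^sup>L (mu a b) (\<lambda>x. g x * poly p x) = 0"
    using cutoff_limit[OF g, of p] orth[OF test_fun_cutoff[of a b p]] by (simp add: LIMSEQ_const_iff)
qed

text \<open>A primitive that is 0 to the left of the support of \<open>\<psi>\<close> is constant to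
  the right of it; mean zero makes this constant 0.\<close>

lemma test_fun_antiderivative:
  assumes \<psi>: "test_fun a b \<psi>" and ab: "a < b" and zero: "integral\<^sup>L (mu a b) \<psi> = 0"
  obtains \<phi> where "test_fun a b \<phi>" "deriv \<phi> = \<psi>"
proof -
  have cont: "isCont \<psi> x" for x
    using test_fun_continuous[OF \<psi>, of UNIV] by (simp add: continuous_on_eq_continuous_at)
  obtain F where F: "\<And>x. (F has_real_derivative \<psi> x) (at x)"
    using einterval_antiderivative[of "-\<infinity>" "\<infinity>" \<psi>] cont
    by (auto simp: has_real_derivative_iff_has_vector_derivative)
  obtain c d where cd: "a < c" "c < d" "d < b" "\<And>x. x \<notin> {c..d} \<Longrightarrow> \<psi> x = 0"
    using test_fun_support[OF \<psi> ab] by metis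
  define \<phi> where "\<phi> x = F x - F c" for x
  have d\<phi>: "(\<phi> has_real_derivative \<psi> x) (at x)" for x
    unfolding \<phi>_def using F by (auto intro!: derivative_eq_intros)
  have const: "\<phi> u = \<phi> v" if "u \<le> v" "\<And>x. u < x \<Longrightarrow> x < v \<Longrightarrow> \<psi> x = 0" for u v
  proof (cases "u = v")
    case False
    with that(1) have "u < v" by simp
    then obtain z where "z > u" "z < v" "\<phi> v - \<phi> u = (v - u) * \<psi> z"
      using MVT2[of u v \<phi> \<psi>] d\<phi> by blast
    then show ?thesis using that(2) by simp
  qed simp
  have "\<phi> b - \<phi> a = integral\<^sup>L (mu a b) \<psi>"
    using ab by (intro integral_mu_FTC[symmetric]) (auto intro: DERIV_subset[OF d\<phi>] test_fun_continuous[OF \<psi>])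
  then have "\<phi> b = \<phi> a" using zero by simp
  moreover have "\<phi> a = \<phi> c" using cd by (intro const) auto
  moreover have "\<phi> d = \<phi> b" using cd by (intro const) auto
  moreover have "\<phi> c = 0" by (simp add: \<phi>_def)
  ultimately have "\<phi> d = 0" by simp
  have "test_fun a b \<phi>"
  proof (rule test_funI[OF _ cd(1,3)])
    show "diff_upto n \<phi>" for n
      using d\<phi> test_fun_diff_upto[OF \<psi>] diff_upto_SucD[of n \<phi>] by auto
    fix x assume "x \<notin> {c..d}"
    then consider "x < c" | "x > d" by fastforce
    then show "\<phi> x = 0"
    proof cases
      case 1
      then have "\<phi> x = \<phi> c" using cd by (intro const) auto
      then show ?thesis using \<open>\<phi> c = 0\<close> by simp
    next
      case 2
      then have "\<phi> d = \<phi> x" using cd by (intro const) auto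
      then show ?thesis using \<open>\<phi> d = 0\<close> by simp
    qed
  qed
  moreover have "deriv \<phi> = \<psi>" using d\<phi> by (auto intro!: ext DERIV_imp_deriv)
  ultimately show thesis by (rule that)
qed

lemma test_fun_lincomb:
  assumes "test_fun a b \<phi>" "test_fun a b \<psi>" "a < b"
  shows "test_fun a b (\<lambda>x. c * \<phi> x + d * \<psi> x)"
proof -
  obtain l u where 1: "a < l" "l < u" "u < b" "\<And>x. x \<notin> {l..u} \<Longrightarrow> \<phi> x = 0"
    using test_fun_support[OF assms(1,3)] by metis
  obtain l' u' where 2: "a < l'" "l' < u'" "u' < b" "\<And>x. x \<notin> {l'..u'} \<Longrightarrow> \<psi> x = 0"
    using test_fun_support[OF assms(2,3)] by metis
  show ?thesis
  proof (rule test_funI[where c = "min l l'" and d = "max u u'"])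
    show "diff_upto n (\<lambda>x. c * \<phi> x + d * \<psi> x)" for n
      by (intro diff_upto_add diff_upto_mult diff_upto_const test_fun_diff_upto[OF assms(1)] test_fun_diff_upto[OF assms(2)])
    show "c * \<phi> x + d * \<psi> x = 0" if "x \<notin> {min l l'..max u u'}" for x
    proof -
      have "x \<notin> {l..u}" "x \<notin> {l'..u'}" using that by auto
      then show ?thesis by (simp add: 1(4) 2(4))
    qed
  qed (use 1 2 in auto)
qed

text \<open>du Bois-Reymond: combine two test functions to one of mean zero.\<close>

lemma AE_const_if_orthogonal_derivs:
  assumes ab: "a < b" and g: "integrable (mu a b) (g :: real \<Rightarrow> real)"
    and orth: "\<And>\<phi>. test_fun a b \<phi> \<Longrightarrow> integral\<^sup>L (mu a b) (\<lambda>x. g x * deriv \<phi> x) = 0"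
  shows "\<exists>c. AE x in mu a b. g x = c"
proof -
  let ?I = "integral\<^sup>L (mu a b)"
  have one: "integrable (mu a b) (\<lambda>x. 1 :: real)" by (rule integrable_mu_const)
  have tint: "integrable (mu a b) \<phi>" if "test_fun a b \<phi>" for \<phi>
    by (intro integrable_mu_continuous test_fun_continuous[OF that])
  have gint: "integrable (mu a b) (\<lambda>x. g x * \<phi> x)" if "test_fun a b \<phi>" for \<phi>
  proof -
    have "bounded (\<phi> ` {a..b})"
      by (intro compact_imp_bounded compact_continuous_image test_fun_continuous[OF that] compact_Icc)
    then obtain B where "\<And>x. x \<in> {a..b} \<Longrightarrow> \<bar>\<phi> x\<bar> \<le> B"
      unfolding bounded_iff by (metis imageI real_norm_def)
    then show ?thesis
      by (intro integrable_mult_bounded[OF g continuous_measurable_mu[OF test_fun_continuous[OF that]], of B]) auto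
  qed
  have key: "?I \<psi> * ?I (\<lambda>x. g x * \<phi> x) = ?I \<phi> * ?I (\<lambda>x. g x * \<psi> x)"
    if \<phi>: "test_fun a b \<phi>" and \<psi>: "test_fun a b \<psi>" for \<phi> \<psi>
  proof -
    define \<omega> where "\<omega> x = ?I \<psi> * \<phi> x + (- ?I \<phi>) * \<psi> x" for x
    have \<omega>: "test_fun a b \<omega>" unfolding \<omega>_def by (intro test_fun_lincomb \<phi> \<psi> ab)
    have "?I \<omega> = 0" unfolding \<omega>_def using tint[OF \<phi>] tint[OF \<psi>] by simp
    then obtain \<Phi> where "test_fun a b \<Phi>" "deriv \<Phi> = \<omega>" using test_fun_antiderivative[OF \<omega> ab] by metis
    then have "?I (\<lambda>x. g x * \<omega> x) = 0" using orth[of \<Phi>] by simp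
    moreover have "(\<lambda>x. g x * \<omega> x) = (\<lambda>x. ?I \<psi> * (g x * \<phi> x) - ?I \<phi> * (g x * \<psi> x))"
      by (auto simp: \<omega>_def algebra_simps)
    ultimately show ?thesis using gint[OF \<phi>] gint[OF \<psi>] by simp
  qed
  have lim1: "(b - a) * ?I (\<lambda>x. g x * poly p x) = ?I (poly p) * ?I g" for p
  proof -
    \<comment> \<open>The identity \<open>key\<close> passes to the limit in one test function at a
      time: here \<open>\<phi>\<close> becomes a polynomial, afterwards the cutoff in the role of
      \<open>\<psi>\<close> tends to 1.\<close>
    have step: "?I (\<lambda>x. 1 * cutoff a b m x) * ?I (\<lambda>x. g x * poly p x) = ?I (poly p) * ?I (\<lambda>x. g x * (1 * cutoff a b m x))" for m
    proof (rule LIMSEQ_unique)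
      have cm: "test_fun a b (\<lambda>x. 1 * cutoff a b m x)" using test_fun_cutoff[of a b 1 m] by simp
      show "(\<lambda>n. ?I (\<lambda>x. 1 * cutoff a b m x) * ?I (\<lambda>x. g x * (poly p x * cutoff a b n x)))
          \<longlonglongrightarrow> ?I (\<lambda>x. 1 * cutoff a b m x) * ?I (\<lambda>x. g x * poly p x)"
        by (intro tendsto_mult_left cutoff_limit g)
      show "(\<lambda>n. ?I (\<lambda>x. 1 * cutoff a b m x) * ?I (\<lambda>x. g x * (poly p x * cutoff a b n x)))
          \<longlonglongrightarrow> ?I (poly p) * ?I (\<lambda>x. g x * (1 * cutoff a b m x))"
        unfolding key[OF test_fun_cutoff cm]
        using cutoff_limit[OF one, of p] by (intro tendsto_mult_right) simp
    qed
    have "(\<lambda>m. ?I (\<lambda>x. 1 * (poly 1 x * cutoff a b m x))) \<longlonglongrightarrow> ?I (\<lambda>x. 1 * poly 1 x)"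
      by (rule cutoff_limit[OF one])
    then have 1: "(\<lambda>m. ?I (cutoff a b m)) \<longlonglongrightarrow> b - a"
      using ab by (simp add: measure_mu)
    have 2: "(\<lambda>m. ?I (\<lambda>x. g x * cutoff a b m x)) \<longlonglongrightarrow> ?I g"
      using cutoff_limit[OF g, of 1] by simp
    show ?thesis
    proof (rule LIMSEQ_unique)
      show "(\<lambda>m. ?I (cutoff a b m) * ?I (\<lambda>x. g x * poly p x)) \<longlonglongrightarrow> (b - a) * ?I (\<lambda>x. g x * poly p x)"
        by (intro tendsto_mult_right 1)
      show "(\<lambda>m. ?I (cutoff a b m) * ?I (\<lambda>x. g x * poly p x)) \<longlonglongrightarrow> ?I (poly p) * ?I g"
        using step by (simp add: tendsto_mult_left[OF 2])
    qed
  qed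
  define c where "c = ?I g / (b - a)"
  have "AE x in mu a b. g x - c = 0"
  proof (rule AE_zero_if_orthogonal_polys)
    show "integrable (mu a b) (\<lambda>x. g x - c)" using g integrable_mu_const by auto
    fix p
    obtain B where "\<And>x. x \<in> {a<..<b} \<Longrightarrow> \<bar>poly p x\<bar> \<le> B" using poly_bounded_mu[of a b p] by metis
    then have "integrable (mu a b) (\<lambda>x. g x * poly p x)"
      by (rule integrable_mult_bounded[OF g poly_measurable_mu])
    then have "?I (\<lambda>x. (g x - c) * poly p x) = ?I (\<lambda>x. g x * poly p x) - c * ?I (poly p)"
      by (simp add: left_diff_distrib L2_integrable L2_poly)
    then show "?I (\<lambda>x. (g x - c) * poly p x) = 0"
      using lim1[of p] ab by (simp add: c_def field_simps)
  qed
  then show ?thesis by (intro exI[of _ c]) auto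
qed

section \<open>Weak derivatives\<close>

lemma test_fun_bounded:
  assumes "test_fun a b \<phi>"
  obtains B where "\<And>x. x \<in> {a..b} \<Longrightarrow> \<bar>\<phi> x\<bar> \<le> B"
proof -
  have "bounded (\<phi> ` {a..b})"
    by (intro compact_imp_bounded compact_continuous_image test_fun_continuous[OF assms] compact_Icc)
  then show thesis using that unfolding bounded_iff by (metis imageI real_norm_def)
qed

lemma locally_integrable_mu:
  assumes "locally_integrable a b u" "a < c" "d < b"
  shows "integrable (mu c d) u"
proof -
  have "set_integrable lebesgue {c..d} u" using assms by (simp add: locally_integrable_def)
  then have "set_integrable lebesgue {c<..<d} u" by (rule set_integrable_subset) auto
  then show ?thesis by (simp add: set_integrable_eq)
qed

text \<open>A locally integrable \<open>u\<close> need not be integrable up to the end points. The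
  support of the test function allows moving to an inner interval, where it is.\<close>

lemma integrable_test_support:
  assumes "test_fun a b \<phi>" "\<And>x. x \<notin> {c..d} \<Longrightarrow> \<phi> x = 0" "a < c" "d < b" "c' < c" "d < d'" "a \<le> c'" "d' \<le> b"
  shows "integral\<^sup>L (mu a b) (\<lambda>x. u x * \<phi> x :: real) = integral\<^sup>L (mu c' d') (\<lambda>x. u x * \<phi> x)"
    and "integrable (mu a b) (\<lambda>x. u x * \<phi> x) \<longleftrightarrow> integrable (mu c' d') (\<lambda>x. u x * \<phi> x)"
proof -
  have "(\<lambda>x. indicator {a<..<b} x *\<^sub>R (u x * \<phi> x)) = (\<lambda>x. indicator {c'<..<d'} x *\<^sub>R (u x * \<phi> x))"
    using assms(2-) by (intro ext) (auto split: split_indicator)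
  then show "integral\<^sup>L (mu a b) (\<lambda>x. u x * \<phi> x :: real) = integral\<^sup>L (mu c' d') (\<lambda>x. u x * \<phi> x)"
    and "integrable (mu a b) (\<lambda>x. u x * \<phi> x) \<longleftrightarrow> integrable (mu c' d') (\<lambda>x. u x * \<phi> x)"
    by (simp_all add: integral_restrict_space integrable_restrict_space)
qed

lemma integrable_test:
  assumes u: "locally_integrable a b u" and \<phi>: "test_fun a b \<phi>" and ab: "a < b"
  shows "integrable (mu a b) (\<lambda>x. u x * \<phi> x)"
proof -
  obtain c d where cd: "a < c" "c < d" "d < b" "\<And>x. x \<notin> {c..d} \<Longrightarrow> \<phi> x = 0"
    using test_fun_support[OF \<phi> ab] by metis
  define c' d' where "c' = (a + c) / 2" and "d' = (d + b) / 2"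
  have c': "a < c'" "c' < c" "d < d'" "d' < b" using cd by (auto simp: c'_def d'_def)
  obtain B where B: "\<And>x. x \<in> {a..b} \<Longrightarrow> \<bar>\<phi> x\<bar> \<le> B" using test_fun_bounded[OF \<phi>] by metis
  have "integrable (mu c' d') (\<lambda>x. u x * \<phi> x)"
    using c' by (intro integrable_mult_bounded[OF locally_integrable_mu[OF u]
          continuous_measurable_mu[OF test_fun_continuous[OF \<phi>]], of _ _ B] B) auto
  then show ?thesis using integrable_test_support(2)[OF \<phi> cd(4), where c' = c' and d' = d' and u = u] cd c' by simp
qed

lemma locally_integrable_lincomb:
  assumes "\<And>i. i \<in> I \<Longrightarrow> locally_integrable a b (u i)"
  shows "locally_integrable a b (\<lambda>x. \<Sum>i\<in>I. c i * u i x)"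
  unfolding locally_integrable_def set_integrable_def
proof (intro allI impI)
  fix l r assume lr: "a < l" "r < b"
  have "(\<lambda>x. indicat_real {l..r} x *\<^sub>R (\<Sum>i\<in>I. c i * u i x)) = (\<lambda>x. \<Sum>i\<in>I. c i * (indicat_real {l..r} x *\<^sub>R u i x))"
    by (auto simp: sum_distrib_left mult.left_commute)
  moreover have "integrable lebesgue (\<lambda>x. \<Sum>i\<in>I. c i * (indicat_real {l..r} x *\<^sub>R u i x))"
    using assms lr by (intro Bochner_Integration.integrable_sum integrable_mult_right)
      (auto simp: locally_integrable_def set_integrable_def)
  ultimately show "integrable lebesgue (\<lambda>x. indicat_real {l..r} x *\<^sub>R (\<Sum>i\<in>I. c i * u i x))" by simp
qed

text \<open>The exceptional sets of the countably many inner intervals with margin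
  \<open>1 / Suc n\<close> have a null union.\<close>

lemma AE_mu_exhaust:
  assumes "\<And>c d. a < c \<Longrightarrow> c < d \<Longrightarrow> d < b \<Longrightarrow> AE x in mu c d. P x"
  shows "AE x in mu a b. P x"
proof -
  have "AE x in mu (a + 1 / Suc n) (b - 1 / Suc n). P x" for n
  proof (cases "a + 1 / Suc n < b - 1 / Suc n")
    case False
    then have "{a + 1 / Suc n<..<b - 1 / Suc n} = {}" by auto
    then show ?thesis by (simp only:) (simp add: AE_restrict_space_iff)
  qed (intro assms; simp)
  then have "AE x in lebesgue. \<forall>n. x \<in> {a + 1 / Suc n<..<b - 1 / Suc n} \<longrightarrow> P x"
    unfolding AE_all_countable by (simp add: AE_restrict_space_iff)
  then have "AE x in lebesgue. x \<in> {a<..<b} \<longrightarrow> P x"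
  proof (rule AE_mp, intro AE_I2 impI)
    fix x assume *: "\<forall>n. x \<in> {a + 1 / Suc n<..<b - 1 / Suc n} \<longrightarrow> P x" and x: "x \<in> {a<..<b}"
    obtain n where n: "1 / Suc n < min (x - a) (b - x)"
      using x reals_Archimedean[of "min (x - a) (b - x)"] by (auto simp: inverse_eq_divide)
    then have "x \<in> {a + 1 / Suc n<..<b - 1 / Suc n}" by auto
    with * show "P x" by blast
  qed
  then show ?thesis by (simp add: AE_restrict_space_iff)
qed

lemma AE_zero_if_orthogonal_test_funs_local:
  assumes g: "locally_integrable a b g"
    and orth: "\<And>\<phi>. test_fun a b \<phi> \<Longrightarrow> integral\<^sup>L (mu a b) (\<lambda>x. g x * \<phi> x) = 0"
  shows "AE x in mu a b. g x = 0"
proof (rule AE_mu_exhaust)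
  fix c d assume cd: "a < c" "c < d" "d < b"
  show "AE x in mu c d. g x = 0"
  proof (rule AE_zero_if_orthogonal_test_funs)
    show "integrable (mu c d) g" using g cd by (intro locally_integrable_mu)
    fix \<phi> assume \<phi>: "test_fun c d \<phi>"
    obtain l u where lu: "c < l" "l < u" "u < d" "\<And>x. x \<notin> {l..u} \<Longrightarrow> \<phi> x = 0"
      using test_fun_support[OF \<phi> cd(2)] by metis
    have \<phi>': "test_fun a b \<phi>" using \<phi> cd by (auto intro: test_fun_mono)
    show "integral\<^sup>L (mu c d) (\<lambda>x. g x * \<phi> x) = 0"
      using orth[OF \<phi>'] integrable_test_support(1)[OF \<phi>' lu(4), where c' = c and d' = d and u = g] lu cd by simp
  qed
qed

lemma weak_deriv_mu:
  "weak_deriv a b k u v \<longleftrightarrow> locally_integrable a b u \<and> locally_integrable a b v \<and>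
     (\<forall>\<phi>. test_fun a b \<phi> \<longrightarrow> integral\<^sup>L (mu a b) (\<lambda>x. u x * (deriv ^^ k) \<phi> x) =
        (- 1) ^ k * integral\<^sup>L (mu a b) (\<lambda>x. v x * \<phi> x))"
  by (simp add: weak_deriv_def set_integral_mu)

lemma test_fun_higher_deriv: "test_fun a b \<phi> \<Longrightarrow> a < b \<Longrightarrow> test_fun a b ((deriv ^^ k) \<phi>)"
  by (induction k) (auto intro: test_fun_deriv)

text \<open>This gives \<open>wderiv\<close> its meaning: whatever is known a.e. about one weak
  derivative transfers to the selected one.\<close>

lemma weak_deriv_unique:
  assumes "weak_deriv a b k u v" "weak_deriv a b k u v'" "a < b"
  shows "AE x in mu a b. v x = v' x"
proof -
  have lv: "locally_integrable a b v" "locally_integrable a b v'" using assms by (auto simp: weak_deriv_mu)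
  have "AE x in mu a b. v x - v' x = 0"
  proof (rule AE_zero_if_orthogonal_test_funs_local)
    show "locally_integrable a b (\<lambda>x. v x - v' x)"
      using lv by (auto simp: locally_integrable_def)
    fix \<phi> assume \<phi>: "test_fun a b \<phi>"
    then have "(- 1) ^ k * integral\<^sup>L (mu a b) (\<lambda>x. v x * \<phi> x) = (- 1) ^ k * integral\<^sup>L (mu a b) (\<lambda>x. v' x * \<phi> x)"
      using assms by (simp add: weak_deriv_mu)
    then have "integral\<^sup>L (mu a b) (\<lambda>x. v x * \<phi> x) = integral\<^sup>L (mu a b) (\<lambda>x. v' x * \<phi> x)" by simp
    then show "integral\<^sup>L (mu a b) (\<lambda>x. (v x - v' x) * \<phi> x) = 0"
      using integrable_test[OF lv(1) \<phi> assms(3)] integrable_test[OF lv(2) \<phi> assms(3)]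
      by (simp add: left_diff_distrib)
  qed
  then show ?thesis by auto
qed

lemma weak_deriv_lincomb:
  assumes "\<And>i. i \<in> I \<Longrightarrow> weak_deriv a b k (u i) (v i)" "a < b"
  shows "weak_deriv a b k (\<lambda>x. \<Sum>i\<in>I. c i * u i x) (\<lambda>x. \<Sum>i\<in>I. c i * v i x)"
  unfolding weak_deriv_mu
proof (intro conjI allI impI)
  show "locally_integrable a b (\<lambda>x. \<Sum>i\<in>I. c i * u i x)" "locally_integrable a b (\<lambda>x. \<Sum>i\<in>I. c i * v i x)"
    using assms by (auto intro!: locally_integrable_lincomb simp: weak_deriv_mu)
  fix \<phi> assume \<phi>: "test_fun a b \<phi>"
  have *: "integral\<^sup>L (mu a b) (\<lambda>x. (\<Sum>i\<in>I. c i * w i x) * \<psi> x) = (\<Sum>i\<in>I. c i * integral\<^sup>L (mu a b) (\<lambda>x. w i x * \<psi> x))"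
    if "\<And>i. i \<in> I \<Longrightarrow> locally_integrable a b (w i)" "test_fun a b \<psi>" for w \<psi>
    using integrable_test[OF that(1) that(2) assms(2)]
    by (simp add: sum_distrib_right mult.assoc)
  show "integral\<^sup>L (mu a b) (\<lambda>x. (\<Sum>i\<in>I. c i * u i x) * (deriv ^^ k) \<phi> x) =
        (- 1) ^ k * integral\<^sup>L (mu a b) (\<lambda>x. (\<Sum>i\<in>I. c i * v i x) * \<phi> x)"
    using assms \<phi> by (simp add: * weak_deriv_mu test_fun_higher_deriv sum_distrib_left mult.left_commute)
qed

lemma weak_deriv_diff:
  assumes "weak_deriv a b k u v" "weak_deriv a b k u' v'" "a < b"
  shows "weak_deriv a b k (\<lambda>x. u x - u' x) (\<lambda>x. v x - v' x)"
  using weak_deriv_lincomb[of "{0, 1 :: nat}" a b k "\<lambda>i. if i = 0 then u else u'" "\<lambda>i. if i = 0 then v else v'"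
      "\<lambda>i. if i = 0 then 1 else - 1"] assms by simp

text \<open>Test with the derivative of a test function. Each order is defined directly from
  \<open>u\<close>; a chain needs the link between consecutive orders.\<close>

lemma weak_deriv_step:
  assumes "weak_deriv a b j u v" "weak_deriv a b (Suc j) u w" "a < b"
  shows "weak_deriv a b 1 v w"
  unfolding weak_deriv_mu
proof (intro conjI allI impI)
  fix \<phi> assume \<phi>: "test_fun a b \<phi>"
  have "integral\<^sup>L (mu a b) (\<lambda>x. u x * (deriv ^^ j) (deriv \<phi>) x) = (- 1) ^ j * integral\<^sup>L (mu a b) (\<lambda>x. v x * deriv \<phi> x)"
    using assms(1) test_fun_deriv[OF \<phi> assms(3)] by (simp add: weak_deriv_mu)
  moreover have "integral\<^sup>L (mu a b) (\<lambda>x. u x * (deriv ^^ j) (deriv \<phi>) x) = (- 1) ^ Suc j * integral\<^sup>L (mu a b) (\<lambda>x. w x * \<phi> x)"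
    using assms(2) \<phi> by (simp add: weak_deriv_mu funpow_Suc_right del: funpow.simps power_Suc)
  ultimately have "(- 1) ^ j * integral\<^sup>L (mu a b) (\<lambda>x. v x * deriv \<phi> x) = (- 1) ^ j * (- integral\<^sup>L (mu a b) (\<lambda>x. w x * \<phi> x))"
    by simp
  then have "integral\<^sup>L (mu a b) (\<lambda>x. v x * deriv \<phi> x) = - integral\<^sup>L (mu a b) (\<lambda>x. w x * \<phi> x)"
    by (subst (asm) mult_left_cancel) simp_all
  then show "integral\<^sup>L (mu a b) (\<lambda>x. v x * (deriv ^^ 1) \<phi> x) = (- 1) ^ 1 * integral\<^sup>L (mu a b) (\<lambda>x. w x * \<phi> x)"
    by simp
qed (use assms in \<open>auto simp: weak_deriv_mu\<close>)

lemma weak_deriv_0: "locally_integrable a b u \<Longrightarrow> weak_deriv a b 0 u u"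
  by (simp add: weak_deriv_mu)

text \<open>By integration by parts, \<open>u\<close> minus the primitive of \<open>v\<close> is
  orthogonal to the derivatives of all test functions, hence a.e. constant.\<close>

lemma weak_deriv_primitive:
  assumes u: "weak_deriv a b 1 u v" "L2 a b u" and v: "L2 a b v" and ab: "a < b"
  shows "\<exists>c. AE x in mu a b. u x = c + prim a v x"
proof -
  have "\<exists>c. AE x in mu a b. u x - prim a v x = c"
  proof (rule AE_const_if_orthogonal_derivs[OF ab])
    have L: "L2 a b (\<lambda>x. u x - prim a v x)" by (intro L2_diff u L2_prim v)
    then show "integrable (mu a b) (\<lambda>x. u x - prim a v x)" by (rule L2_integrable)
    fix \<phi> assume \<phi>: "test_fun a b \<phi>"
    have d\<phi>: "test_fun a b (deriv \<phi>)" by (rule test_fun_deriv[OF \<phi> ab])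
    have \<phi>L: "L2 a b \<phi>" "L2 a b (deriv \<phi>)"
      using test_fun_continuous[OF \<phi>] test_fun_continuous[OF d\<phi>] by (auto intro: L2_continuous)
    obtain c d where "d < b" "\<And>x. x \<notin> {c..d} \<Longrightarrow> \<phi> x = 0"
      using test_fun_support[OF \<phi> ab] by metis
    then have "\<phi> b = 0" by auto
    moreover have "ip a b (prim a v) (deriv \<phi>) + ip a b v \<phi> = prim a v b * \<phi> b"
    proof (rule ip_prim_parts[OF less_imp_le[OF ab] v])
      show "(\<phi> has_real_derivative deriv \<phi> x) (at x within {a..b})" for x
        using diff_upto_deriv(1)[OF test_fun_diff_upto[OF \<phi>, of "Suc 0"]] by (rule DERIV_subset) simp
    qed (rule test_fun_continuous[OF d\<phi>])
    moreover have "ip a b u (deriv \<phi>) = - ip a b v \<phi>"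
      using u(1) \<phi> by (simp add: weak_deriv_mu ip_def)
    ultimately have "ip a b (\<lambda>x. u x - prim a v x) (deriv \<phi>) = 0"
      using \<phi>L by (simp add: ip_diff_left u(2) L2_prim v)
    then show "integral\<^sup>L (mu a b) (\<lambda>x. (u x - prim a v x) * deriv \<phi> x) = 0" by (simp add: ip_def)
  qed
  then obtain c where "AE x in mu a b. u x - prim a v x = c" by blast
  then have "AE x in mu a b. u x = c + prim a v x" by (rule AE_mp) (auto intro!: AE_I2)
  then show ?thesis by blast
qed

lemma wderiv_weak_deriv: "\<exists>v. weak_deriv a b k u v \<Longrightarrow> weak_deriv a b k u (wderiv a b k u)"
  unfolding wderiv_def by (rule someI_ex[where P = "weak_deriv a b k u"])

lemma wderiv_eq_AE: "weak_deriv a b k u v \<Longrightarrow> a < b \<Longrightarrow> AE x in mu a b. wderiv a b k u x = v x"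
  by (rule weak_deriv_unique[OF wderiv_weak_deriv]) auto

lemma locally_integrable_measurable:
  assumes "locally_integrable a b u"
  shows "u \<in> borel_measurable (mu a b)"
proof (rule borel_measurable_if_D)
  let ?U = "\<lambda>n x. if x \<in> {a + 1 / Suc n<..<b - 1 / Suc n} then u x else 0"
  show "(\<lambda>x. if x \<in> {a<..<b} then u x else 0) \<in> borel_measurable lebesgue"
  proof (rule borel_measurable_LIMSEQ_real)
    show "?U n \<in> borel_measurable lebesgue" for n
      using locally_integrable_mu[OF assms, of "a + 1 / Suc n" "b - 1 / Suc n"]
      by (intro borel_measurable_if_I) auto
    fix x
    show "(\<lambda>n. ?U n x) \<longlonglongrightarrow> (if x \<in> {a<..<b} then u x else 0)"
    proof (cases "x \<in> {a<..<b}")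
      case True
      obtain n where n: "1 / Suc n < min (x - a) (b - x)"
        using True reals_Archimedean[of "min (x - a) (b - x)"] by (auto simp: inverse_eq_divide)
      have "\<forall>\<^sub>F m in sequentially. ?U m x = u x"
        using eventually_ge_at_top[of n]
      proof eventually_elim
        case (elim m)
        then have "1 / real (Suc m) \<le> 1 / Suc n" by (intro divide_left_mono) auto
        with n have "x \<in> {a + 1 / Suc m<..<b - 1 / Suc m}" by auto
        then show ?case by simp
      qed
      then show ?thesis using True by (simp add: tendsto_eventually)
    next
      case False
      have "x \<notin> {a + 1 / Suc n<..<b - 1 / Suc n}" for n
      proof -
        have "0 < 1 / real (Suc n)" by simp
        with False show ?thesis by (simp only: greaterThanLessThan_iff) linarith
      qed
      then have "?U n x = 0" for n by (simp only: if_False)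
      then show ?thesis using False by (simp only: if_False tendsto_const)
    qed
  qed
qed

text \<open>The offset \<open>m\<close> lets a chain start at the first or at the second derivative
  of the solution.\<close>

lemma weak_deriv_chain:
  assumes wd: "\<And>j. j \<le> k \<Longrightarrow> weak_deriv a b (m + j) u (g j)" and L: "\<And>j. j \<le> k \<Longrightarrow> L2 a b (g j)" and ab: "a < b"
  shows "chain a b k g"
  unfolding chain_def
proof (intro conjI allI impI L)
  fix j assume j: "j < k"
  then have "weak_deriv a b (m + j) u (g j)" "weak_deriv a b (Suc (m + j)) u (g (Suc j))"
    using wd[of j] wd[of "Suc j"] by auto
  from weak_deriv_step[OF this ab] show "\<exists>c. AE x in mu a b. g j x = c + prim a (g (Suc j)) x"
    using j L ab by (intro weak_deriv_primitive) auto
qed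

lemma continuous_AE_eq:
  assumes "AE x in mu a b. f x = g x" "continuous_on {a..b} f" "continuous_on {a..b} (g :: real \<Rightarrow> real)" "a < b" "x \<in> {a..b}"
  shows "f x = g x"
proof -
  have "nsq a b (\<lambda>x. f x - g x) = nsq a b (\<lambda>x. 0)"
    using assms by (intro nsq_cong_AE L2_continuous continuous_intros) auto
  then have z: "integral\<^sup>L (mu a b) (\<lambda>x. (f x - g x)\<^sup>2) = 0" by (simp add: nsq_def)
  have c: "continuous_on {a..b} (\<lambda>x. (f x - g x)\<^sup>2)" using assms by (intro continuous_intros)
  have "integral {a..b} (\<lambda>x. (f x - g x)\<^sup>2) = 0"
    using prim_eq_integral(1)[OF integrable_mu_continuous[OF c] order_refl] z by (simp add: prim_def)
  moreover have "(\<lambda>x. (f x - g x)\<^sup>2) integrable_on {a..b}"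
    by (rule integrable_continuous_real[OF c])
  ultimately have "((\<lambda>x. (f x - g x)\<^sup>2) has_integral 0) (cbox a b)"
    by (metis box_real(2) integrable_integral)
  then have "(f x - g x)\<^sup>2 = 0"
    by (rule has_integral_0_cbox_imp_0[rotated 2]) (use c assms in auto)
  then show ?thesis by simp
qed

section \<open>Sobolev norms of vector functions\<close>

lemma vnorm_sq: "(vnorm v)\<^sup>2 = (\<Sum>i<dim_vec v. (v $ i)\<^sup>2)"
proof -
  have "v \<bullet> v = (\<Sum>i<dim_vec v. (v $ i)\<^sup>2)"
    by (simp add: scalar_prod_def power2_eq_square lessThan_atLeast0)
  then show ?thesis by (simp add: vnorm_def sum_nonneg)
qed

lemma vnorm_nonneg: "0 \<le> vnorm v"
proof -
  have "0 \<le> v \<bullet> v" by (simp add: scalar_prod_def sum_nonneg)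
  then show ?thesis by (simp add: vnorm_def)
qed

abbreviation wcomp :: "real \<Rightarrow> nat \<Rightarrow> (real \<Rightarrow> real Matrix.vec) \<Rightarrow> nat \<Rightarrow> real \<Rightarrow> real" where
  "wcomp T j v i \<equiv> wderiv 0 T j (\<lambda>x. v x $ i)"

lemma vnorm_vderiv_sq: "(vnorm (vderiv M a b j v x))\<^sup>2 = (\<Sum>i<M. (wderiv a b j (\<lambda>y. v y $ i) x)\<^sup>2)"
  by (simp add: vnorm_sq vderiv_def)

lemma vnorm_vderiv_diff_sq:
  "(vnorm (vderiv M a b j v x - vderiv M a b j v y))\<^sup>2 =
    (\<Sum>i<M. (wderiv a b j (\<lambda>y. v y $ i) x - wderiv a b j (\<lambda>y. v y $ i) y)\<^sup>2)"
  by (simp add: vnorm_sq vderiv_def)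

text \<open>The integrand in \<open>x\<close> of the squared norm, with the inner integral of the
  seminorm left over the whole of \<open>(0, T)\<close>. Restricting \<open>x\<close> to a cell
  bounds the local seminorm from above, and the restrictions add up exactly to the global
  norm.\<close>

definition Hdens :: "nat \<Rightarrow> real \<Rightarrow> real \<Rightarrow> (real \<Rightarrow> real Matrix.vec) \<Rightarrow> real \<Rightarrow> ennreal" where
  "Hdens M T s v x = (\<Sum>j\<le>nat \<lfloor>s\<rfloor>. ennreal (\<Sum>i<M. (wcomp T j v i x)\<^sup>2)) +
     (if frac s = 0 then 0
      else \<integral>\<^sup>+y. ennreal ((\<Sum>i<M. (wcomp T (nat \<lfloor>s\<rfloor>) v i x - wcomp T (nat \<lfloor>s\<rfloor>) v i y)\<^sup>2)
                / \<bar>x - y\<bar> powr (1 + 2 * frac s)) \<partial>mu 0 T)"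

lemma pair_measurable_fst: "f \<in> borel_measurable A \<Longrightarrow> (\<lambda>z. f (fst z)) \<in> borel_measurable (A \<Otimes>\<^sub>M B)"
  by (rule measurable_compose[OF measurable_fst])

lemma pair_measurable_snd: "f \<in> borel_measurable B \<Longrightarrow> (\<lambda>z. f (snd z)) \<in> borel_measurable (A \<Otimes>\<^sub>M B)"
  by (rule measurable_compose[OF measurable_snd])

lemma id_measurable_mu: "(\<lambda>x. x) \<in> borel_measurable (mu a b)"
  by (rule continuous_measurable_mu) (rule continuous_on_id)

lemma sigma_finite_mu: "sigma_finite_measure (mu a b)"
  using finite_measure_mu by (rule finite_measure.axioms(1))

lemma quotient_pair_measurable:
  assumes w: "\<And>i. i < M \<Longrightarrow> w i \<in> borel_measurable (mu 0 T)"
  shows "(\<lambda>(x, y). ennreal ((\<Sum>i<M. (w i x - w i y)\<^sup>2) / \<bar>x - y\<bar> powr p)) \<in> borel_measurable (mu 0 T \<Otimes>\<^sub>M mu 0 T)"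
proof -
  have d: "(\<lambda>z. f (fst z) - f (snd z)) \<in> borel_measurable (mu 0 T \<Otimes>\<^sub>M mu 0 T)"
    if "f \<in> borel_measurable (mu 0 T)" for f :: "real \<Rightarrow> real"
    using that by (intro borel_measurable_diff pair_measurable_fst pair_measurable_snd)
  have "(\<lambda>z. ennreal ((\<Sum>i<M. (w i (fst z) - w i (snd z))\<^sup>2) / \<bar>fst z - snd z\<bar> powr p)) \<in> borel_measurable (mu 0 T \<Otimes>\<^sub>M mu 0 T)"
    using w d[OF id_measurable_mu]
    by (intro measurable_compose[OF _ measurable_ennreal] borel_measurable_divide borel_measurable_sum
        borel_measurable_power d powr_real_measurable borel_measurable_abs) (auto intro: id_measurable_mu)
  then show ?thesis by (simp add: case_prod_beta')
qed

lemma sq_measurable: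
  assumes "\<And>i. i < M \<Longrightarrow> w i \<in> borel_measurable (mu a b)"
  shows "(\<lambda>x. ennreal (\<Sum>i<M. (w i x)\<^sup>2)) \<in> borel_measurable (mu a b)"
  using assms
  by (intro measurable_compose[OF _ measurable_ennreal] borel_measurable_sum borel_measurable_power) auto

lemma inner_measurable:
  assumes "\<And>i. i < M \<Longrightarrow> w i \<in> borel_measurable (mu 0 T)"
  shows "(\<lambda>x. \<integral>\<^sup>+y. ennreal ((\<Sum>i<M. (w i x - w i y)\<^sup>2) / \<bar>x - y\<bar> powr p) \<partial>mu 0 T) \<in> borel_measurable (mu 0 T)"
  by (rule sigma_finite_measure.borel_measurable_nn_integral[OF sigma_finite_mu quotient_pair_measurable[OF assms]])

lemma frac_part_measurable:
  assumes "\<And>i. i < M \<Longrightarrow> w i \<in> borel_measurable (mu 0 T)"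
  shows "(\<lambda>x. if frac s = 0 then 0 else \<integral>\<^sup>+y. ennreal ((\<Sum>i<M. (w i x - w i y)\<^sup>2) / \<bar>x - y\<bar> powr p) \<partial>mu 0 T)
    \<in> borel_measurable (mu 0 T)"
proof (cases "frac s = 0")
  case True
  show ?thesis unfolding True by simp
next
  case False
  show ?thesis unfolding if_not_P[OF False] by (rule inner_measurable[OF assms])
qed

lemma Hdens_measurable:
  assumes "\<And>i j. i < M \<Longrightarrow> j \<le> nat \<lfloor>s\<rfloor> \<Longrightarrow> wcomp T j v i \<in> borel_measurable (mu 0 T)"
  shows "Hdens M T s v \<in> borel_measurable (mu 0 T)"
  unfolding Hdens_def[abs_def]
  using assms by (intro borel_measurable_add borel_measurable_sum sq_measurable frac_part_measurable) auto

lemma H_norm_sq_eq: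
  assumes "\<And>i j. i < M \<Longrightarrow> j \<le> nat \<lfloor>s\<rfloor> \<Longrightarrow> wcomp T j v i \<in> borel_measurable (mu 0 T)"
  shows "H_norm_sq M 0 T s v = (\<integral>\<^sup>+x. Hdens M T s v x \<partial>mu 0 T)"
proof -
  let ?I = "\<lambda>x. \<integral>\<^sup>+y. ennreal ((\<Sum>i<M. (wcomp T (nat \<lfloor>s\<rfloor>) v i x - wcomp T (nat \<lfloor>s\<rfloor>) v i y)\<^sup>2)
                / \<bar>x - y\<bar> powr (1 + 2 * frac s)) \<partial>mu 0 T"
  have "(\<integral>\<^sup>+x. Hdens M T s v x \<partial>mu 0 T) = (\<integral>\<^sup>+x. (\<Sum>j\<le>nat \<lfloor>s\<rfloor>. ennreal (\<Sum>i<M. (wcomp T j v i x)\<^sup>2)) \<partial>mu 0 T) +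
     (\<integral>\<^sup>+x. (if frac s = 0 then 0 else ?I x) \<partial>mu 0 T)"
    unfolding Hdens_def using assms
    by (intro nn_integral_add borel_measurable_sum sq_measurable frac_part_measurable) auto
  also have "(\<integral>\<^sup>+x. (\<Sum>j\<le>nat \<lfloor>s\<rfloor>. ennreal (\<Sum>i<M. (wcomp T j v i x)\<^sup>2)) \<partial>mu 0 T) =
      (\<Sum>j\<le>nat \<lfloor>s\<rfloor>. \<integral>\<^sup>+x. ennreal (\<Sum>i<M. (wcomp T j v i x)\<^sup>2) \<partial>mu 0 T)"
    using assms by (intro nn_integral_sum sq_measurable) auto
  finally show ?thesis
    by (simp add: H_norm_sq_def vnorm_vderiv_sq vnorm_vderiv_diff_sq)
qed

lemma L2_if_nn_integral_finite:
  assumes "f \<in> borel_measurable (mu a b)" "(\<integral>\<^sup>+x. ennreal ((f x)\<^sup>2) \<partial>mu a b) < \<infinity>"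
  shows "L2 a b f"
  unfolding L2_def using assms
  by (auto intro!: integrableI_bounded borel_measurable_power)

lemma weakly_differentiable_wcomp:
  assumes "weakly_differentiable M 0 T k v" "i < M" "j \<le> k"
  shows "weak_deriv 0 T j (\<lambda>x. v x $ i) (wcomp T j v i)"
  using assms by (auto simp: weakly_differentiable_def intro!: wderiv_weak_deriv)

lemma weak_deriv_measurable: "weak_deriv a b k u v \<Longrightarrow> v \<in> borel_measurable (mu a b)"
  by (simp add: weak_deriv_mu locally_integrable_measurable)

text \<open>The family starts at the first derivative, so its order is \<open>s - 1\<close> with
  unchanged fractional part. For \<open>mod_bound\<close> the squared difference is divided by the
  power of \<open>\<bar>x - y\<bar>\<close> and multiplied by that of \<open>\<rho>\<close>, which
  can only enlarge it as long as \<open>\<bar>x - y\<bar> \<le> \<rho>\<close>.\<close>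

lemma H_space_sob:
  assumes wd: "weakly_differentiable M 0 T (nat \<lfloor>s\<rfloor>) v" and fin: "H_norm_sq M 0 T s v < \<infinity>"
    and s: "s \<ge> 1" and T: "T > 0"
  shows "sob_fam 0 T M (s - 1) (\<lambda>j i. wcomp T (Suc j) v i) (Hdens M T s v)"
    and "(\<integral>\<^sup>+x. Hdens M T s v x \<partial>mu 0 T) = ennreal ((H_norm M 0 T s v)\<^sup>2)"
    and "\<And>i j. i < M \<Longrightarrow> j \<le> nat \<lfloor>s\<rfloor> \<Longrightarrow> L2 0 T (wcomp T j v i)"
proof -
  define k where "k = nat \<lfloor>s\<rfloor>"
  have k1: "k \<ge> 1" using s by (simp add: k_def le_nat_iff le_floor_iff)
  have k: "nat \<lfloor>s - 1\<rfloor> = k - 1" by (simp add: k_def nat_diff_distrib)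
  have fr: "frac (s - 1) = frac s" by (simp add: frac_def)
  have wd': "weak_deriv 0 T j (\<lambda>x. v x $ i) (wcomp T j v i)" if "i < M" "j \<le> k" for i j
    using wd that unfolding k_def by (rule weakly_differentiable_wcomp)
  have meas: "wcomp T j v i \<in> borel_measurable (mu 0 T)" if "i < M" "j \<le> nat \<lfloor>s\<rfloor>" for i j
    using wd'[OF that(1)] that(2) by (auto simp: k_def intro: weak_deriv_measurable)
  have int: "H_norm_sq M 0 T s v = (\<integral>\<^sup>+x. Hdens M T s v x \<partial>mu 0 T)" by (rule H_norm_sq_eq[OF meas])
  show "(\<integral>\<^sup>+x. Hdens M T s v x \<partial>mu 0 T) = ennreal ((H_norm M 0 T s v)\<^sup>2)"
    unfolding int[symmetric] H_norm_def using fin by (simp add: less_top)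
  have dens: "ennreal (\<Sum>i<M. (wcomp T j v i x)\<^sup>2) \<le> Hdens M T s v x" if "j \<le> k" for j x
  proof -
    have "ennreal (\<Sum>i<M. (wcomp T j v i x)\<^sup>2) \<le> (\<Sum>j\<le>k. ennreal (\<Sum>i<M. (wcomp T j v i x)\<^sup>2))"
      using that by (intro member_le_sum) auto
    also have "\<dots> \<le> Hdens M T s v x" by (simp add: Hdens_def k_def)
    finally show ?thesis .
  qed
  show L: "L2 0 T (wcomp T j v i)" if "i < M" "j \<le> nat \<lfloor>s\<rfloor>" for i j
  proof (rule L2_if_nn_integral_finite[OF meas[OF that]])
    have "(\<integral>\<^sup>+x. ennreal ((wcomp T j v i x)\<^sup>2) \<partial>mu 0 T) \<le> (\<integral>\<^sup>+x. Hdens M T s v x \<partial>mu 0 T)"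
    proof (rule nn_integral_mono)
      fix x
      have "ennreal ((wcomp T j v i x)\<^sup>2) \<le> ennreal (\<Sum>i<M. (wcomp T j v i x)\<^sup>2)"
        using that(1) by (intro ennreal_leI member_le_sum) auto
      also have "\<dots> \<le> Hdens M T s v x" using that(2) by (intro dens) (simp add: k_def)
      finally show "ennreal ((wcomp T j v i x)\<^sup>2) \<le> Hdens M T s v x" .
    qed
    then show "(\<integral>\<^sup>+x. ennreal ((wcomp T j v i x)\<^sup>2) \<partial>mu 0 T) < \<infinity>" using fin int by (simp add: order.strict_trans1)
  qed
  show "sob_fam 0 T M (s - 1) (\<lambda>j i. wcomp T (Suc j) v i) (Hdens M T s v)"
    unfolding sob_fam_def k fr
  proof (intro conjI allI impI)
    show "chain 0 T (k - 1) (\<lambda>j. wcomp T (Suc j) v i)" if "i < M" for i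
      using k1 that
      by (intro weak_deriv_chain[where m = 1 and u = "\<lambda>x. v x $ i"] T L) (auto intro!: wd' simp: k_def)
    show "AE x in mu 0 T. ennreal (\<Sum>i<M. (wcomp T (Suc j) v i x)\<^sup>2) \<le> Hdens M T s v x" if "j \<le> k - 1" for j
      using that k1 by (intro AE_I2 dens) simp
    show "Hdens M T s v \<in> borel_measurable (mu 0 T)" by (rule Hdens_measurable[OF meas])
    assume frac: "frac s \<noteq> 0"
    have Sk: "Suc (k - 1) = k" using k1 by simp
    show "mod_bound 0 T M (\<lambda>i. wcomp T (Suc (k - 1)) v i) (frac s) (Hdens M T s v)"
      unfolding mod_bound_def Sk
    proof (intro allI impI AE_I2)
      fix c d \<rho> x :: real
      assume cd: "0 \<le> c" "c < d" "d \<le> T" and \<rho>: "\<rho> > 0" and x: "x \<in> space (mu 0 T)"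
        and near: "\<forall>y\<in>{c<..<d}. \<bar>x - y\<bar> \<le> \<rho>"
      let ?Q = "\<lambda>y. (\<Sum>i<M. (wcomp T k v i x - wcomp T k v i y)\<^sup>2)"
      let ?p = "1 + 2 * frac s"
      have p: "?p \<ge> 0" using frac_ge_0[of s] by simp
      have wk: "wcomp T k v i \<in> borel_measurable (mu 0 T)" if "i < M" for i
        using meas[OF that] by (simp add: k_def)
      have qm: "(\<lambda>y. ennreal (?Q y / \<bar>x - y\<bar> powr ?p)) \<in> borel_measurable (mu c d)"
      proof (rule measurable_mu_subset[OF _ cd(1,3)])
        have "(\<lambda>y. (\<lambda>(x, y). ennreal ((\<Sum>i<M. (wcomp T k v i x - wcomp T k v i y)\<^sup>2) / \<bar>x - y\<bar> powr ?p)) (x, y)) \<in> borel_measurable (mu 0 T)"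
          by (rule measurable_compose[OF measurable_Pair1'[OF x] quotient_pair_measurable[OF wk]])
        then show "(\<lambda>y. ennreal (?Q y / \<bar>x - y\<bar> powr ?p)) \<in> borel_measurable (mu 0 T)" by simp
      qed
      have "(\<integral>\<^sup>+y. ennreal (?Q y) \<partial>mu c d) \<le> (\<integral>\<^sup>+y. ennreal (\<rho> powr ?p) * ennreal (?Q y / \<bar>x - y\<bar> powr ?p) \<partial>mu c d)"
      proof (rule nn_integral_mono)
        fix y assume "y \<in> space (mu c d)"
        then have le: "\<bar>x - y\<bar> \<le> \<rho>" using near by auto
        have "?Q y \<le> \<rho> powr ?p * (?Q y / \<bar>x - y\<bar> powr ?p)"
        proof (cases "x = y")
          case False
          then have "?Q y * \<bar>x - y\<bar> powr ?p \<le> ?Q y * \<rho> powr ?p"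
            using le p by (intro mult_left_mono powr_mono2 sum_nonneg) auto
          then show ?thesis using False by (simp add: field_simps)
        qed simp
        then show "ennreal (?Q y) \<le> ennreal (\<rho> powr ?p) * ennreal (?Q y / \<bar>x - y\<bar> powr ?p)"
          by (simp add: ennreal_mult[symmetric] sum_nonneg ennreal_leI)
      qed
      also have "\<dots> = ennreal (\<rho> powr ?p) * (\<integral>\<^sup>+y. ennreal (?Q y / \<bar>x - y\<bar> powr ?p) \<partial>mu c d)"
        by (rule nn_integral_cmult[OF qm])
      also have "\<dots> \<le> ennreal (\<rho> powr ?p) * Hdens M T s v x"
      proof (intro mult_left_mono)
        have "(\<integral>\<^sup>+y. ennreal (?Q y / \<bar>x - y\<bar> powr ?p) \<partial>mu c d) \<le> (\<integral>\<^sup>+y. ennreal (?Q y / \<bar>x - y\<bar> powr ?p) \<partial>mu 0 T)"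
          by (rule nn_integral_mu_subset[OF cd(1,3)])
        also have "\<dots> \<le> Hdens M T s v x" using frac by (simp add: Hdens_def k_def del: frac_eq_0_iff)
        finally show "(\<integral>\<^sup>+y. ennreal (?Q y / \<bar>x - y\<bar> powr ?p) \<partial>mu c d) \<le> Hdens M T s v x" .
      qed simp
      finally show "(\<integral>\<^sup>+y. ennreal (?Q y) \<partial>mu c d) \<le> ennreal (\<rho> powr ?p) * Hdens M T s v x" .
    qed
  qed
qed

section \<open>Families from essentially bounded derivatives\<close>

lemma emeasure_mu_pos: "a < b \<Longrightarrow> \<not> (AE x in mu a b. False)"
proof -
  assume ab: "a < b"
  have "{x \<in> space (mu a b). \<not> False} = {a<..<b}" by auto
  moreover have "{a<..<b} \<in> sets (mu a b)" using sets.top[of "mu a b"] by simp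
  ultimately have "(AE x in mu a b. False) = (emeasure (mu a b) {a<..<b} = 0)"
    by (intro AE_iff_measurable)
  then show ?thesis using ab by (simp add: emeasure_restrict_space)
qed

lemma Winf_AE:
  assumes Y: "Y \<in> Winf_space M 0 T (1 + s)" and s: "s \<ge> 1" and T: "T > 0"
  defines "W \<equiv> Winf_norm M 0 T (s + 1) Y"
  shows "W \<ge> 0"
    and "\<And>j. j \<le> nat \<lfloor>s\<rfloor> + 1 \<Longrightarrow> AE x in mu 0 T. (\<Sum>i<M. (wcomp T j Y i x)\<^sup>2) \<le> W\<^sup>2"
    and "frac s \<noteq> 0 \<Longrightarrow> AE x in mu 0 T. AE y in mu 0 T.
      (\<Sum>i<M. (wcomp T (nat \<lfloor>s\<rfloor> + 1) Y i x - wcomp T (nat \<lfloor>s\<rfloor> + 1) Y i y)\<^sup>2) \<le> W\<^sup>2 * \<bar>x - y\<bar> powr (2 * frac s)"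
proof -
  define E where "E = Winf_enorm M 0 T (1 + s) Y"
  have k: "nat \<lfloor>1 + s\<rfloor> = nat \<lfloor>s\<rfloor> + 1" using s by (simp add: nat_add_distrib)
  have fr: "frac (1 + s) = frac s" by (simp add: frac_def)
  have E: "E < \<infinity>" using Y by (simp add: Winf_space_def E_def)
  have W: "W = real_of_ereal E" by (simp add: W_def E_def Winf_norm_def add.commute)
  have bound: "AE x in mu 0 T. ereal (vnorm (vderiv M 0 T j Y x)) \<le> E" if j: "j \<le> nat \<lfloor>s\<rfloor> + 1" for j
  proof -
    have "esssup (mu 0 T) (\<lambda>x. ereal (vnorm (vderiv M 0 T j Y x))) \<le> E"
      unfolding E_def Winf_enorm_def k using j by (intro max.coboundedI1 Max_ge) auto
    then show ?thesis
      using esssup_AE[of "\<lambda>x. ereal (vnorm (vderiv M 0 T j Y x))" "mu 0 T"] by (auto elim!: eventually_mono intro: order_trans)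
  qed
  \<comment> \<open>\<open>real_of_ereal\<close> identifies infinite values with 0, so minus
    infinity must be excluded. A negative bound would be violated by the norm everywhere on an
    interval of positive length.\<close>
  have "E \<ge> 0"
  proof (rule ccontr)
    assume "\<not> E \<ge> 0"
    have "AE x in mu 0 T. False"
      using bound[OF le0]
    proof (rule AE_mp, intro AE_I2 impI)
      fix x assume "ereal (vnorm (vderiv M 0 T 0 Y x)) \<le> E"
      then have "0 \<le> E" using vnorm_nonneg by (meson ereal_less_eq(5) order_trans)
      then show False using \<open>\<not> E \<ge> 0\<close> by simp
    qed
    then show False using emeasure_mu_pos[OF T] by simp
  qed
  then have EW: "E = ereal W" and W0: "W \<ge> 0" using E W by (cases E; simp)+
  show "W \<ge> 0" by (rule W0)
  show "AE x in mu 0 T. (\<Sum>i<M. (wcomp T j Y i x)\<^sup>2) \<le> W\<^sup>2" if "j \<le> nat \<lfloor>s\<rfloor> + 1" for j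
    using bound[OF that]
  proof (rule AE_mp, intro AE_I2 impI)
    fix x assume "ereal (vnorm (vderiv M 0 T j Y x)) \<le> E"
    then have "vnorm (vderiv M 0 T j Y x) \<le> W" by (simp add: EW)
    then have "(vnorm (vderiv M 0 T j Y x))\<^sup>2 \<le> W\<^sup>2" by (intro power_mono vnorm_nonneg)
    then show "(\<Sum>i<M. (wcomp T j Y i x)\<^sup>2) \<le> W\<^sup>2" by (simp add: vnorm_vderiv_sq)
  qed
  assume frac: "frac s \<noteq> 0"
  let ?k = "nat \<lfloor>s\<rfloor> + 1"
  let ?q = "\<lambda>(x, y). ereal (vnorm (vderiv M 0 T ?k Y x - vderiv M 0 T ?k Y y) / \<bar>x - y\<bar> powr frac s)"
  have "esssup (mu 0 T \<Otimes>\<^sub>M mu 0 T) ?q \<le> E"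
    unfolding E_def Winf_enorm_def k fr using frac by (simp del: frac_eq_0_iff)
  then have "AE z in mu 0 T \<Otimes>\<^sub>M mu 0 T. ?q z \<le> ereal W"
    using esssup_AE[of ?q "mu 0 T \<Otimes>\<^sub>M mu 0 T"] unfolding EW by (auto elim!: eventually_mono intro: order_trans)
  then have "AE x in mu 0 T. AE y in mu 0 T. ?q (x, y) \<le> ereal W"
    by (rule pair_sigma_finite.AE_pair[OF pair_sigma_finite.intro[OF sigma_finite_mu sigma_finite_mu]])
  then show "AE x in mu 0 T. AE y in mu 0 T.
      (\<Sum>i<M. (wcomp T ?k Y i x - wcomp T ?k Y i y)\<^sup>2) \<le> W\<^sup>2 * \<bar>x - y\<bar> powr (2 * frac s)"
  proof eventually_elim
    case (elim x)
    then show ?case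
    proof eventually_elim
      case (elim y)
      then have q: "vnorm (vderiv M 0 T ?k Y x - vderiv M 0 T ?k Y y) / \<bar>x - y\<bar> powr frac s \<le> W" by simp
      have "vnorm (vderiv M 0 T ?k Y x - vderiv M 0 T ?k Y y) \<le> W * \<bar>x - y\<bar> powr frac s"
      proof (cases "x = y")
        case True
        then show ?thesis by (simp add: vnorm_def vderiv_def scalar_prod_def)
      next
        case False
        then show ?thesis using q by (simp add: field_simps)
      qed
      then have "(vnorm (vderiv M 0 T ?k Y x - vderiv M 0 T ?k Y y))\<^sup>2 \<le> (W * \<bar>x - y\<bar> powr frac s)\<^sup>2"
        by (intro power_mono vnorm_nonneg)
      then show ?case
        by (simp add: vnorm_vderiv_diff_sq power_mult_distrib powr_sq)
    qed
  qed
qed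

lemma Winf_L2:
  assumes Y: "Y \<in> Winf_space M 0 T (1 + s)" and s: "s \<ge> 1" and T: "T > 0" and ij: "i < M" "j \<le> nat \<lfloor>s\<rfloor> + 1"
  shows "weak_deriv 0 T j (\<lambda>x. Y x $ i) (wcomp T j Y i)" "L2 0 T (wcomp T j Y i)"
    and "AE x in mu 0 T. \<bar>wcomp T j Y i x\<bar> \<le> Winf_norm M 0 T (s + 1) Y"
proof -
  let ?W = "Winf_norm M 0 T (s + 1) Y"
  have k: "nat \<lfloor>1 + s\<rfloor> = nat \<lfloor>s\<rfloor> + 1" using s by (simp add: nat_add_distrib)
  have "weakly_differentiable M 0 T (nat \<lfloor>s\<rfloor> + 1) Y" using Y unfolding Winf_space_def k by blast
  then show wd: "weak_deriv 0 T j (\<lambda>x. Y x $ i) (wcomp T j Y i)"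
    using ij by (rule weakly_differentiable_wcomp)
  show b: "AE x in mu 0 T. \<bar>wcomp T j Y i x\<bar> \<le> ?W"
    using Winf_AE(2)[OF Y s T ij(2)]
  proof (rule AE_mp, intro AE_I2 impI)
    fix x assume "(\<Sum>i<M. (wcomp T j Y i x)\<^sup>2) \<le> ?W\<^sup>2"
    moreover have "(wcomp T j Y i x)\<^sup>2 \<le> (\<Sum>i<M. (wcomp T j Y i x)\<^sup>2)"
      using ij(1) by (intro member_le_sum) auto
    ultimately have "(wcomp T j Y i x)\<^sup>2 \<le> ?W\<^sup>2" by linarith
    then show "\<bar>wcomp T j Y i x\<bar> \<le> ?W" using Winf_AE(1)[OF Y s T] by (simp add: abs_le_square_iff[symmetric])
  qed
  have m: "wcomp T j Y i \<in> borel_measurable (mu 0 T)" by (rule weak_deriv_measurable[OF wd])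
  show "L2 0 T (wcomp T j Y i)"
  proof (rule L2_if_nn_integral_finite[OF m])
    have "(\<integral>\<^sup>+x. ennreal ((wcomp T j Y i x)\<^sup>2) \<partial>mu 0 T) \<le> (\<integral>\<^sup>+x. ennreal (?W\<^sup>2) \<partial>mu 0 T)"
    proof (rule nn_integral_mono_AE, use b in eventually_elim)
      case (elim x)
      then have "\<bar>wcomp T j Y i x\<bar>\<^sup>2 \<le> ?W\<^sup>2" by (intro power_mono) auto
      then show ?case by (intro ennreal_leI) simp
    qed
    also have "\<dots> < \<infinity>" using T by (simp add: emeasure_restrict_space ennreal_mult_less_top)
    finally show "(\<integral>\<^sup>+x. ennreal ((wcomp T j Y i x)\<^sup>2) \<partial>mu 0 T) < \<infinity>" .
  qed
qed

text \<open>Two families for two purposes. The second derivative with the full fractional order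
  serves the bound on D Y'. The first derivative serves the projection error of Y' in the maximum
  norm; rounding its order down to \<open>nat \<lfloor>s\<rfloor>\<close> is affordable there, since
  order \<open>s - 1\<close> would already do.\<close>

lemma Winf_sob:
  assumes Y: "Y \<in> Winf_space M 0 T (1 + s)" and s: "s \<ge> 1" and T: "T > 0"
  defines "W \<equiv> Winf_norm M 0 T (s + 1) Y"
  shows "sob_fam 0 T M (s - 1) (\<lambda>j i. wcomp T (Suc (Suc j)) Y i) (\<lambda>_. ennreal (2 * W\<^sup>2))"
    and "sob_fam 0 T M (real (nat \<lfloor>s\<rfloor>)) (\<lambda>j i. wcomp T (Suc j) Y i) (\<lambda>_. ennreal (W\<^sup>2))"
proof -
  define k where "k = nat \<lfloor>s\<rfloor>"
  have k1: "k \<ge> 1" using s by (simp add: k_def le_nat_iff le_floor_iff)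
  have k: "nat \<lfloor>s - 1\<rfloor> = k - 1" by (simp add: k_def nat_diff_distrib)
  have fr: "frac (s - 1) = frac s" by (simp add: frac_def)
  note WL = Winf_L2[OF Y s T]
  have chain: "chain 0 T l (\<lambda>j. wcomp T (m + j) Y i)" if "i < M" "m + l \<le> k + 1" for i l m
    using that by (intro weak_deriv_chain[where m = m and u = "\<lambda>x. Y x $ i"] T) (auto intro!: WL simp: k_def)
  have W2: "AE x in mu 0 T. ennreal (\<Sum>i<M. (wcomp T j Y i x)\<^sup>2) \<le> ennreal (W\<^sup>2)" if "j \<le> k + 1" for j
    using Winf_AE(2)[OF Y s T, of j] that by (auto simp: k_def W_def elim!: eventually_mono intro: ennreal_leI)
  show "sob_fam 0 T M (real (nat \<lfloor>s\<rfloor>)) (\<lambda>j i. wcomp T (Suc j) Y i) (\<lambda>_. ennreal (W\<^sup>2))"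
    unfolding sob_fam_def using chain[of _ 1 k] W2 by (auto simp: k_def)
  show "sob_fam 0 T M (s - 1) (\<lambda>j i. wcomp T (Suc (Suc j)) Y i) (\<lambda>_. ennreal (2 * W\<^sup>2))"
    unfolding sob_fam_def k fr
  proof (intro conjI allI impI)
    show "chain 0 T (k - 1) (\<lambda>j. wcomp T (Suc (Suc j)) Y i)" if "i < M" for i
      using chain[OF that, of 2 "k - 1"] k1 by simp
    show "AE x in mu 0 T. ennreal (\<Sum>i<M. (wcomp T (Suc (Suc j)) Y i x)\<^sup>2) \<le> ennreal (2 * W\<^sup>2)" if "j \<le> k - 1" for j
    proof -
      have "ennreal (W\<^sup>2) \<le> ennreal (2 * W\<^sup>2)" by (rule ennreal_leI) simp
      moreover have "Suc (Suc j) \<le> k + 1" using that k1 by simp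
      ultimately show ?thesis using W2[of "Suc (Suc j)"] by (auto elim!: eventually_mono intro: order_trans)
    qed
    assume frac: "frac s \<noteq> 0"
    have Sk: "Suc (Suc (k - 1)) = nat \<lfloor>s\<rfloor> + 1" using k1 by (simp add: k_def)
    show "mod_bound 0 T M (\<lambda>i. wcomp T (Suc (Suc (k - 1))) Y i) (frac s) (\<lambda>_. ennreal (2 * W\<^sup>2))"
      unfolding mod_bound_def Sk
    proof (intro allI impI)
      fix c d \<rho> :: real
      assume cd: "0 \<le> c" "c < d" "d \<le> T" and \<rho>: "\<rho> > 0"
      let ?Q = "\<lambda>x y. (\<Sum>i<M. (wcomp T (nat \<lfloor>s\<rfloor> + 1) Y i x - wcomp T (nat \<lfloor>s\<rfloor> + 1) Y i y)\<^sup>2)"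
      show "AE x in mu 0 T. (\<forall>y\<in>{c<..<d}. \<bar>x - y\<bar> \<le> \<rho>) \<longrightarrow>
        (\<integral>\<^sup>+y. ennreal (?Q x y) \<partial>mu c d) \<le> ennreal (\<rho> powr (1 + 2 * frac s)) * ennreal (2 * W\<^sup>2)"
        using Winf_AE(3)[OF Y s T frac]
      proof (eventually_elim, intro impI)
        fix x assume ae: "AE y in mu 0 T. ?Q x y \<le> (Winf_norm M 0 T (s + 1) Y)\<^sup>2 * \<bar>x - y\<bar> powr (2 * frac s)"
          and near: "\<forall>y\<in>{c<..<d}. \<bar>x - y\<bar> \<le> \<rho>"
        have "AE y in mu c d. ?Q x y \<le> W\<^sup>2 * \<bar>x - y\<bar> powr (2 * frac s)"
          unfolding W_def by (rule AE_mu_subset[OF ae cd(1,3)])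
        then have "AE y in mu c d. ennreal (?Q x y) \<le> ennreal (W\<^sup>2 * \<rho> powr (2 * frac s))"
        proof (rule AE_mp, intro AE_I2 impI ennreal_leI)
          fix y assume "y \<in> space (mu c d)" and "?Q x y \<le> W\<^sup>2 * \<bar>x - y\<bar> powr (2 * frac s)"
          moreover from this near have "W\<^sup>2 * \<bar>x - y\<bar> powr (2 * frac s) \<le> W\<^sup>2 * \<rho> powr (2 * frac s)"
            by (intro mult_left_mono powr_mono2) (auto simp: frac_ge_0)
          ultimately show "?Q x y \<le> W\<^sup>2 * \<rho> powr (2 * frac s)" by linarith
        qed
        then have "(\<integral>\<^sup>+y. ennreal (?Q x y) \<partial>mu c d) \<le> (\<integral>\<^sup>+y. ennreal (W\<^sup>2 * \<rho> powr (2 * frac s)) \<partial>mu c d)"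
          by (rule nn_integral_mono_AE)
        also have "\<dots> = ennreal (W\<^sup>2 * \<rho> powr (2 * frac s) * (d - c))"
          using cd by (simp add: emeasure_restrict_space ennreal_mult)
        also have "\<dots> \<le> ennreal (\<rho> powr (1 + 2 * frac s) * (2 * W\<^sup>2))"
        proof (rule ennreal_leI)
          \<comment> \<open>All points of the interval are within \<open>\<rho>\<close> of
            \<open>x\<close>, which causes the factor 2 in the density. The end points do not belong
            to the interval and are reached only in the limit.\<close>
          have "d - c \<le> 2 * \<rho>"
          proof (rule field_le_epsilon)
            fix e :: real assume e: "e > 0"
            define e' where "e' = min (e / 2) ((d - c) / 3)"
            have e': "e' > 0" "2 * e' \<le> e" "2 * e' < d - c" using e cd by (auto simp: e'_def min_def field_simps)
            then have "\<bar>x - (c + e')\<bar> \<le> \<rho>" "\<bar>x - (d - e')\<bar> \<le> \<rho>" using near by auto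
            then show "d - c \<le> 2 * \<rho> + e" using e' by linarith
          qed
          then have "W\<^sup>2 * \<rho> powr (2 * frac s) * (d - c) \<le> W\<^sup>2 * \<rho> powr (2 * frac s) * (2 * \<rho>)"
            by (intro mult_left_mono) auto
          also have "\<dots> = \<rho> powr (1 + 2 * frac s) * (2 * W\<^sup>2)" using \<rho> by (simp add: powr_add)
          finally show "W\<^sup>2 * \<rho> powr (2 * frac s) * (d - c) \<le> \<rho> powr (1 + 2 * frac s) * (2 * W\<^sup>2)" .
        qed
        also have "\<dots> = ennreal (\<rho> powr (1 + 2 * frac s)) * ennreal (2 * W\<^sup>2)"
          by (simp add: ennreal_mult)
        finally show "(\<integral>\<^sup>+y. ennreal (?Q x y) \<partial>mu c d) \<le> ennreal (\<rho> powr (1 + 2 * frac s)) * ennreal (2 * W\<^sup>2)" .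
      qed
    qed
  qed auto
qed

section \<open>Finiteness of fractional norms\<close>

text \<open>One version for each side of the point at which an interval will be split. For negative
  \<open>\<beta>\<close> the integrand is singular at an end point, hence the fundamental theorem
  with derivatives in the interior only.\<close>

lemma nn_integral_powr_dist:
  assumes ab: "a < b" and \<beta>: "\<beta> > - 1"
  shows "(\<integral>\<^sup>+y. ennreal (\<bar>a - y\<bar> powr \<beta>) \<partial>mu a b) = ennreal ((b - a) powr (\<beta> + 1) / (\<beta> + 1))"
    and "(\<integral>\<^sup>+y. ennreal (\<bar>b - y\<bar> powr \<beta>) \<partial>mu a b) = ennreal ((b - a) powr (\<beta> + 1) / (\<beta> + 1))"
proof -
  have conv: "(\<integral>\<^sup>+y. ennreal (f y) \<partial>mu a b) = ennreal I"
    if "(f has_integral I) {a..b}" "\<And>y. f y \<ge> 0" for f I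
  proof -
    have "(f has_integral I) {a<..<b}" using that(1) by (simp add: has_integral_Icc_iff_Ioo)
    then have "(\<integral>\<^sup>+y\<in>{a<..<b}. ennreal (f y) \<partial>lborel) = ennreal I"
      by (intro nn_integral_has_integral_lebesgue') (auto simp: that(2))
    then show ?thesis by (simp add: nn_integral_restrict_space nn_integral_completion)
  qed
  have "((\<lambda>y. \<bar>a - y\<bar> powr \<beta>) has_integral ((b - a) powr (\<beta> + 1) / (\<beta> + 1) - (a - a) powr (\<beta> + 1) / (\<beta> + 1))) {a..b}"
  proof (rule fundamental_theorem_of_calculus_interior)
    show "continuous_on {a..b} (\<lambda>y. (y - a) powr (\<beta> + 1) / (\<beta> + 1))"
      using \<beta> by (intro continuous_intros continuous_on_powr') auto
    show "((\<lambda>y. (y - a) powr (\<beta> + 1) / (\<beta> + 1)) has_vector_derivative \<bar>a - y\<bar> powr \<beta>) (at y)" if "y \<in> {a<..<b}" for y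
      unfolding has_real_derivative_iff_has_vector_derivative[symmetric]
      using that \<beta> by (auto intro!: derivative_eq_intros)
  qed (use ab in simp)
  then show "(\<integral>\<^sup>+y. ennreal (\<bar>a - y\<bar> powr \<beta>) \<partial>mu a b) = ennreal ((b - a) powr (\<beta> + 1) / (\<beta> + 1))"
    by (intro conv) auto
  have "((\<lambda>y. \<bar>b - y\<bar> powr \<beta>) has_integral (- ((b - b) powr (\<beta> + 1) / (\<beta> + 1)) - - ((b - a) powr (\<beta> + 1) / (\<beta> + 1)))) {a..b}"
  proof (rule fundamental_theorem_of_calculus_interior)
    show "continuous_on {a..b} (\<lambda>y. - ((b - y) powr (\<beta> + 1) / (\<beta> + 1)))"
      using \<beta> by (intro continuous_intros continuous_on_powr') auto
    show "((\<lambda>y. - ((b - y) powr (\<beta> + 1) / (\<beta> + 1))) has_vector_derivative \<bar>b - y\<bar> powr \<beta>) (at y)" if "y \<in> {a<..<b}" for y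
      unfolding has_real_derivative_iff_has_vector_derivative[symmetric]
      using that \<beta> by (auto intro!: derivative_eq_intros)
  qed (use ab in simp)
  then show "(\<integral>\<^sup>+y. ennreal (\<bar>b - y\<bar> powr \<beta>) \<partial>mu a b) = ennreal ((b - a) powr (\<beta> + 1) / (\<beta> + 1))"
    by (intro conv) auto
qed

lemma nn_integral_powr_dist_le:
  assumes x: "x \<in> {0<..<T}" and \<beta>: "\<beta> > - 1"
  shows "(\<integral>\<^sup>+y. ennreal (\<bar>x - y\<bar> powr \<beta>) \<partial>mu 0 T) \<le> ennreal (2 * (T powr (\<beta> + 1) / (\<beta> + 1)))"
proof -
  have "(\<lambda>y. ennreal (\<bar>x - y\<bar> powr \<beta>)) \<in> borel_measurable (mu 0 T)"
    using id_measurable_mu[of 0 T]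
    by (intro measurable_compose[OF _ measurable_ennreal] powr_real_measurable borel_measurable_abs borel_measurable_diff) auto
  then have "(\<integral>\<^sup>+y. ennreal (\<bar>x - y\<bar> powr \<beta>) \<partial>mu 0 T) =
      (\<integral>\<^sup>+y. ennreal (\<bar>x - y\<bar> powr \<beta>) \<partial>mu 0 x) + (\<integral>\<^sup>+y. ennreal (\<bar>x - y\<bar> powr \<beta>) \<partial>mu x T)"
    using x by (intro nn_integral_mu_split) auto
  also have "\<dots> = ennreal (x powr (\<beta> + 1) / (\<beta> + 1)) + ennreal ((T - x) powr (\<beta> + 1) / (\<beta> + 1))"
    using x \<beta> by (simp add: nn_integral_powr_dist)
  also have "\<dots> \<le> ennreal (T powr (\<beta> + 1) / (\<beta> + 1)) + ennreal (T powr (\<beta> + 1) / (\<beta> + 1))"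
    using x \<beta> by (intro add_mono ennreal_leI divide_right_mono powr_mono2) auto
  also have "\<dots> = ennreal (2 * (T powr (\<beta> + 1) / (\<beta> + 1)))"
    using \<beta> by (subst ennreal_plus[symmetric]) auto
  finally show ?thesis .
qed

lemma prim_lipschitz:
  assumes z: "L2 0 T z" and B: "AE x in mu 0 T. \<bar>z x\<bar> \<le> B" and xy: "0 \<le> x" "x \<le> y" "y \<le> T"
  shows "\<bar>prim 0 z y - prim 0 z x\<bar> \<le> B * (y - x)"
proof -
  have "prim 0 z y - prim 0 z x = prim x z y"
    using prim_split[OF L2_integrable[OF z], of x y] xy by simp
  also have "\<bar>\<dots>\<bar> \<le> integral\<^sup>L (mu x y) (\<lambda>t. \<bar>z t\<bar>)"
    unfolding prim_def by (rule integral_abs_bound)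
  also have "\<dots> \<le> integral\<^sup>L (mu x y) (\<lambda>t. B)"
    using xy by (intro integral_mono_AE AE_mu_subset[OF B] integrable_abs integrable_mu_const
        L2_integrable L2_subset[OF z]) auto
  also have "\<dots> = B * (y - x)" using xy by (simp add: integral_mu_const del: Bochner_Integration.lebesgue_integral_const)
  finally show ?thesis .
qed

text \<open>The \<open>k\<close>-th derivatives are Lipschitz, hence in every fractional space of order less than one.\<close>

lemma H_norm_sq_finite:
  assumes T: "T > 0" and B: "B \<ge> 0"
    and wd: "\<And>i j. i < M \<Longrightarrow> j \<le> nat \<lfloor>s\<rfloor> + 1 \<Longrightarrow> weak_deriv 0 T j (\<lambda>x. U x $ i) (g j i)"
    and bd: "\<And>i j. i < M \<Longrightarrow> j \<le> nat \<lfloor>s\<rfloor> + 1 \<Longrightarrow> AE x in mu 0 T. \<bar>g j i x\<bar> \<le> B"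
  shows "H_norm_sq M 0 T s U < \<infinity>"
proof -
  define k where "k = nat \<lfloor>s\<rfloor>"
  let ?w = "\<lambda>j. wcomp T j U"
  have ae: "AE x in mu 0 T. ?w j i x = g j i x" if "i < M" "j \<le> k + 1" for i j
    using wd that T by (intro wderiv_eq_AE) (auto simp: k_def)
  have gm: "g j i \<in> borel_measurable (mu 0 T)" if "i < M" "j \<le> k + 1" for i j
    using wd that by (auto simp: k_def intro: weak_deriv_measurable)
  have gL: "L2 0 T (g j i)" if "i < M" "j \<le> k + 1" for i j
  proof (rule L2_cong_AE)
    \<comment> \<open>The bound holds only a.e.; truncation gives a representative that is bounded
      everywhere.\<close>
    let ?h = "\<lambda>x. max (- B) (min B (g j i x))"
    show "L2 0 T ?h"
    proof (rule L2_bounded)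
      show "?h \<in> borel_measurable (mu 0 T)" using gm[OF that] by measurable
      show "\<bar>?h x\<bar> \<le> B" for x using B by auto
    qed
    show "AE x in mu 0 T. ?h x = g j i x"
    proof -
      have "AE x in mu 0 T. \<bar>g j i x\<bar> \<le> B" using bd[of i j] that by (simp add: k_def)
      then show ?thesis by eventually_elim auto
    qed
  qed
  have const: "(\<integral>\<^sup>+x. ennreal c \<partial>mu 0 T) = ennreal (c * T)" if "c \<ge> 0" for c
    using T that by (simp add: emeasure_restrict_space ennreal_mult)
  have "(\<integral>\<^sup>+x. ennreal ((vnorm (vderiv M 0 T j U x))\<^sup>2) \<partial>mu 0 T) \<le> ennreal (real M * B\<^sup>2 * T)" if j: "j \<le> k" for j
  proof -
    have "AE x in mu 0 T. \<forall>i\<in>{..<M}. \<bar>?w j i x\<bar> \<le> B"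
    proof (rule AE_finite_allI)
      fix i assume "i \<in> {..<M}"
      then show "AE x in mu 0 T. \<bar>?w j i x\<bar> \<le> B"
        using ae[of i j] bd[of i j] j by (auto simp: k_def elim: eventually_elim2)
    qed simp
    then have "AE x in mu 0 T. ennreal ((vnorm (vderiv M 0 T j U x))\<^sup>2) \<le> ennreal (real M * B\<^sup>2)"
    proof eventually_elim
      case (elim x)
      have "(\<Sum>i<M. (?w j i x)\<^sup>2) \<le> (\<Sum>i<M. B\<^sup>2)"
      proof (rule sum_mono)
        fix i assume "i \<in> {..<M}"
        then have "\<bar>?w j i x\<bar>\<^sup>2 \<le> B\<^sup>2" using elim by (intro power_mono) auto
        then show "(?w j i x)\<^sup>2 \<le> B\<^sup>2" by simp
      qed
      then show ?case unfolding vnorm_vderiv_sq by (intro ennreal_leI) simp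
    qed
    from nn_integral_mono_AE[OF this] show ?thesis by (simp add: const del: nn_integral_const)
  qed
  then have "(\<Sum>j\<le>k. \<integral>\<^sup>+x. ennreal ((vnorm (vderiv M 0 T j U x))\<^sup>2) \<partial>mu 0 T) \<le> (\<Sum>j\<le>k. ennreal (real M * B\<^sup>2 * T))"
    by (intro sum_mono) auto
  also have "\<dots> = ennreal (\<Sum>j\<le>k. real M * B\<^sup>2 * T)" using T by (intro sum_ennreal) auto
  also have "\<dots> < \<infinity>" by simp
  finally have 1: "(\<Sum>j\<le>k. \<integral>\<^sup>+x. ennreal ((vnorm (vderiv M 0 T j U x))\<^sup>2) \<partial>mu 0 T) < \<infinity>" .
  have 2: "(if frac s = 0 then 0
      else \<integral>\<^sup>+x. \<integral>\<^sup>+y. ennreal ((vnorm (vderiv M 0 T k U x - vderiv M 0 T k U y))\<^sup>2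
                / \<bar>x - y\<bar> powr (1 + 2 * frac s)) \<partial>mu 0 T \<partial>mu 0 T) < \<infinity>"
  proof (cases "frac s = 0")
    case True
    then show ?thesis by (simp only: if_True) simp
  next
    case False
    \<comment> \<open>Lipschitz continuity supplies two powers of the distance; what remains is
      integrable because \<open>frac s < 1\<close>.\<close>
    define \<beta> where "\<beta> = 1 - 2 * frac s"
    have \<beta>: "\<beta> > - 1" using frac_lt_1[of s] by (simp add: \<beta>_def)
    define K where "K = 2 * (T powr (\<beta> + 1) / (\<beta> + 1))"
    have K: "K \<ge> 0" using \<beta> by (simp add: K_def)
    have "\<exists>c. AE x in mu 0 T. g k i x = c + prim 0 (g (k + 1) i) x" if "i < M" for i
    proof (rule weak_deriv_primitive)
      show "weak_deriv 0 T 1 (g k i) (g (k + 1) i)"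
        using wd[of i k] wd[of i "k + 1"] that T by (intro weak_deriv_step) (auto simp: k_def)
    qed (use gL that T in auto)
    then obtain c where c: "\<And>i. i < M \<Longrightarrow> AE x in mu 0 T. g k i x = c i + prim 0 (g (k + 1) i) x" by metis
    have rep: "AE x in mu 0 T. \<forall>i\<in>{..<M}. ?w k i x = c i + prim 0 (g (k + 1) i) x"
    proof (rule AE_finite_allI)
      fix i assume "i \<in> {..<M}"
      then show "AE x in mu 0 T. ?w k i x = c i + prim 0 (g (k + 1) i) x"
        using ae[of i k] c[of i] by (auto elim: eventually_elim2)
    qed simp
    have rep': "AE x in mu 0 T. x \<in> {0<..<T} \<and> (\<forall>i\<in>{..<M}. ?w k i x = c i + prim 0 (g (k + 1) i) x)"
      using rep by (rule AE_mp) (auto intro!: AE_I2)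
    have lip: "(prim 0 (g (k + 1) i) x - prim 0 (g (k + 1) i) y)\<^sup>2 \<le> B\<^sup>2 * \<bar>x - y\<bar>\<^sup>2"
      if "i < M" "x \<in> {0<..<T}" "y \<in> {0<..<T}" for i x y
    proof -
      have z: "L2 0 T (g (k + 1) i)" "AE x in mu 0 T. \<bar>g (k + 1) i x\<bar> \<le> B"
        using gL[of i "k + 1"] bd[of i "k + 1"] that(1) by (auto simp: k_def)
      have "\<bar>prim 0 (g (k + 1) i) x - prim 0 (g (k + 1) i) y\<bar> \<le> B * \<bar>x - y\<bar>"
      proof (cases "x \<le> y")
        case True
        then show ?thesis using prim_lipschitz[OF z, of x y] that by (simp add: abs_minus_commute)
      next
        case False
        then show ?thesis using prim_lipschitz[OF z, of y x] that by simp
      qed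
      then have "\<bar>prim 0 (g (k + 1) i) x - prim 0 (g (k + 1) i) y\<bar>\<^sup>2 \<le> (B * \<bar>x - y\<bar>)\<^sup>2"
        by (intro power_mono) auto
      then show ?thesis by (simp add: power_mult_distrib)
    qed
    have pt: "ennreal ((\<Sum>i<M. (?w k i x - ?w k i y)\<^sup>2) / \<bar>x - y\<bar> powr (1 + 2 * frac s))
        \<le> ennreal (real M * B\<^sup>2) * ennreal (\<bar>x - y\<bar> powr \<beta>)"
      if x: "x \<in> {0<..<T} \<and> (\<forall>i\<in>{..<M}. ?w k i x = c i + prim 0 (g (k + 1) i) x)"
        and y: "y \<in> {0<..<T} \<and> (\<forall>i\<in>{..<M}. ?w k i y = c i + prim 0 (g (k + 1) i) y)" for x y
    proof -
      have "(\<Sum>i<M. (?w k i x - ?w k i y)\<^sup>2) \<le> (\<Sum>i<M. B\<^sup>2 * \<bar>x - y\<bar>\<^sup>2)"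
      proof (rule sum_mono)
        fix i assume "i \<in> {..<M}"
        then show "(?w k i x - ?w k i y)\<^sup>2 \<le> B\<^sup>2 * \<bar>x - y\<bar>\<^sup>2" using x y lip[of i x y] by auto
      qed
      then have "(\<Sum>i<M. (?w k i x - ?w k i y)\<^sup>2) / \<bar>x - y\<bar> powr (1 + 2 * frac s)
          \<le> real M * B\<^sup>2 * (\<bar>x - y\<bar>\<^sup>2 / \<bar>x - y\<bar> powr (1 + 2 * frac s))"
        using divide_right_mono[of "\<Sum>i<M. (?w k i x - ?w k i y)\<^sup>2" "\<Sum>i<M. B\<^sup>2 * \<bar>x - y\<bar>\<^sup>2" "\<bar>x - y\<bar> powr (1 + 2 * frac s)"]
        by simp
      also have "\<bar>x - y\<bar>\<^sup>2 / \<bar>x - y\<bar> powr (1 + 2 * frac s) = \<bar>x - y\<bar> powr \<beta>"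
      proof (cases "x = y")
        case False
        then have "\<bar>x - y\<bar>\<^sup>2 = \<bar>x - y\<bar> powr 2" by (simp add: powr_numeral)
        moreover have "\<beta> = 2 - (1 + 2 * frac s)" by (simp add: \<beta>_def)
        ultimately show ?thesis by (simp only: powr_diff)
      qed simp
      finally show ?thesis by (simp add: ennreal_mult[symmetric] ennreal_leI)
    qed
    have "AE x in mu 0 T. (\<integral>\<^sup>+y. ennreal ((\<Sum>i<M. (?w k i x - ?w k i y)\<^sup>2) / \<bar>x - y\<bar> powr (1 + 2 * frac s)) \<partial>mu 0 T)
        \<le> ennreal (real M * B\<^sup>2 * K)"
      using rep'
    proof eventually_elim
      case (elim x)
      have "(\<integral>\<^sup>+y. ennreal ((\<Sum>i<M. (?w k i x - ?w k i y)\<^sup>2) / \<bar>x - y\<bar> powr (1 + 2 * frac s)) \<partial>mu 0 T)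
          \<le> (\<integral>\<^sup>+y. ennreal (real M * B\<^sup>2) * ennreal (\<bar>x - y\<bar> powr \<beta>) \<partial>mu 0 T)"
      proof (rule nn_integral_mono_AE)
        show "AE y in mu 0 T. ennreal ((\<Sum>i<M. (?w k i x - ?w k i y)\<^sup>2) / \<bar>x - y\<bar> powr (1 + 2 * frac s))
            \<le> ennreal (real M * B\<^sup>2) * ennreal (\<bar>x - y\<bar> powr \<beta>)"
          using rep' by eventually_elim (rule pt[OF elim])
      qed
      also have "\<dots> = ennreal (real M * B\<^sup>2) * (\<integral>\<^sup>+y. ennreal (\<bar>x - y\<bar> powr \<beta>) \<partial>mu 0 T)"
        using id_measurable_mu[of 0 T]
        by (intro nn_integral_cmult measurable_compose[OF _ measurable_ennreal] powr_real_measurable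
            borel_measurable_abs borel_measurable_diff) auto
      also have "\<dots> \<le> ennreal (real M * B\<^sup>2) * ennreal K"
        unfolding K_def using elim by (intro mult_left_mono nn_integral_powr_dist_le \<beta>) auto
      finally show ?case using K by (simp add: ennreal_mult[symmetric])
    qed
    from nn_integral_mono_AE[OF this]
    have "(\<integral>\<^sup>+x. \<integral>\<^sup>+y. ennreal ((\<Sum>i<M. (?w k i x - ?w k i y)\<^sup>2) / \<bar>x - y\<bar> powr (1 + 2 * frac s)) \<partial>mu 0 T \<partial>mu 0 T)
        \<le> ennreal (real M * B\<^sup>2 * K * T)"
      using K by (simp add: const del: nn_integral_const)
    also have "\<dots> < \<infinity>" by simp
    finally show ?thesis unfolding if_not_P[OF False] vnorm_vderiv_diff_sq .
  qed
  show ?thesis unfolding H_norm_sq_def k_def[symmetric] using 1 2 by (simp add: ennreal_add_less_top del: frac_eq_0_iff)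
qed

section \<open>From vectors and matrices to components\<close>

lemma scalar_prod_sum: "dim_vec w = M \<Longrightarrow> v \<bullet> w = (\<Sum>i<M. v $ i * w $ i)"
  by (simp add: scalar_prod_def lessThan_atLeast0)

lemma veval_index: "p \<in> carrier_vec M \<Longrightarrow> i < M \<Longrightarrow> veval p x $ i = poly (p $ i) x"
  by (simp add: veval_def)

text \<open>Existence is given by the scalar projections, uniqueness by testing with vectors that
  have a single nonzero entry. Degree at most \<open>r - 1\<close> is \<open>plt r\<close> because
  \<open>r \<ge> 1\<close>.\<close>

lemma L2_proj_eq:
  assumes ab: "a < b" and v: "\<And>x. x \<in> {a<..<b} \<Longrightarrow> v x \<in> carrier_vec M"
    and L: "\<And>i. i < M \<Longrightarrow> L2 a b (\<lambda>x. v x $ i)" and r: "r \<ge> 1"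
  shows "L2_proj M (r - 1) a b v = Matrix.vec M (\<lambda>i. pr a b r (\<lambda>x. v x $ i))"
proof -
  let ?v = "\<lambda>i x. v x $ i"
  have deg: "degree p \<le> r - 1 \<longleftrightarrow> plt r p" for p using plt_degree[of "r - 1" p] r by simp
  have vp: "p \<in> vpolys M (r - 1) \<longleftrightarrow> p \<in> carrier_vec M \<and> (\<forall>i<M. plt r (p $ i))" for p
    by (auto simp: vpolys_def deg simp del: One_nat_def)
  have int1: "(LINT x:{a<..<b}|lebesgue. veval p x \<bullet> veval w x) = (\<Sum>i<M. ip a b (poly (p $ i)) (poly (w $ i)))"
    if "p \<in> carrier_vec M" "w \<in> carrier_vec M" for p w
  proof -
    have "(LINT x:{a<..<b}|lebesgue. veval p x \<bullet> veval w x) = integral\<^sup>L (mu a b) (\<lambda>x. \<Sum>i<M. poly (p $ i) x * poly (w $ i) x)"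
      unfolding set_integral_mu using that
      by (intro Bochner_Integration.integral_cong) (auto simp: scalar_prod_sum[of _ M] veval_index veval_def)
    also have "\<dots> = (\<Sum>i<M. ip a b (poly (p $ i)) (poly (w $ i)))"
      unfolding ip_def by (intro Bochner_Integration.integral_sum L2_mult_integrable L2_poly)
    finally show ?thesis .
  qed
  have int2: "(LINT x:{a<..<b}|lebesgue. v x \<bullet> veval w x) = (\<Sum>i<M. ip a b (?v i) (poly (w $ i)))"
    if "w \<in> carrier_vec M" for w
  proof -
    have "(LINT x:{a<..<b}|lebesgue. v x \<bullet> veval w x) = integral\<^sup>L (mu a b) (\<lambda>x. \<Sum>i<M. ?v i x * poly (w $ i) x)"
      unfolding set_integral_mu using that v
      by (intro Bochner_Integration.integral_cong) (auto simp: scalar_prod_sum[of _ M] veval_index veval_def)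
    also have "\<dots> = (\<Sum>i<M. ip a b (?v i) (poly (w $ i)))"
      unfolding ip_def by (intro Bochner_Integration.integral_sum L2_mult_integrable L2_poly L) auto
    finally show ?thesis .
  qed
  show ?thesis
    unfolding L2_proj_def
  proof (rule the_equality, intro conjI ballI)
    show "Matrix.vec M (\<lambda>i. pr a b r (?v i)) \<in> vpolys M (r - 1)"
      unfolding vp by (auto intro!: pr_plt L)
    fix w assume "w \<in> vpolys M (r - 1)"
    then have w: "w \<in> carrier_vec M" "\<And>i. i < M \<Longrightarrow> plt r (w $ i)" by (auto simp: vp simp del: One_nat_def)
    show "(LINT x:{a<..<b}|lebesgue. veval (Matrix.vec M (\<lambda>i. pr a b r (?v i))) x \<bullet> veval w x) =
        (LINT x:{a<..<b}|lebesgue. v x \<bullet> veval w x)"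
      using w by (simp add: int1 int2 pr_ip L)
  next
    fix p assume p: "p \<in> vpolys M (r - 1) \<and> (\<forall>w\<in>vpolys M (r - 1).
      (LINT x:{a<..<b}|lebesgue. veval p x \<bullet> veval w x) = (LINT x:{a<..<b}|lebesgue. v x \<bullet> veval w x))"
    then have pc: "p \<in> carrier_vec M" and pp: "\<And>i. i < M \<Longrightarrow> plt r (p $ i)" by (auto simp: vp simp del: One_nat_def)
    have "pr a b r (?v i) = p $ i" if i: "i < M" for i
    proof (rule pr_unique[OF ab L[OF i] pp[OF i]])
      fix q assume q: "plt r q"
      define w where "w = Matrix.vec M (\<lambda>j. if j = i then q else 0)"
      have w: "w \<in> vpolys M (r - 1)" "w \<in> carrier_vec M" using q by (auto simp: vp w_def plt_0 simp del: One_nat_def)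
      have sum: "(\<Sum>j<M. ip a b (f j) (poly (w $ j))) = ip a b (f i) (poly q)" for f
      proof -
        have "(\<Sum>j<M. ip a b (f j) (poly (w $ j))) = (\<Sum>j<M. if j = i then ip a b (f i) (poly q) else 0)"
          by (intro sum.cong) (auto simp: w_def ip_def)
        then show ?thesis using i by simp
      qed
      from p w(1) have "(LINT x:{a<..<b}|lebesgue. veval p x \<bullet> veval w x) = (LINT x:{a<..<b}|lebesgue. v x \<bullet> veval w x)"
        by blast
      then show "ip a b (poly (p $ i)) (poly q) = ip a b (?v i) (poly q)"
        unfolding int1[OF pc w(2)] int2[OF w(2)] sum .
    qed
    then show "p = Matrix.vec M (\<lambda>i. pr a b r (?v i))" using pc by (intro eq_vecI) auto
  qed
qed

text \<open>The form of \<open>D + D\<^sup>T\<close> is twice that of \<open>D\<close>, by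
  exchanging the summation indices in the transposed part.\<close>

lemma neg_semidef_sum:
  assumes D: "D \<in> carrier_mat M M" and neg: "neg_semidef M (D + D\<^sup>T)"
  shows "(\<Sum>i<M. \<Sum>j<M. v i * D $$ (i, j) * v j) \<le> 0"
proof -
  let ?x = "Matrix.vec M v"
  have "?x \<bullet> ((D + D\<^sup>T) *\<^sub>v ?x) = (\<Sum>i<M. \<Sum>j<M. v i * ((D $$ (i, j) + D $$ (j, i)) * v j))"
    using D by (simp add: scalar_prod_sum[of _ M] sum_distrib_left cong: sum.cong)
      (auto intro!: sum.cong simp: scalar_prod_def lessThan_atLeast0 sum_distrib_left)
  also have "\<dots> = (\<Sum>i<M. \<Sum>j<M. v i * D $$ (i, j) * v j) + (\<Sum>i<M. \<Sum>j<M. v j * D $$ (j, i) * v i)"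
    by (simp add: sum.distrib[symmetric] algebra_simps)
  also have "(\<Sum>i<M. \<Sum>j<M. v j * D $$ (j, i) * v i) = (\<Sum>i<M. \<Sum>j<M. v i * D $$ (i, j) * v j)"
    by (rule sum.swap)
  finally have "?x \<bullet> ((D + D\<^sup>T) *\<^sub>v ?x) = 2 * (\<Sum>i<M. \<Sum>j<M. v i * D $$ (i, j) * v j)" by simp
  moreover have "?x \<bullet> ((D + D\<^sup>T) *\<^sub>v ?x) \<le> 0" using neg by (simp add: neg_semidef_def)
  ultimately show ?thesis by simp
qed

text \<open>The factor \<open>h / r\<close> from integrating once raises the exponents
  \<open>min (real r) (s - 1)\<close> and \<open>s - 1\<close> by one. With the mesh size in place
  of \<open>h\<close> the constant is common to all intervals, and the integrals of the density add
  up.\<close>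

lemma sob_global:
  assumes part: "is_partition T N t" and T: "T > 0" and r: "r \<ge> 1" and s: "s \<ge> 1"
    and sob: "sob_fam 0 T M (s - 1) g S" and A: "(\<integral>\<^sup>+x. S x \<partial>mu 0 T) \<le> ennreal A" "A \<ge> 0"
  shows "(\<Sum>n<N. ((t (Suc n) - t n) / r)\<^sup>2 * (\<Sum>i<M. err (t n) (t (Suc n)) r (g 0 i)))
    \<le> hp_const (s - 1) * (mesh_size N t powr min (real r + 1) s / real r powr s)\<^sup>2 * A"
proof -
  have t0: "t 0 = 0" and tN: "t N = T" and t_less: "\<And>n. n < N \<Longrightarrow> t n < t (Suc n)"
    using part by (auto simp: is_partition_def)
  have t_mono: "t m \<le> t n" if "m \<le> n" "n \<le> N" for m n
    using that by (induction n) (force simp: le_Suc_eq intro: order_trans[OF _ less_imp_le[OF t_less]])+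
  have tr: "0 \<le> t n" "t n \<le> T" if "n \<le> N" for n
    using t_mono[of 0 n] t_mono[of n N] that t0 tN by auto
  define \<tau> where "\<tau> = mesh_size N t"
  define K where "K = \<tau> powr min (real r + 1) s / real r powr s"
  have h\<tau>: "t (Suc n) - t n \<le> \<tau>" if "n < N" for n
    unfolding \<tau>_def mesh_size_def using that by (intro Max_ge) auto
  have hp: "hp_const (s - 1) \<ge> 0" by (simp add: hp_const_def)
  have "ennreal (((t (Suc n) - t n) / r)\<^sup>2 * (\<Sum>i<M. err (t n) (t (Suc n)) r (g 0 i)))
      \<le> ennreal (hp_const (s - 1) * K\<^sup>2) * (\<integral>\<^sup>+x. S x \<partial>mu (t n) (t (Suc n)))" if n: "n < N" for n
  proof -
    define h where "h = t (Suc n) - t n"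
    have h: "h > 0" using t_less[OF n] by (simp add: h_def)
    let ?P = "(h powr min (real r) (s - 1) / real r powr (s - 1))\<^sup>2"
    have "sob_fam (t n) (t (Suc n)) M (s - 1) g S"
      using n tr[of n] tr[of "Suc n"] by (intro sob_fam_subset[OF sob]) auto
    from sob_fam_err[OF t_less[OF n] r _ this] s
    have "ennreal (\<Sum>i<M. err (t n) (t (Suc n)) r (g 0 i)) \<le> ennreal (hp_const (s - 1) * ?P) * (\<integral>\<^sup>+x. S x \<partial>mu (t n) (t (Suc n)))"
      by (simp add: h_def)
    then have "ennreal ((h / r)\<^sup>2) * ennreal (\<Sum>i<M. err (t n) (t (Suc n)) r (g 0 i))
        \<le> ennreal ((h / r)\<^sup>2) * (ennreal (hp_const (s - 1) * ?P) * (\<integral>\<^sup>+x. S x \<partial>mu (t n) (t (Suc n))))"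
      by (rule mult_left_mono) simp
    also have "\<dots> = ennreal (hp_const (s - 1) * ((h / r)\<^sup>2 * ?P)) * (\<integral>\<^sup>+x. S x \<partial>mu (t n) (t (Suc n)))"
    proof -
      have "ennreal (hp_const (s - 1) * ((h / r)\<^sup>2 * ?P)) = ennreal ((h / r)\<^sup>2 * (hp_const (s - 1) * ?P))"
        by (simp only: mult.left_commute)
      also have "\<dots> = ennreal ((h / r)\<^sup>2) * ennreal (hp_const (s - 1) * ?P)"
        using hp by (intro ennreal_mult mult_nonneg_nonneg) auto
      finally show ?thesis by (simp only: mult.assoc)
    qed
    also have "\<dots> \<le> ennreal (hp_const (s - 1) * K\<^sup>2) * (\<integral>\<^sup>+x. S x \<partial>mu (t n) (t (Suc n)))"
    proof (intro mult_right_mono ennreal_leI mult_left_mono hp)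
      have "(h / r)\<^sup>2 * ?P = (h / r * (h powr min (real r) (s - 1) / real r powr (s - 1)))\<^sup>2"
        by (simp only: power_mult_distrib)
      also have "h / r * (h powr min (real r) (s - 1) / real r powr (s - 1)) = h powr (1 + min (real r) (s - 1)) / real r powr (1 + (s - 1))"
      proof -
        have "h powr (1 + min (real r) (s - 1)) = h * h powr min (real r) (s - 1)"
          and "real r powr (1 + (s - 1)) = real r * real r powr (s - 1)"
          by (subst powr_add, use h r in simp)+
        then show ?thesis by (simp only: times_divide_times_eq)
      qed
      also have "1 + min (real r) (s - 1) = min (real r + 1) s" by (simp add: min_def)
      also have "1 + (s - 1) = s" by simp
      also have "(h powr min (real r + 1) s / real r powr s)\<^sup>2 \<le> K\<^sup>2"
        unfolding K_def using h h\<tau>[OF n] s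
        by (intro power_mono divide_right_mono powr_mono2) (auto simp: h_def)
      finally show "(h / r)\<^sup>2 * ?P \<le> K\<^sup>2" .
    qed simp
    finally show ?thesis by (simp add: h_def ennreal_mult sum_nonneg err_nonneg)
  qed
  then have "(\<Sum>n<N. ennreal (((t (Suc n) - t n) / r)\<^sup>2 * (\<Sum>i<M. err (t n) (t (Suc n)) r (g 0 i))))
      \<le> (\<Sum>n<N. ennreal (hp_const (s - 1) * K\<^sup>2) * (\<integral>\<^sup>+x. S x \<partial>mu (t n) (t (Suc n))))"
    by (intro sum_mono) auto
  also have "\<dots> = ennreal (hp_const (s - 1) * K\<^sup>2) * (\<integral>\<^sup>+x. S x \<partial>mu 0 T)"
    unfolding sum_distrib_left[symmetric] t0[symmetric] tN[symmetric]
    using sob t_less by (subst nn_integral_mu_partition) (auto simp: sob_fam_def t0 tN intro: less_imp_le)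
  also have "\<dots> \<le> ennreal (hp_const (s - 1) * K\<^sup>2) * ennreal A"
    by (intro mult_left_mono A) simp
  also have "\<dots> = ennreal (hp_const (s - 1) * K\<^sup>2 * A)" using hp A by (simp add: ennreal_mult)
  also have "(\<Sum>n<N. ennreal (((t (Suc n) - t n) / r)\<^sup>2 * (\<Sum>i<M. err (t n) (t (Suc n)) r (g 0 i)))) =
      ennreal (\<Sum>n<N. ((t (Suc n) - t n) / r)\<^sup>2 * (\<Sum>i<M. err (t n) (t (Suc n)) r (g 0 i)))"
    by (intro sum_ennreal mult_nonneg_nonneg sum_nonneg err_nonneg) auto
  finally show ?thesis
    using hp A by (simp add: K_def \<tau>_def ennreal_le_iff)
qed

section \<open>The error estimates\<close>

text \<open>Outside the interval the vector functions are arbitrary, even in dimension, so matrix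
  and component expressions need agree only inside.\<close>

lemma weak_deriv_cong:
  assumes "weak_deriv a b k u v" "\<And>x. x \<in> {a<..<b} \<Longrightarrow> u x = u' x" "\<And>x. x \<in> {a<..<b} \<Longrightarrow> v x = v' x"
  shows "weak_deriv a b k u' v'"
proof -
  have loc: "locally_integrable a b f'" if "locally_integrable a b f" "\<And>x. x \<in> {a<..<b} \<Longrightarrow> f x = f' x" for f f'
    unfolding locally_integrable_def
  proof (intro allI impI)
    fix c d assume cd: "a < c" "d < b"
    have "set_integrable lebesgue {c..d} f \<longleftrightarrow> set_integrable lebesgue {c..d} f'"
      unfolding set_integrable_def using cd that(2)
      by (intro Bochner_Integration.integrable_cong) (auto split: split_indicator)
    then show "set_integrable lebesgue {c..d} f'" using that(1) cd by (simp add: locally_integrable_def)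
  qed
  have int: "integral\<^sup>L (mu a b) (\<lambda>x. f x * \<phi> x) = integral\<^sup>L (mu a b) (\<lambda>x. f' x * \<phi> x)"
    if "\<And>x. x \<in> {a<..<b} \<Longrightarrow> f x = f' x" for f f' \<phi> :: "real \<Rightarrow> real"
    using that by (intro Bochner_Integration.integral_cong) auto
  show ?thesis
    using assms(1) loc[of u u', OF _ assms(2)] loc[of v v', OF _ assms(3)]
      int[of u u', OF assms(2)] int[of v v', OF assms(3)]
    unfolding weak_deriv_mu by simp
qed

lemma err_minus_le:
  assumes "L2 a b f"
  shows "err a b n (\<lambda>x. - f x) \<le> err a b n f"
proof -
  have "err a b n (\<lambda>x. - f x) \<le> nsq a b (\<lambda>x. - f x - poly (Polynomial.smult (- 1) (pr a b n f)) x)"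
    by (intro err_le L2_minus assms plt_smult pr_plt)
  also have "\<dots> = err a b n f"
    unfolding err_def by (simp add: nsq_def power2_eq_square algebra_simps)
  finally show ?thesis .
qed

text \<open>Both estimates are kept squared, so that sums over components and intervals need no
  roots. \<open>K\<close> contains only the power of the mesh size, because the two bounds differ in
  the power of \<open>r\<close>.\<close>

lemma galerkin_estimates:
  fixes s T :: real
  assumes s: "s \<ge> 1" and T: "T > 0" and part: "is_partition T N t" and r: "r \<ge> 1"
    and D: "D \<in> carrier_mat M M" and neg: "neg_semidef M (D + D\<^sup>T)"
    and ivp: "ivp_solution M T D R Y0 Y" and RH: "R \<in> H_space M 0 T s"
    and YW: "Y \<in> Winf_space M 0 T (1 + s)" and gal: "galerkin_solution M r T N t D R Y0 Yr"
  defines "K \<equiv> mesh_size N t powr min (real r + 1) s"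
    and "W \<equiv> Winf_norm M 0 T (s + 1) Y" and "c \<equiv> hp_const (s - 1)" and "c' \<equiv> hp_const (real (nat \<lfloor>s\<rfloor>))"
  shows "(L2_norm_on 0 T (\<lambda>x. Y x - Yr x))\<^sup>2 \<le> 2 * c * (K / real r powr s)\<^sup>2 * (H_norm M 0 T s Y)\<^sup>2
      + 32 * T\<^sup>2 * (c * (K / real r powr s)\<^sup>2 * (H_norm M 0 T s (\<lambda>x. D *\<^sub>v Y x))\<^sup>2)"
    and "\<And>x. x \<in> {0..T} \<Longrightarrow> (vnorm (Y x - Yr x))\<^sup>2 \<le> 2 * c' * ((1 + T) * (K / real r powr (s - 1)))\<^sup>2 * W\<^sup>2
      + 320 * T * ((K / real r powr (s - 1))\<^sup>2 * (4 * c * (T * W\<^sup>2 + (H_norm M 0 T s R)\<^sup>2)))"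
proof -
  have t0: "t 0 = 0" and tN: "t N = T" and t_less: "\<And>n. n < N \<Longrightarrow> t n < t (Suc n)"
    using part by (auto simp: is_partition_def)
  have t_mono: "t m \<le> t n" if "m \<le> n" "n \<le> N" for m n
    using that by (induction n) (force simp: le_Suc_eq intro: order_trans[OF _ less_imp_le[OF t_less]])+
  have tr: "0 \<le> t n" "t n \<le> T" if "n \<le> N" for n
    using t_mono[of 0 n] t_mono[of n N] that t0 tN by auto
  define k where "k = nat \<lfloor>s\<rfloor>"
  have k1: "k \<ge> 1" using s by (simp add: k_def le_nat_iff le_floor_iff)
  define y where "y i x = Y x $ i" for i x
  define \<rho> where "\<rho> i x = R x $ i" for i x
  define d where "d i j = D $$ (i, j)" for i j
  define U where "U x = D *\<^sub>v Y x" for x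
  define z where "z i = wcomp T (Suc 0) Y i" for i
  define zD where "zD i x = (\<Sum>j<M. d i j * z j x)" for i x

  have Yc: "Y x \<in> carrier_vec M" if "x \<in> {0..T}" for x using ivp that by (auto simp: ivp_solution_def)
  have ycont: "continuous_on {0..T} (y i)" if "i < M" for i
    using ivp that by (auto simp: ivp_solution_def y_def[abs_def])
  have Rwd: "weakly_differentiable M 0 T k R" and Rfin: "H_norm_sq M 0 T s R < \<infinity>"
    using RH by (auto simp: H_space_def k_def)
  have Rc: "R x \<in> carrier_vec M" if "x \<in> {0<..<T}" for x using Rwd that by (auto simp: weakly_differentiable_def)
  have mv: "(D *\<^sub>v Y x) $ i = (\<Sum>j<M. d i j * y j x)" if "i < M" "x \<in> {0..T}" for i x
    using D Yc[OF that(2)] that(1) by (simp add: scalar_prod_sum[of _ M] d_def y_def)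
  have rhs: "(D *\<^sub>v Y x + R x) $ i = (\<Sum>j<M. d i j * y j x) + \<rho> i x" if "i < M" "x \<in> {0<..<T}" for i x
    using Rc[OF that(2)] that mv[of i x] by (simp add: \<rho>_def)
  have wdY: "weak_deriv 0 T j (\<lambda>x. Y x $ i) (wcomp T j Y i)" and LY: "L2 0 T (wcomp T j Y i)"
    and bY: "AE x in mu 0 T. \<bar>wcomp T j Y i x\<bar> \<le> W" if "i < M" "j \<le> k + 1" for i j
    using Winf_L2[OF YW s T, of i j] that by (auto simp: k_def W_def)
  have W0: "W \<ge> 0" unfolding W_def by (rule Winf_AE(1)[OF YW s T])
  have wdU: "weak_deriv 0 T j (\<lambda>x. U x $ i) (\<lambda>x. \<Sum>l<M. d i l * wcomp T j Y l x)" if "i < M" "j \<le> k + 1" for i j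
  proof (rule weak_deriv_cong[OF weak_deriv_lincomb[OF _ T]])
    show "weak_deriv 0 T j (\<lambda>x. Y x $ l) (wcomp T j Y l)" if "l \<in> {..<M}" for l
      using that \<open>j \<le> k + 1\<close> by (intro wdY) auto
    show "(\<Sum>l<M. d i l * (Y x $ l)) = U x $ i" if "x \<in> {0<..<T}" for x
      using mv[OF \<open>i < M\<close>, of x] that by (simp add: U_def y_def)
  qed simp

  \<comment> \<open>\<open>H_norm\<close> sends an infinite squared norm to 0, so the right side of
    the L2 estimate is meaningful only after finiteness is known, here for \<open>Y\<close> and
    below for D Y.\<close>
  have Yfin: "H_norm_sq M 0 T s Y < \<infinity>"
    by (rule H_norm_sq_finite[OF T W0]) (auto intro: wdY bY simp: k_def)
  \<comment> \<open>This bound depends on \<open>D\<close>, but it serves finiteness only and enters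
    no estimate.\<close>
  define B where "B = (\<Sum>i<M. \<Sum>j<M. \<bar>d i j\<bar>) * W"
  have B0: "B \<ge> 0" unfolding B_def using W0 by (intro mult_nonneg_nonneg sum_nonneg) auto
  have bU: "AE x in mu 0 T. \<bar>\<Sum>l<M. d i l * wcomp T j Y l x\<bar> \<le> B" if i: "i < M" and j: "j \<le> k + 1" for i j
  proof -
    have "AE x in mu 0 T. \<forall>l\<in>{..<M}. \<bar>wcomp T j Y l x\<bar> \<le> W"
      using bY j by (intro AE_finite_allI) auto
    then show ?thesis
    proof eventually_elim
      case (elim x)
      have "\<bar>\<Sum>l<M. d i l * wcomp T j Y l x\<bar> \<le> (\<Sum>l<M. \<bar>d i l\<bar> * W)"
        using elim by (intro order_trans[OF sum_abs] sum_mono) (auto simp: abs_mult intro!: mult_left_mono)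
      also have "\<dots> = (\<Sum>l<M. \<bar>d i l\<bar>) * W" by (simp add: sum_distrib_right)
      also have "\<dots> \<le> B" unfolding B_def
        using i W0 by (intro mult_right_mono member_le_sum[of i "{..<M}" "\<lambda>i. \<Sum>l<M. \<bar>d i l\<bar>"]) (auto intro: sum_nonneg)
      finally show ?case .
    qed
  qed
  have Ufin: "H_norm_sq M 0 T s U < \<infinity>"
    by (rule H_norm_sq_finite[OF T B0]) (auto intro: wdU bU simp: k_def)
  have Ywd: "weakly_differentiable M 0 T k Y"
    unfolding weakly_differentiable_def
  proof (intro conjI allI impI)
    show "Y \<in> {0<..<T} \<rightarrow> carrier_vec M" using Yc by auto
    show "\<exists>w. weak_deriv 0 T j (\<lambda>x. Y x $ i) w" if "i < M" "j \<le> k" for i j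
      using wdY[of i j] that by auto
  qed
  have Uwd: "weakly_differentiable M 0 T k U"
    unfolding weakly_differentiable_def U_def[symmetric]
  proof (intro conjI allI impI)
    show "U \<in> {0<..<T} \<rightarrow> carrier_vec M" using Yc D by (auto simp: U_def)
    show "\<exists>w. weak_deriv 0 T j (\<lambda>x. U x $ i) w" if "i < M" "j \<le> k" for i j
      using wdU[of i j] that by auto
  qed
  note HY = H_space_sob[OF Ywd[unfolded k_def] Yfin s T]
  note HU = H_space_sob[OF Uwd[unfolded k_def] Ufin s T]
  note HR = H_space_sob[OF Rwd[unfolded k_def] Rfin s T]
  note WS = Winf_sob[OF YW s T, folded W_def]

  have zL: "L2 0 T (z i)" if "i < M" for i unfolding z_def using that by (intro LY) auto
  have zDL: "L2 0 T (zD i)" for i unfolding zD_def by (intro L2_sum L2_cmult zL) auto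
  have \<rho>L: "L2 0 T (\<rho> i)" if i: "i < M" for i
  proof (rule L2_cong_AE)
    show "L2 0 T (wcomp T 0 R i)" using i by (intro HR(3)) auto
    have "locally_integrable 0 T (\<rho> i)"
      using weakly_differentiable_wcomp[OF Rwd i, of 0] by (simp add: weak_deriv_mu \<rho>_def[abs_def])
    then have "weak_deriv 0 T 0 (\<rho> i) (\<rho> i)" by (rule weak_deriv_0)
    from wderiv_eq_AE[OF this T] show "AE x in mu 0 T. wcomp T 0 R i x = \<rho> i x" by (simp add: \<rho>_def[abs_def])
  qed
  have ivp_wd: "weak_deriv 0 T 1 (\<lambda>x. Y x $ i) (\<lambda>x. (D *\<^sub>v Y x + R x) $ i)" if "i < M" for i
    using ivp that by (auto simp: ivp_solution_def)
  have ode: "AE x in mu 0 T. z i x = (\<Sum>j<M. d i j * y j x) + \<rho> i x" if i: "i < M" for i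
  proof -
    have "AE x in mu 0 T. z i x = (D *\<^sub>v Y x + R x) $ i"
      using wderiv_eq_AE[OF ivp_wd[OF i] T] by (simp add: z_def)
    then show ?thesis by (rule AE_mp) (auto intro!: AE_I2 simp: rhs[OF i])
  qed
  \<comment> \<open>The weak derivative yields the primitive a.e.; continuity of \<open>Y\<close>
    turns this into equality at every point, in particular at the nodes.\<close>
  have prim_y: "y i x = y i 0 + prim 0 (z i) x" if i: "i < M" and x: "x \<in> {0..T}" for i x
  proof -
    have "weak_deriv 0 T 1 (y i) (z i)" using wdY[OF i, of 1] by (simp add: y_def[abs_def] z_def)
    then obtain e where e: "AE x in mu 0 T. y i x = e + prim 0 (z i) x"
      using weak_deriv_primitive[OF _ L2_continuous[OF ycont[OF i]] zL[OF i] T] by blast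
    have "y i x = e + prim 0 (z i) x" if "x \<in> {0..T}" for x
      using that zL[OF i]
      by (intro continuous_AE_eq[OF e ycont[OF i] _ T] continuous_intros prim_continuous L2_integrable) auto
    from this[OF x] this[of 0] T show ?thesis by (simp add: prim_self)
  qed
  \<comment> \<open>For the L2 estimate: D Y' as the derivative of D Y.\<close>
  have zD_U: "AE x in mu 0 T. wcomp T (Suc 0) U i x = zD i x" if i: "i < M" for i
    using wderiv_eq_AE[OF wdU[OF i, of "Suc 0"] T] by (simp add: zD_def[abs_def] z_def)
  \<comment> \<open>For the maximum norm: the differentiated equation expresses D Y' as Y'' -
    R'.\<close>
  have zD_YR: "AE x in mu 0 T. wcomp T (Suc (Suc 0)) Y i x - wcomp T (Suc 0) R i x = zD i x" if i: "i < M" for i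
  proof -
    have "weak_deriv 0 T (Suc 1) (\<lambda>x. Y x $ i) (wcomp T (Suc (Suc 0)) Y i)"
      using wdY[OF i, of "Suc (Suc 0)"] k1 by simp
    from weak_deriv_step[OF ivp_wd[OF i] this T]
    have 1: "weak_deriv 0 T 1 (\<lambda>x. (D *\<^sub>v Y x + R x) $ i) (wcomp T (Suc (Suc 0)) Y i)" .
    have 2: "weak_deriv 0 T 1 (\<lambda>x. R x $ i) (wcomp T (Suc 0) R i)"
      using weakly_differentiable_wcomp[OF Rwd i, of 1] k1 by simp
    have "weak_deriv 0 T 1 (\<lambda>x. U x $ i) (\<lambda>x. wcomp T (Suc (Suc 0)) Y i x - wcomp T (Suc 0) R i x)"
      by (rule weak_deriv_cong[OF weak_deriv_diff[OF 1 2 T]])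
        (use rhs[OF i] mv[OF i] in \<open>auto simp: U_def \<rho>_def\<close>)
    from weak_deriv_unique[OF this wdU[OF i, of 1] T] show ?thesis by (simp add: zD_def[abs_def] z_def)
  qed

  have Yr: "Yr \<in> V_space M r T N t" "Yr 0 = Y0" using gal by (auto simp: galerkin_solution_def)
  then have "\<forall>n. \<exists>p. n < N \<longrightarrow> p \<in> vpolys M r \<and> (\<forall>x\<in>{t n<..<t (Suc n)}. Yr x = veval p x)"
    by (auto simp: V_space_def)
  then have "\<exists>P. \<forall>n. n < N \<longrightarrow> P n \<in> vpolys M r \<and> (\<forall>x\<in>{t n<..<t (Suc n)}. Yr x = veval (P n) x)"
    by (rule choice)
  then obtain P where P: "\<And>n. n < N \<Longrightarrow> P n \<in> vpolys M r"
    and PYr: "\<And>n x. n < N \<Longrightarrow> x \<in> {t n<..<t (Suc n)} \<Longrightarrow> Yr x = veval (P n) x"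
    by blast
  define p where "p n i = P n $ i" for n i
  have Pc: "P n \<in> carrier_vec M" if "n < N" for n using P[OF that] by (simp add: vpolys_def)
  have Yrc: "Yr x \<in> carrier_vec M" if "x \<in> {0..T}" for x using Yr(1) that by (auto simp: V_space_def)
  have Yr_cont: "continuous_on {0..T} (\<lambda>x. Yr x $ i)" if "i < M" for i
    using Yr(1) that by (auto simp: V_space_def)
  have p_plt: "plt (Suc r) (p n i)" if "n < N" "i < M" for n i
    using P[OF that(1)] that(2) by (simp add: vpolys_def p_def plt_degree)
  have Yr_open: "Yr x $ i = poly (p n i) x" if "n < N" "i < M" "x \<in> {t n<..<t (Suc n)}" for n i x
    using PYr[OF that(1,3)] Pc[OF that(1)] that(2) by (simp add: p_def veval_index)
  \<comment> \<open>The pieces are given on open intervals. Continuity extends the identity to the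
    nodes, where the initial value and the matching of neighbouring pieces are read off.\<close>
  have Yr_p: "Yr x $ i = poly (p n i) x" if n: "n < N" and i: "i < M" and x: "x \<in> {t n..t (Suc n)}" for n i x
  proof (rule continuous_AE_eq[OF _ _ _ t_less[OF n] x])
    show "AE x in mu (t n) (t (Suc n)). Yr x $ i = poly (p n i) x"
      using Yr_open[OF n i] by (auto intro!: AE_I2)
    show "continuous_on {t n..t (Suc n)} (\<lambda>x. Yr x $ i)"
      using tr[of n] tr[of "Suc n"] n by (intro continuous_on_subset[OF Yr_cont[OF i]]) auto
  qed (intro continuous_intros)
  have proj: "L2_proj M (r - 1) (t n) (t (Suc n)) v = Matrix.vec M (\<lambda>i. pr (t n) (t (Suc n)) r (\<lambda>x. v x $ i))"
    if n: "n < N" and v: "\<And>x. x \<in> {0<..<T} \<Longrightarrow> v x \<in> carrier_vec M" "\<And>i. i < M \<Longrightarrow> L2 0 T (\<lambda>x. v x $ i)" for n v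
  proof (rule L2_proj_eq[OF t_less[OF n] _ _ r])
    show "v x \<in> carrier_vec M" if "x \<in> {t n<..<t (Suc n)}" for x
      using that tr[of n] tr[of "Suc n"] n by (intro v(1)) auto
    show "L2 (t n) (t (Suc n)) (\<lambda>x. v x $ i)" if "i < M" for i
      using tr[of n] tr[of "Suc n"] n by (intro L2_subset[OF v(2)[OF that]]) auto
  qed
  have pode: "poly (pderiv (p n i)) x = (\<Sum>j<M. d i j * poly (pr (t n) (t (Suc n)) r (poly (p n j))) x)
        + poly (pr (t n) (t (Suc n)) r (\<rho> i)) x"
    if n: "n < N" and i: "i < M" and x: "x \<in> {t n<..<t (Suc n)}" for n i x
  proof -
    let ?P = "pr (t n) (t (Suc n)) r"
    let ?V = "veval (L2_proj M (r - 1) (t n) (t (Suc n)) Yr) x"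
    have V: "?V = Matrix.vec M (\<lambda>j. poly (?P (poly (p n j))) x)"
    proof -
      have "?P (\<lambda>x. Yr x $ j) = ?P (poly (p n j))" if "j < M" for j
      proof (rule pr_cong_AE)
        show "AE x in mu (t n) (t (Suc n)). Yr x $ j = poly (p n j) x"
          using Yr_open[OF n that] by (auto intro!: AE_I2)
        show "L2 (t n) (t (Suc n)) (\<lambda>x. Yr x $ j)"
          using tr[of n] tr[of "Suc n"] n by (intro L2_subset[OF L2_continuous[OF Yr_cont[OF that]]]) auto
      qed
      moreover have "L2_proj M (r - 1) (t n) (t (Suc n)) Yr = Matrix.vec M (\<lambda>i. ?P (\<lambda>x. Yr x $ i))"
        by (intro proj n L2_continuous Yr_cont) (auto intro: Yrc)
      ultimately show ?thesis by (auto simp: veval_def)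
    qed
    have VR: "veval (L2_proj M (r - 1) (t n) (t (Suc n)) R) x = Matrix.vec M (\<lambda>j. poly (?P (\<rho> j)) x)"
    proof -
      have "L2_proj M (r - 1) (t n) (t (Suc n)) R = Matrix.vec M (\<lambda>i. ?P (\<lambda>x. R x $ i))"
        by (intro proj n Rc) (auto intro: \<rho>L[unfolded \<rho>_def[abs_def]])
      then show ?thesis by (auto simp: veval_def \<rho>_def[abs_def])
    qed
    have "((\<lambda>y. Yr y $ i) has_real_derivative
           (D *\<^sub>v ?V + veval (L2_proj M (r - 1) (t n) (t (Suc n)) R) x) $ i) (at x)"
      using gal n i x by (auto simp: galerkin_solution_def)
    moreover have "((\<lambda>y. Yr y $ i) has_real_derivative poly (pderiv (p n i)) x) (at x)"
      by (rule has_field_derivative_transform_within_open[OF poly_DERIV, where S = "{t n<..<t (Suc n)}"])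
        (use x Yr_open[OF n i] in auto)
    ultimately have "poly (pderiv (p n i)) x = (D *\<^sub>v ?V + veval (L2_proj M (r - 1) (t n) (t (Suc n)) R) x) $ i"
      by (metis DERIV_unique)
    also have "\<dots> = (\<Sum>j<M. d i j * poly (?P (poly (p n j))) x) + poly (?P (\<rho> i)) x"
      unfolding V VR using D i by (simp add: scalar_prod_sum[of _ M] d_def)
    finally show ?thesis .
  qed
  have N1: "N \<ge> 1" using t0 tN T by (cases N) auto
  have p_start: "poly (p 0 i) 0 = y i 0" if i: "i < M" for i
  proof -
    have "Yr 0 $ i = poly (p 0 i) 0"
      by (rule Yr_p[OF _ i]) (use N1 t_less[of 0] t0 in auto)
    moreover have "Yr 0 = Y 0" using Yr(2) ivp by (simp add: ivp_solution_def)
    ultimately show ?thesis by (simp add: y_def)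
  qed
  have p_cont: "poly (p n i) (t (Suc n)) = poly (p (Suc n) i) (t (Suc n))" if "Suc n < N" "i < M" for n i
    using Yr_p[of n i "t (Suc n)"] Yr_p[of "Suc n" i "t (Suc n)"] that t_less[of n] t_less[of "Suc n"] by simp
  have dneg: "(\<Sum>i<M. \<Sum>j<M. v i * d i j * v j) \<le> 0" for v
    unfolding d_def by (rule neg_semidef_sum[OF D neg])

  define E1 where "E1 n = (\<Sum>i<M. err (t n) (t (Suc n)) r (z i))" for n
  define E2 where "E2 = (\<Sum>n<N. ((t (Suc n) - t n) / r)\<^sup>2 * (\<Sum>i<M. err (t n) (t (Suc n)) r (zD i)))"
  have core: "(\<Sum>n<N. \<Sum>i<M. nsq (t n) (t (Suc n)) (\<lambda>x. y i x - poly (p n i) x))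
      \<le> 2 * (\<Sum>n<N. ((t (Suc n) - t n) / r)\<^sup>2 * E1 n) + 32 * T\<^sup>2 * E2"
    "\<And>n x. n < N \<Longrightarrow> x \<in> {t n..t (Suc n)} \<Longrightarrow>
      (\<Sum>i<M. (y i x - poly (p n i) x)\<^sup>2) \<le> 2 * (t (Suc n) - t n) * E1 n + 320 * (real r)\<^sup>2 * T * E2"
    using galerkin_error[OF T part r dneg zL \<rho>L prim_y ode p_plt p_start p_cont pode]
    unfolding E1_def E2_def zD_def[abs_def] by auto
  have errD: "err (t n) (t (Suc n)) r (zD i) = err (t n) (t (Suc n)) r u"
    if "n < N" "AE x in mu 0 T. u x = zD i x" for n i u
  proof -
    have "AE x in mu 0 T. zD i x = u x" using that(2) by (rule AE_mp) (auto intro!: AE_I2)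
    then have "AE x in mu (t n) (t (Suc n)). zD i x = u x"
      by (rule AE_mu_subset) (use that(1) tr[of n] tr[of "Suc n"] in auto)
    moreover have "L2 (t n) (t (Suc n)) (zD i)"
      using that(1) tr[of n] tr[of "Suc n"] by (intro L2_subset[OF zDL]) auto
    ultimately show ?thesis by (rule err_cong_AE)
  qed
  have vn: "(vnorm (Y x - Yr x))\<^sup>2 = (\<Sum>i<M. (y i x - Yr x $ i)\<^sup>2)" if "x \<in> {0..T}" for x
    using Yc[OF that] Yrc[OF that] by (simp add: vnorm_sq y_def)

  have "(L2_norm_on 0 T (\<lambda>x. Y x - Yr x))\<^sup>2 = integral\<^sup>L (mu 0 T) (\<lambda>x. (vnorm (Y x - Yr x))\<^sup>2)"
    unfolding L2_norm_on_def set_integral_mu by simp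
  also have "\<dots> = integral\<^sup>L (mu (t 0) (t N)) (\<lambda>x. \<Sum>i<M. (y i x - Yr x $ i)\<^sup>2)"
    unfolding t0 tN by (intro Bochner_Integration.integral_cong) (auto simp: vn)
  also have "\<dots> = (\<Sum>n<N. integral\<^sup>L (mu (t n) (t (Suc n))) (\<lambda>x. \<Sum>i<M. (y i x - Yr x $ i)\<^sup>2))"
    by (intro integral_mu_partition integrable_mu_continuous)
      (use t_less ycont Yr_cont in \<open>auto simp: t0 tN intro!: continuous_intros less_imp_le\<close>)
  also have "\<dots> = (\<Sum>n<N. \<Sum>i<M. nsq (t n) (t (Suc n)) (\<lambda>x. y i x - poly (p n i) x))"
  proof (rule sum.cong[OF refl])
    fix n assume "n \<in> {..<N}"
    then have n: "n < N" by simp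
    have "integral\<^sup>L (mu (t n) (t (Suc n))) (\<lambda>x. \<Sum>i<M. (y i x - Yr x $ i)\<^sup>2) =
        integral\<^sup>L (mu (t n) (t (Suc n))) (\<lambda>x. \<Sum>i<M. (y i x - poly (p n i) x)\<^sup>2)"
      using Yr_open[OF n] by (intro Bochner_Integration.integral_cong) auto
    also have "\<dots> = (\<Sum>i<M. nsq (t n) (t (Suc n)) (\<lambda>x. y i x - poly (p n i) x))"
      unfolding nsq_def
      using tr[of n] tr[of "Suc n"] n
      by (intro Bochner_Integration.integral_sum L2_square L2_diff L2_poly L2_subset[OF L2_continuous[OF ycont]]) auto
    finally show "integral\<^sup>L (mu (t n) (t (Suc n))) (\<lambda>x. \<Sum>i<M. (y i x - Yr x $ i)\<^sup>2) =
        (\<Sum>i<M. nsq (t n) (t (Suc n)) (\<lambda>x. y i x - poly (p n i) x))" .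
  qed
  also note core(1)
  also have "2 * (\<Sum>n<N. ((t (Suc n) - t n) / r)\<^sup>2 * E1 n) + 32 * T\<^sup>2 * E2 \<le>
      2 * (c * (K / real r powr s)\<^sup>2 * (H_norm M 0 T s Y)\<^sup>2) + 32 * T\<^sup>2 * (c * (K / real r powr s)\<^sup>2 * (H_norm M 0 T s U)\<^sup>2)"
  proof (intro add_mono mult_left_mono)
    show "(\<Sum>n<N. ((t (Suc n) - t n) / r)\<^sup>2 * E1 n) \<le> c * (K / real r powr s)\<^sup>2 * (H_norm M 0 T s Y)\<^sup>2"
      unfolding E1_def z_def K_def c_def
      by (rule sob_global[OF part T r s HY(1)]) (simp_all add: HY(2))
    have "E2 = (\<Sum>n<N. ((t (Suc n) - t n) / r)\<^sup>2 * (\<Sum>i<M. err (t n) (t (Suc n)) r (wcomp T (Suc 0) U i)))"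
      unfolding E2_def using errD[OF _ zD_U] by (intro sum.cong refl arg_cong2[where f = times]) auto
    also have "\<dots> \<le> c * (K / real r powr s)\<^sup>2 * (H_norm M 0 T s U)\<^sup>2"
      unfolding K_def c_def
      by (rule sob_global[OF part T r s HU(1)]) (simp_all add: HU(2))
    finally show "E2 \<le> c * (K / real r powr s)\<^sup>2 * (H_norm M 0 T s U)\<^sup>2" .
  qed auto
  finally show "(L2_norm_on 0 T (\<lambda>x. Y x - Yr x))\<^sup>2 \<le> 2 * c * (K / real r powr s)\<^sup>2 * (H_norm M 0 T s Y)\<^sup>2
      + 32 * T\<^sup>2 * (c * (K / real r powr s)\<^sup>2 * (H_norm M 0 T s (\<lambda>x. D *\<^sub>v Y x))\<^sup>2)"
    by (simp add: U_def[abs_def] mult.assoc)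

  \<comment> \<open>The factor 4 is 2 from splitting Y'' - R' times 2 from the density
    \<open>2 * W\<^sup>2\<close>.\<close>
  have E2: "E2 \<le> (K / real r powr s)\<^sup>2 * (4 * c * (T * W\<^sup>2 + (H_norm M 0 T s R)\<^sup>2))"
  proof -
    let ?Y = "wcomp T (Suc (Suc 0)) Y" and ?R = "wcomp T (Suc 0) R"
    have "E2 \<le> (\<Sum>n<N. 2 * (((t (Suc n) - t n) / r)\<^sup>2 * (\<Sum>i<M. err (t n) (t (Suc n)) r (?Y i))) +
        2 * (((t (Suc n) - t n) / r)\<^sup>2 * (\<Sum>i<M. err (t n) (t (Suc n)) r (?R i))))"
      unfolding E2_def
    proof (rule sum_mono)
      fix n assume "n \<in> {..<N}"
      then have n: "n < N" by simp
      have "err (t n) (t (Suc n)) r (zD i) \<le> 2 * err (t n) (t (Suc n)) r (?Y i) + 2 * err (t n) (t (Suc n)) r (?R i)"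
        if i: "i < M" for i
      proof -
        have L: "L2 (t n) (t (Suc n)) (?Y i)" "L2 (t n) (t (Suc n)) (?R i)"
          using tr[of n] tr[of "Suc n"] n k1
          by (intro L2_subset[OF LY[OF i, of "Suc (Suc 0)"]] L2_subset[OF HR(3)[OF i, of "Suc 0"]]; simp add: k_def[symmetric])+
        have "err (t n) (t (Suc n)) r (zD i) = err (t n) (t (Suc n)) r (\<lambda>x. ?Y i x + - ?R i x)"
          using errD[OF n zD_YR[OF i]] by simp
        also have "\<dots> \<le> 2 * err (t n) (t (Suc n)) r (?Y i) + 2 * err (t n) (t (Suc n)) r (\<lambda>x. - ?R i x)"
          by (intro err_add_le L2_minus L)
        finally show ?thesis using err_minus_le[OF L(2), of r] by simp
      qed
      then have "(\<Sum>i<M. err (t n) (t (Suc n)) r (zD i)) \<le>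
          (\<Sum>i<M. 2 * err (t n) (t (Suc n)) r (?Y i) + 2 * err (t n) (t (Suc n)) r (?R i))"
        by (intro sum_mono) auto
      then have "((t (Suc n) - t n) / r)\<^sup>2 * (\<Sum>i<M. err (t n) (t (Suc n)) r (zD i)) \<le> ((t (Suc n) - t n) / r)\<^sup>2 *
          (\<Sum>i<M. 2 * err (t n) (t (Suc n)) r (?Y i) + 2 * err (t n) (t (Suc n)) r (?R i))"
        by (rule mult_left_mono) simp
      also have "\<dots> = 2 * (((t (Suc n) - t n) / r)\<^sup>2 * (\<Sum>i<M. err (t n) (t (Suc n)) r (?Y i))) +
        2 * (((t (Suc n) - t n) / r)\<^sup>2 * (\<Sum>i<M. err (t n) (t (Suc n)) r (?R i)))"
        by (simp add: sum.distrib sum_distrib_left[symmetric] distrib_left)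
      finally show "((t (Suc n) - t n) / r)\<^sup>2 * (\<Sum>i<M. err (t n) (t (Suc n)) r (zD i)) \<le>
        2 * (((t (Suc n) - t n) / r)\<^sup>2 * (\<Sum>i<M. err (t n) (t (Suc n)) r (?Y i))) +
        2 * (((t (Suc n) - t n) / r)\<^sup>2 * (\<Sum>i<M. err (t n) (t (Suc n)) r (?R i)))" .
    qed
    also have "\<dots> = 2 * (\<Sum>n<N. ((t (Suc n) - t n) / r)\<^sup>2 * (\<Sum>i<M. err (t n) (t (Suc n)) r (?Y i))) +
        2 * (\<Sum>n<N. ((t (Suc n) - t n) / r)\<^sup>2 * (\<Sum>i<M. err (t n) (t (Suc n)) r (?R i)))"
      by (simp only: sum.distrib sum_distrib_left)
    also have "\<dots> \<le> 2 * (c * (K / real r powr s)\<^sup>2 * (2 * W\<^sup>2 * T)) + 2 * (c * (K / real r powr s)\<^sup>2 * (H_norm M 0 T s R)\<^sup>2)"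
    proof (intro add_mono mult_left_mono)
      show "(\<Sum>n<N. ((t (Suc n) - t n) / r)\<^sup>2 * (\<Sum>i<M. err (t n) (t (Suc n)) r (?Y i))) \<le> c * (K / real r powr s)\<^sup>2 * (2 * W\<^sup>2 * T)"
        unfolding K_def c_def
        by (rule sob_global[OF part T r s WS(1)]) (use T in \<open>simp_all add: emeasure_restrict_space ennreal_mult\<close>)
      show "(\<Sum>n<N. ((t (Suc n) - t n) / r)\<^sup>2 * (\<Sum>i<M. err (t n) (t (Suc n)) r (?R i))) \<le> c * (K / real r powr s)\<^sup>2 * (H_norm M 0 T s R)\<^sup>2"
        unfolding K_def c_def
        by (rule sob_global[OF part T r s HR(1)]) (simp_all add: HR(2))
    qed auto
    also have "\<dots> \<le> (K / real r powr s)\<^sup>2 * (4 * c * (T * W\<^sup>2 + (H_norm M 0 T s R)\<^sup>2))"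
    proof -
      have "0 \<le> c * (K / real r powr s)\<^sup>2 * (H_norm M 0 T s R)\<^sup>2" by (simp add: c_def hp_const_def)
      then show ?thesis by (simp add: algebra_simps)
    qed
    finally show ?thesis .
  qed

  fix x assume x: "x \<in> {0..T}"
  have "\<exists>n<N. x \<in> {t n..t (Suc n)}"
  proof -
    have "\<exists>n<m. x \<in> {t n..t (Suc n)}" if "m \<ge> 1" "x \<le> t m" for m
      using that
    proof (induction m)
      case (Suc m)
      show ?case
      proof (cases "m \<ge> 1 \<and> x \<le> t m")
        case True
        then show ?thesis using Suc.IH less_SucI by blast
      next
        case False
        then have "t m \<le> x" using x t0 by (cases m) auto
        then show ?thesis using Suc.prems by (intro exI[of _ m]) auto
      qed
    qed simp
    from this[OF N1] show ?thesis using x tN by simp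
  qed
  then obtain n where n: "n < N" and xn: "x \<in> {t n..t (Suc n)}" by blast
  define h where "h = t (Suc n) - t n"
  have h: "h > 0" using t_less[OF n] by (simp add: h_def)
  have h\<tau>: "h \<le> mesh_size N t"
    unfolding h_def mesh_size_def using n by (intro Max_ge) auto
  have hT: "h \<le> T" using tr[of n] tr[of "Suc n"] n by (simp add: h_def)
  have c'0: "c' \<ge> 0" by (simp add: c'_def hp_const_def)
  have E1: "E1 n \<le> c' * (h powr min (real r) (real k) / real r powr real k)\<^sup>2 * (W\<^sup>2 * h)"
  proof -
    have "sob_fam (t n) (t (Suc n)) M (real k) (\<lambda>j i. wcomp T (Suc j) Y i) (\<lambda>_. ennreal (W\<^sup>2))"
      unfolding k_def using tr[of n] tr[of "Suc n"] n by (intro sob_fam_subset[OF WS(2)]) auto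
    from sob_fam_err[OF t_less[OF n] r _ this]
    have "ennreal (E1 n) \<le> ennreal (c' * (h powr min (real r) (real k) / real r powr real k)\<^sup>2) * (\<integral>\<^sup>+x. ennreal (W\<^sup>2) \<partial>mu (t n) (t (Suc n)))"
      by (simp add: E1_def z_def c'_def k_def h_def del: nn_integral_const)
    also have "(\<integral>\<^sup>+x. ennreal (W\<^sup>2) \<partial>mu (t n) (t (Suc n))) = ennreal (W\<^sup>2 * h)"
      using h by (simp add: emeasure_restrict_space h_def ennreal_mult)
    also have "ennreal (c' * (h powr min (real r) (real k) / real r powr real k)\<^sup>2) * ennreal (W\<^sup>2 * h) =
        ennreal (c' * (h powr min (real r) (real k) / real r powr real k)\<^sup>2 * (W\<^sup>2 * h))"
      using h c'0 by (intro ennreal_mult[symmetric] mult_nonneg_nonneg) auto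
    finally show ?thesis using h c'0 by (simp add: ennreal_le_iff)
  qed
  have pow: "h * (h powr min (real r) (real k) / real r powr real k) \<le> (1 + T) * (K / real r powr (s - 1))"
  proof -
    \<comment> \<open>\<open>m\<close> is the exponent wanted, \<open>m'\<close> the one that the
      integer order yields. The surplus lies between 0 and 1 and is paid for by
      \<open>1 + T\<close>, as \<open>h \<le> T\<close>.\<close>
    define m where "m = min (real r + 1) s"
    define m' where "m' = min (real r + 1) (real k + 1)"
    have ks: "s \<le> real k + 1" "real k \<le> s" using s by (auto simp: k_def)
    have mm: "0 \<le> m' - m" "m' - m \<le> 1" "0 \<le> m" using ks s by (auto simp: m_def m'_def min_def)
    have "h * h powr min (real r) (real k) = h powr (1 + min (real r) (real k))"
      using h by (simp add: powr_add)
    also have "1 + min (real r) (real k) = m + (m' - m)" by (simp add: m'_def min_def)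
    also have "h powr (m + (m' - m)) = h powr m * h powr (m' - m)" by (rule powr_add)
    also have "\<dots> \<le> K * (1 + T)"
    proof (intro mult_mono)
      show "h powr m \<le> K" unfolding K_def m_def[symmetric] using h h\<tau> mm by (intro powr_mono2) auto
      have "h powr (m' - m) \<le> (1 + T) powr (m' - m)" using h hT mm by (intro powr_mono2) auto
      also have "\<dots> \<le> (1 + T) powr 1" using T mm by (intro powr_mono) auto
      finally show "h powr (m' - m) \<le> 1 + T" using T by simp
    qed (auto simp: K_def)
    finally have 1: "h * h powr min (real r) (real k) \<le> K * (1 + T)" .
    have 2: "real r powr (s - 1) \<le> real r powr real k" using ks r by (intro powr_mono) auto
    have "h * h powr min (real r) (real k) / real r powr real k \<le> K * (1 + T) / real r powr (s - 1)"
      using 1 2 h T r by (intro frac_le) (auto simp: K_def)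
    then show ?thesis by (simp add: mult.commute)
  qed
  have "(vnorm (Y x - Yr x))\<^sup>2 = (\<Sum>i<M. (y i x - poly (p n i) x)\<^sup>2)"
    using vn[OF x] Yr_p[OF n _ xn] by simp
  also have "\<dots> \<le> 2 * h * E1 n + 320 * (real r)\<^sup>2 * T * E2"
    using core(2)[OF n xn] by (simp add: h_def)
  also have "\<dots> \<le> 2 * c' * ((1 + T) * (K / real r powr (s - 1)))\<^sup>2 * W\<^sup>2
      + 320 * T * ((K / real r powr (s - 1))\<^sup>2 * (4 * c * (T * W\<^sup>2 + (H_norm M 0 T s R)\<^sup>2)))"
  proof (rule add_mono)
    have "2 * h * E1 n \<le> 2 * h * (c' * (h powr min (real r) (real k) / real r powr real k)\<^sup>2 * (W\<^sup>2 * h))"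
      using h by (intro mult_left_mono E1) auto
    also have "\<dots> = 2 * c' * (h * (h powr min (real r) (real k) / real r powr real k))\<^sup>2 * W\<^sup>2"
      by (simp add: power2_eq_square mult_ac)
    also have "\<dots> \<le> 2 * c' * ((1 + T) * (K / real r powr (s - 1)))\<^sup>2 * W\<^sup>2"
      using c'0 h by (intro mult_right_mono mult_left_mono power_mono pow) auto
    finally show "2 * h * E1 n \<le> 2 * c' * ((1 + T) * (K / real r powr (s - 1)))\<^sup>2 * W\<^sup>2" .
    have "320 * (real r)\<^sup>2 * T * E2 \<le> 320 * (real r)\<^sup>2 * T * ((K / real r powr s)\<^sup>2 * (4 * c * (T * W\<^sup>2 + (H_norm M 0 T s R)\<^sup>2)))"
      using T by (intro mult_left_mono E2) auto
    also have "\<dots> = 320 * T * ((real r * (K / real r powr s))\<^sup>2 * (4 * c * (T * W\<^sup>2 + (H_norm M 0 T s R)\<^sup>2)))"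
      by (simp only: power_mult_distrib mult_ac)
    also have "real r * (K / real r powr s) = K / real r powr (s - 1)"
      using r by (simp add: powr_diff)
    finally show "320 * (real r)\<^sup>2 * T * E2 \<le> 320 * T * ((K / real r powr (s - 1))\<^sup>2 * (4 * c * (T * W\<^sup>2 + (H_norm M 0 T s R)\<^sup>2)))" .
  qed
  finally show "(vnorm (Y x - Yr x))\<^sup>2 \<le> 2 * c' * ((1 + T) * (K / real r powr (s - 1)))\<^sup>2 * W\<^sup>2
      + 320 * T * ((K / real r powr (s - 1))\<^sup>2 * (4 * c * (T * W\<^sup>2 + (H_norm M 0 T s R)\<^sup>2)))" .
qed

lemma H_norm_nonneg: "0 \<le> H_norm M a b s v"
  by (simp add: H_norm_def)

text \<open>What remains is to take roots. In the maximum norm the contribution of eta is a multiple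
  of \<open>(1 + T) * W\<close> without a factor \<open>sqrt T\<close> at \<open>W\<close>; this is
  the source of the dependence of \<open>C'\<close> on \<open>T\<close>. As a decreasing function,
  \<open>C'\<close> stays bounded for \<open>T\<close> bounded away from 0.\<close>

theorem theorem5p2:
  fixes s :: real
  assumes "s \<ge> 1"
  shows "\<exists>C>0. \<exists>C' :: real \<Rightarrow> real. antimono_on {0<..} C' \<and>
    (\<forall>(M :: nat) (T :: real) (N :: nat) (t :: nat \<Rightarrow> real) (r :: nat)
       (D :: real mat) (Y0 :: real Matrix.vec)
       (R :: real \<Rightarrow> real Matrix.vec) (Y :: real \<Rightarrow> real Matrix.vec) (Yr :: real \<Rightarrow> real Matrix.vec).
       M \<ge> 1 \<longrightarrow> T > 0 \<longrightarrow> is_partition T N t \<longrightarrow> r \<ge> 1 \<longrightarrow>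
       D \<in> carrier_mat M M \<longrightarrow> D\<^sup>T = D \<or> D\<^sup>T = - D \<longrightarrow> neg_semidef M (D + D\<^sup>T) \<longrightarrow>
       Y0 \<in> carrier_vec M \<longrightarrow>
       ivp_solution M T D R Y0 Y \<longrightarrow>
       R \<in> H_space M 0 T s \<longrightarrow>
       Y \<in> Winf_space M 0 T (1 + s) \<longrightarrow>
       galerkin_solution M r T N t D R Y0 Yr \<longrightarrow>
         L2_norm_on 0 T (\<lambda>x. Y x - Yr x)
           \<le> C * (1 + T) * (mesh_size N t powr min (real r + 1) s / real r powr s) *
             (H_norm M 0 T s Y + H_norm M 0 T s (\<lambda>x. D *\<^sub>v Y x))
       \<and> (\<forall>x\<in>{0..T}. vnorm (Y x - Yr x)
           \<le> C' T * (1 + sqrt T) * (mesh_size N t powr min (real r + 1) s / real r powr (s - 1)) *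
             (sqrt T * Winf_norm M 0 T (s + 1) Y + H_norm M 0 T s R)))"
proof -
  define c where "c = hp_const (s - 1)"
  define c' where "c' = hp_const (real (nat \<lfloor>s\<rfloor>))"
  have "hp_const q > 0" if "q \<ge> 0" for q using that by (simp add: hp_const_def)
  then have c: "c > 0" "c' > 0" using assms by (auto simp only: c_def c'_def)
  \<comment> \<open>32 is the larger of the factors 2 and 32 in the L2 bound; 1280 below is
    \<open>320 * 4\<close>.\<close>
  define C where "C = sqrt (32 * c)"
  define C0 where "C0 = sqrt (2 * c' + 1280 * c)"
  \<comment> \<open>Chosen such that
    \<open>C' T * (1 + sqrt T) * sqrt T = C0 * (1 + sqrt T)\<^sup>2\<close>, which dominates the
    factor \<open>1 + T\<close> of the eta contribution.\<close>
  define C' where "C' T = C0 * (1 + 1 / sqrt T)" for T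
  have CC: "C > 0" "C\<^sup>2 = 32 * c" "C0 \<ge> 0" "C0\<^sup>2 = 2 * c' + 1280 * c" using c by (auto simp: C_def C0_def)
  have anti: "antimono_on {0<..} C'"
    unfolding C'_def using CC by (intro monotone_onI mult_left_mono add_left_mono divide_left_mono) auto
  show ?thesis
  proof (rule exI[of _ C], rule conjI[OF CC(1)], rule exI[of _ C'], rule conjI[OF anti], intro allI impI)
    fix M :: nat and T :: real and N :: nat and t :: "nat \<Rightarrow> real" and r :: nat and D :: "real mat"
      and Y0 :: "real Matrix.vec" and R Y Yr :: "real \<Rightarrow> real Matrix.vec"
    assume T: "T > 0" and part: "is_partition T N t" and r: "r \<ge> 1"
      and D: "D \<in> carrier_mat M M" and neg: "neg_semidef M (D + D\<^sup>T)"
      and ivp: "ivp_solution M T D R Y0 Y" and RH: "R \<in> H_space M 0 T s"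
      and YW: "Y \<in> Winf_space M 0 T (1 + s)" and gal: "galerkin_solution M r T N t D R Y0 Yr"
    note est = galerkin_estimates[OF assms T part r D neg ivp RH YW gal, folded c_def c'_def]
    define W where "W = Winf_norm M 0 T (s + 1) Y"
    define H1 where "H1 = H_norm M 0 T s Y"
    define H2 where "H2 = H_norm M 0 T s (\<lambda>x. D *\<^sub>v Y x)"
    define H where "H = H_norm M 0 T s R"
    define K where "K = mesh_size N t powr min (real r + 1) s / real r powr s"
    define K' where "K' = mesh_size N t powr min (real r + 1) s / real r powr (s - 1)"
    have nonneg: "H1 \<ge> 0" "H2 \<ge> 0" "H \<ge> 0" "W \<ge> 0" "K \<ge> 0" "K' \<ge> 0"
      using Winf_AE(1)[OF YW assms T] by (auto simp: H1_def H2_def H_def W_def K_def K'_def H_norm_nonneg)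
    define u where "u = sqrt T"
    have u: "u > 0" "T = u\<^sup>2" using T by (auto simp: u_def)
    have "L2_norm_on 0 T (\<lambda>x. Y x - Yr x) \<le> C * (1 + T) * K * (H1 + H2)"
    proof (rule power2_le_imp_le)
      have "(L2_norm_on 0 T (\<lambda>x. Y x - Yr x))\<^sup>2 \<le> 2 * c * K\<^sup>2 * H1\<^sup>2 + 32 * T\<^sup>2 * (c * K\<^sup>2 * H2\<^sup>2)"
        using est(1) by (simp only: K_def H1_def H2_def)
      also have "\<dots> = 32 * c * K\<^sup>2 * (1 / 16 * H1\<^sup>2 + T\<^sup>2 * H2\<^sup>2)" by (simp add: algebra_simps)
      also have "\<dots> \<le> 32 * c * K\<^sup>2 * ((1 + T) * (H1 + H2))\<^sup>2"
      proof (intro mult_left_mono)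
        have "1 / 16 * H1\<^sup>2 + T\<^sup>2 * H2\<^sup>2 \<le> (1 + T)\<^sup>2 * H1\<^sup>2 + (1 + T)\<^sup>2 * H2\<^sup>2"
          using T by (intro add_mono mult_right_mono power_mono) (auto simp: power2_eq_square algebra_simps)
        also have "\<dots> \<le> ((1 + T) * (H1 + H2))\<^sup>2"
          unfolding power_mult_distrib distrib_left[symmetric]
          using nonneg T by (intro mult_left_mono) (auto simp: power2_sum)
        finally show "1 / 16 * H1\<^sup>2 + T\<^sup>2 * H2\<^sup>2 \<le> ((1 + T) * (H1 + H2))\<^sup>2" .
      qed (use c in simp)
      also have "\<dots> = (C * (1 + T) * K * (H1 + H2))\<^sup>2"
        unfolding power_mult_distrib CC(2) by (simp only: mult_ac)
      finally show "(L2_norm_on 0 T (\<lambda>x. Y x - Yr x))\<^sup>2 \<le> (C * (1 + T) * K * (H1 + H2))\<^sup>2" .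
    qed (use nonneg CC T in simp)
    moreover have "vnorm (Y x - Yr x) \<le> C' T * (1 + sqrt T) * K' * (sqrt T * W + H)" if x: "x \<in> {0..T}" for x
    proof (rule power2_le_imp_le)
      define b where "b = (1 + u) ^ 4"
      have "1 + u\<^sup>2 \<le> (1 + u)\<^sup>2" using u by (simp add: power2_sum)
      then have "(1 + u\<^sup>2)\<^sup>2 \<le> ((1 + u)\<^sup>2)\<^sup>2" by (rule power_mono) simp
      then have b: "(1 + u\<^sup>2)\<^sup>2 \<le> b" "u ^ 4 \<le> b"
        unfolding b_def using u by (auto simp: power_mult[symmetric] intro!: power_mono)
      have C'T: "C' T * (1 + u) * u = C0 * (1 + u)\<^sup>2"
        using u by (simp add: C'_def u_def[symmetric] field_simps power2_eq_square)
      have "(vnorm (Y x - Yr x))\<^sup>2 \<le> 2 * c' * ((1 + T) * K')\<^sup>2 * W\<^sup>2 + 320 * T * (K'\<^sup>2 * (4 * c * (T * W\<^sup>2 + H\<^sup>2)))"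
        using est(2)[OF x] by (simp only: K'_def W_def H_def)
      \<comment> \<open>Multiplication by \<open>u\<^sup>2\<close> clears the
        \<open>1 / sqrt T\<close> in \<open>C'\<close> and produces the combination
        \<open>u * W\<close>.\<close>
      then have "u\<^sup>2 * (vnorm (Y x - Yr x))\<^sup>2 \<le>
          u\<^sup>2 * (2 * c' * ((1 + T) * K')\<^sup>2 * W\<^sup>2 + 320 * T * (K'\<^sup>2 * (4 * c * (T * W\<^sup>2 + H\<^sup>2))))"
        by (rule mult_left_mono) simp
      also have "\<dots> = K'\<^sup>2 * ((2 * c' * (1 + u\<^sup>2)\<^sup>2 + 1280 * c * u ^ 4) * (u * W)\<^sup>2 + 1280 * c * u ^ 4 * H\<^sup>2)"
        by (simp add: u(2) power2_eq_square power4_eq_xxxx algebra_simps)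
      also have "\<dots> \<le> K'\<^sup>2 * ((2 * c' * b + 1280 * c * b) * (u * W)\<^sup>2 + (2 * c' * b + 1280 * c * b) * H\<^sup>2)"
      proof (intro mult_left_mono add_mono mult_right_mono b)
        have "1280 * c * u ^ 4 \<le> 1280 * c * b" using c b by (intro mult_left_mono) auto
        moreover have "0 \<le> 2 * c' * b" using c by (simp add: b_def)
        ultimately show "1280 * c * u ^ 4 \<le> 2 * c' * b + 1280 * c * b" by linarith
      qed (use c in auto)
      also have "\<dots> = K'\<^sup>2 * (C0\<^sup>2 * b) * ((u * W)\<^sup>2 + H\<^sup>2)"
        unfolding CC(4) by (simp add: algebra_simps)
      also have "\<dots> \<le> K'\<^sup>2 * (C0\<^sup>2 * b) * (u * W + H)\<^sup>2"
        using nonneg u by (intro mult_left_mono) (auto simp: power2_sum b_def)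
      also have "\<dots> = ((C0 * (1 + u)\<^sup>2) * K' * (u * W + H))\<^sup>2"
      proof -
        have "b = ((1 + u)\<^sup>2)\<^sup>2" by (simp add: b_def power_mult[symmetric])
        then show ?thesis by (simp only: power_mult_distrib mult_ac)
      qed
      also have "\<dots> = u\<^sup>2 * (C' T * (1 + sqrt T) * K' * (sqrt T * W + H))\<^sup>2"
        unfolding C'T[symmetric] u_def[symmetric] by (simp only: power_mult_distrib mult_ac)
      finally show "(vnorm (Y x - Yr x))\<^sup>2 \<le> (C' T * (1 + sqrt T) * K' * (sqrt T * W + H))\<^sup>2"
        using u by simp
    qed (use nonneg CC T in \<open>auto simp: C'_def\<close>)
    ultimately show "L2_norm_on 0 T (\<lambda>x. Y x - Yr x)
           \<le> C * (1 + T) * (mesh_size N t powr min (real r + 1) s / real r powr s) *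
             (H_norm M 0 T s Y + H_norm M 0 T s (\<lambda>x. D *\<^sub>v Y x))
       \<and> (\<forall>x\<in>{0..T}. vnorm (Y x - Yr x)
           \<le> C' T * (1 + sqrt T) * (mesh_size N t powr min (real r + 1) s / real r powr (s - 1)) *
             (sqrt T * Winf_norm M 0 T (s + 1) Y + H_norm M 0 T s R))"
      by (simp only: K_def K'_def H1_def H2_def H_def W_def ball_simps) blast
  qed
qed

end
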